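(* Let $a,b,n$ be positive integers with $a+b\leq n$. The index of $\mathfrak{p}_n^{\mathrm C}((n)\mid(a,b))$ is equal to zero if and only if one of the following conditions holds: (i) $a+b=n-1$ and $\gcd(a+b,\,b+1)=1$; (ii) $a+b=n-2$ and $\gcd(a+b,\,b+2)=1$; (iii) $a+b=n-3$, the integers $n$, $a$, and $b$ are all odd, and $\gcd(a+b,\,b+3)=2$.
   Context: The ground field is algebraically closed of characteristic zero. Index. For a Lie algebra $\mathfrak{g}$, $\operatorname{ind}\mathfrak{g}=\min_{f\in\mathfrak{g}^*}\dim\ker(B_f)$, where $B_f(x,y)=f([x,y])$ for $x,y\in\mathfrak{g}$. Symplectic Lie algebra. $\mathfrak{sp}(2n)$ is the Lie algebra of $2n\times 2n$ block matrices $\begin{bmatrix}A&B\\C&-\widehat{A}\end{bmatrix}$ with $A,B,C$ of size $n\times n$, $B=\widehat{B}$, $C=\widehat{C}$, where $\widehat{X}$ is the transpose of $X$ with respect to the antidiagonal. Use the triangular decomposition $\mathfrak{sp}(2n)=\mathfrak{u}_+\oplus\mathfrak{h}\oplus\mathfrak{u}_-$ into strictly upper triangular, diagonal, and strictly lower triangular matrices. Let $\Pi=\{\alpha_1,\dots,\alpha_n\}$ be the simple roots in the standard order with $\alpha_n$ the exceptional (long) root: writing $\epsilon_i$ for the $i$-th diagonal entry functional on $\mathfrak h$, $\alpha_i=\epsilon_i-\epsilon_{i+1}$ for $i<n$ and $\alpha_n=2\epsilon_n$. Let $\mathfrak{g}_\alpha$ denote the root space of $\alpha$. Seaweeds. For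 $\Psi,\Psi'\subseteq\Pi$, $\mathfrak{p}_n^{\mathrm C}(\Psi\mid\Psi')$ is the (standard) seaweed subalgebra $\mathfrak{p}\cap\mathfrak{p}'$ of $\mathfrak{sp}(2n)$, where $\mathfrak{p}\supseteq\mathfrak{h}\oplus\mathfrak{u}_+$ and $\mathfrak{p}'\supseteq\mathfrak{h}\oplus\mathfrak{u}_-$ are the parabolic subalgebras determined by $\Psi=\{\alpha\in\Pi:\mathfrak{g}_{-\alpha}\not\subseteq\mathfrak{p}\}$ and $\Psi'=\{\alpha\in\Pi:\mathfrak{g}_{\alpha}\not\subseteq\mathfrak{p}'\}$. Let $C_{\leq n}$ be the set of finite strings of positive integers (possibly the empty string $\emptyset$) with sum at most $n$. For $\underline{a}=(a_1,\dots,a_m)\in C_{\leq n}$ put $\varphi_{\mathrm C}(\underline{a})=\{\alpha_{a_1},\alpha_{a_1+a_2},\dots,\alpha_{a_1+\dots+a_m}\}$ (with $\varphi_{\mathrm C}(\emptyset)=\emptyset$), and define $\mathfrak{p}_n^{\mathrm C}(\underline{a}\mid\underline{b})=\mathfrak{p}_n^{\mathrm C}(\varphi_{\mathrm C}(\underline{a})\mid\varphi_{\mathrm C}(\underline{b}))$. *)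

theory Defs
  imports "Jordan_Normal_Form.VS_Connect"
begin

section \<open>Index of a Lie algebra\<close>

text \<open>The scalar ring as a module over itself, the target of linear functionals.\<close>

definition self_module :: "('k, 'r) ring_scheme \<Rightarrow> ('k, 'k) module" where
  "self_module K = \<lparr>carrier = carrier K, mult = mult K, one = one K,
     zero = zero K, add = add K, smult = mult K\<rparr>"

text \<open>Elements of \<open>lie_dual K L\<close> are only constrained on the carrier of \<open>L\<close>; everything below
  evaluates them only there.\<close>

definition lie_dual ::
  "('k, 'r) ring_scheme \<Rightarrow> ('k, 'v, 'm) module_scheme \<Rightarrow> ('v \<Rightarrow> 'k) set" where
  "lie_dual K L = LinearCombinations.module_hom K L (self_module K)"

definition form_kernel ::
  "('k, 'r) ring_scheme \<Rightarrow> ('k, 'v, 'm) module_scheme \<Rightarrow> ('v \<Rightarrow> 'v \<Rightarrow> 'v) \<Rightarrow> ('v \<Rightarrow> 'k) \<Rightarrow> 'v set"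
  where
  "form_kernel K L br f = {x \<in> carrier L. \<forall>y \<in> carrier L. f (br x y) = \<zero>\<^bsub>K\<^esub>}"

definition lie_index ::
  "('k, 'r) ring_scheme \<Rightarrow> ('k, 'v, 'm) module_scheme \<Rightarrow> ('v \<Rightarrow> 'v \<Rightarrow> 'v) \<Rightarrow> nat" where
  "lie_index K L br =
     (INF f \<in> lie_dual K L. vectorspace.dim K (L\<lparr>carrier := form_kernel K L br f\<rparr>))"


section \<open>The symplectic Lie algebra\<close>

text \<open>Matrix indices start at 0, so row \<open>i\<close> of the usual numbering is row \<open>i - 1\<close> here.\<close>

definition anti_transpose :: "'a mat \<Rightarrow> 'a mat" where
  "anti_transpose X = mat (dim_col X) (dim_row X)
     (\<lambda>(i, j). X $$ (dim_row X - 1 - j, dim_col X - 1 - i))"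

definition sp :: "nat \<Rightarrow> 'a::field mat set" where
  "sp n = {four_block_mat A B C (- anti_transpose A) | A B C.
     A \<in> carrier_mat n n \<and> B \<in> carrier_mat n n \<and> C \<in> carrier_mat n n \<and>
     B = anti_transpose B \<and> C = anti_transpose C}"

definition bracket :: "'a::field mat \<Rightarrow> 'a mat \<Rightarrow> 'a mat" where
  "bracket x y = x * y - y * x"

definition lie_subalgebra_sp :: "nat \<Rightarrow> 'a::field mat set \<Rightarrow> bool" where
  "lie_subalgebra_sp n p \<longleftrightarrow>
     p \<subseteq> sp n \<and>
     VectorSpace.subspace class_ring p (module_mat TYPE('a) (2 * n) (2 * n)) \<and>
     (\<forall>x \<in> p. \<forall>y \<in> p. bracket x y \<in> p)"

definition cartan :: "nat \<Rightarrow> 'a::field mat set" where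
  "cartan n = {x \<in> sp n. diagonal_mat x}"

definition u_plus :: "nat \<Rightarrow> 'a::field mat set" where
  "u_plus n = {x \<in> sp n. \<forall>i < 2 * n. \<forall>j \<le> i. x $$ (i, j) = 0}"

definition u_minus :: "nat \<Rightarrow> 'a::field mat set" where
  "u_minus n = {x \<in> sp n. \<forall>j < 2 * n. \<forall>i \<le> j. x $$ (i, j) = 0}"

text \<open>Roots are functionals on the Cartan subalgebra, given by formulas that make sense for all
  matrices.\<close>

definition eps :: "nat \<Rightarrow> 'a::field mat \<Rightarrow> 'a" where
  "eps i h = h $$ (i - 1, i - 1)"

definition simple_root :: "nat \<Rightarrow> nat \<Rightarrow> 'a::field mat \<Rightarrow> 'a" where
  "simple_root n i = (\<lambda>h. if i < n then eps i h - eps (i + 1) h else 2 * eps n h)"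

definition simple_roots :: "nat \<Rightarrow> ('a::field mat \<Rightarrow> 'a) set" where
  "simple_roots n = simple_root n ` {1..n}"

definition root_space :: "nat \<Rightarrow> ('a::field mat \<Rightarrow> 'a) \<Rightarrow> 'a mat set" where
  "root_space n \<alpha> = {x \<in> sp n. \<forall>h \<in> cartan n. bracket h x = \<alpha> h \<cdot>\<^sub>m x}"


section \<open>Seaweed subalgebras\<close>

text \<open>In characteristic zero, a subalgebra containing a Borel subalgebra is determined by the set of simple roots whose
  opposite root space it misses, and every set of simple roots occurs; so the definite descriptions
  below are well defined for \<open>\<Psi> \<subseteq> simple_roots n\<close>. Since \<open>p\<close> is a subspace, containing the direct
  sum of \<open>cartan n\<close> and \<open>u_plus n\<close> amounts to containing both summands.\<close>

definition parabolic_plus :: "nat \<Rightarrow> ('a::field mat \<Rightarrow> 'a) set \<Rightarrow> 'a mat set" where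
  "parabolic_plus n \<Psi> = (THE p. lie_subalgebra_sp n p \<and> cartan n \<union> u_plus n \<subseteq> p \<and>
     \<Psi> = {\<alpha> \<in> simple_roots n. \<not> root_space n (- \<alpha>) \<subseteq> p})"

definition parabolic_minus :: "nat \<Rightarrow> ('a::field mat \<Rightarrow> 'a) set \<Rightarrow> 'a mat set" where
  "parabolic_minus n \<Psi> = (THE p. lie_subalgebra_sp n p \<and> cartan n \<union> u_minus n \<subseteq> p \<and>
     \<Psi> = {\<alpha> \<in> simple_roots n. \<not> root_space n \<alpha> \<subseteq> p})"

definition seaweed :: "nat \<Rightarrow> ('a::field mat \<Rightarrow> 'a) set \<Rightarrow> ('a mat \<Rightarrow> 'a) set \<Rightarrow> 'a mat set" where
  "seaweed n \<Psi> \<Psi>' = parabolic_plus n \<Psi> \<inter> parabolic_minus n \<Psi>'"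

text \<open>Meant for lists \<open>cs\<close> of positive integers with sum at most \<open>n\<close>; the members are then the
  simple roots indexed by the partial sums of the nonempty prefixes of \<open>cs\<close>.\<close>

definition phi_C :: "nat \<Rightarrow> nat list \<Rightarrow> ('a::field mat \<Rightarrow> 'a) set" where
  "phi_C n cs = {simple_root n (sum_list (take k cs)) | k. 1 \<le> k \<and> k \<le> length cs}"

definition seaweed_C :: "nat \<Rightarrow> nat list \<Rightarrow> nat list \<Rightarrow> 'a::field mat set" where
  "seaweed_C n cs ds = seaweed n (phi_C n cs) (phi_C n ds)"

text \<open>The index of a subalgebra of \<open>sp n\<close>, with the vector space structure and commutator bracket of
  the \<open>2n \<times> 2n\<close> matrices.\<close>

definition index_sp :: "nat \<Rightarrow> 'a::field mat set \<Rightarrow> nat" where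
  "index_sp n g =
     lie_index class_ring ((module_mat TYPE('a) (2 * n) (2 * n))\<lparr>carrier := g\<rparr>) bracket"

end

theory Submission
  imports Defs
begin

text \<open>With \<open>r = n - a - b\<close>, the seaweed is the semidirect product of the block lower triangular matrices of
  block sizes \<open>(a, b, r)\<close> with the symmetric \<open>r \<times> r\<close> matrices. The index vanishes iff some linear functional has
  a nondegenerate commutator form. The part of such a functional on the symmetric matrices must itself be
  nondegenerate, since otherwise a rank one symmetric matrix lies in the kernel, so it can be normalised to
  the identity; what remains is a system of matrix equations for the kernel (\<open>HK\<close>), and the question is
  whether suitable parameters make it trivial.

  The system is then reduced in a Euclidean fashion through a companion system (\<open>EK\<close>). If a parameter block
  fails to have full rank, a kernel element can be written down at once; if it has full rank, some unknowns
  can be eliminated and a smaller system of one of the two types is left: step A lowers the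
  second size of \<open>EK\<close> by the first, step B passes from \<open>EK\<close> to \<open>HK\<close> when the second is at most the first, step C passes from \<open>HK\<close> to \<open>EK\<close> when \<open>r \<le> a\<close>, and step D splits off an
  orthogonal Lie algebra of size \<open>a\<close> when \<open>a < r\<close>, which admits a nondegenerate form only for \<open>a \<le> 1\<close>. The
  gcd conditions are exactly the invariants of this reduction.\<close>

section \<open>Finitely supported matrices\<close>

text \<open>The reduction meets images and kernels that are not spanned by coordinate vectors, and
  sizes change at every step. Hence blocks are idempotents in one ring without unit, and sizes are
  read off from traces, which determine ranks because the characteristic is zero. Every full rank
  claim has the same source: a map between two corners that is neither injective nor surjective is
  annihilated from both sides by some nonzero \<open>z\<close>, and such a \<open>z\<close> alone
  already solves the kernel equations. Transposition survives only on \<open>s\<close>; step D is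
  the one place where a complement must be compatible with it, and there a singular Gram matrix is
  the obstruction. The bound 3 on \<open>r\<close> arises as 1 + 1 + 1. Steps A, B and C keep
  \<open>r\<close>, whereas D turns \<open>(a, b, r)\<close> into \<open>(b, 0, r - a)\<close> with
  \<open>a\<close> at most 1. From then on the second size stays zero, so a further step D ends at
  \<open>(0, 0, r)\<close>, the orthogonal Lie algebra itself, where again \<open>r\<close> is at
  most 1. Algebraic closedness enters when the symmetric form is brought to the identity.\<close>

typedef (overloaded) 'a fmat =
  "{A :: nat \<Rightarrow> nat \<Rightarrow> 'a::zero. \<exists>N. \<forall>i j. A i j \<noteq> 0 \<longrightarrow> i < N \<and> j < N}"
  morphisms ent Fmat
  by (rule exI[of _ "\<lambda>_ _. 0"]) simp

setup_lifting type_definition_fmat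

lemma fmat_eqI: "(\<And>i j. ent A i j = ent B i j) \<Longrightarrow> A = B"
  by (metis ent_inject ext)

lemma ent_bound: "\<exists>N. \<forall>i j. ent A i j \<noteq> 0 \<longrightarrow> i < N \<and> j < N"
  using ent[of A] by auto

instantiation fmat :: (ab_group_add) ab_group_add
begin

lift_definition zero_fmat :: "'a fmat" is "\<lambda>_ _. 0" by simp

lift_definition plus_fmat :: "'a fmat \<Rightarrow> 'a fmat \<Rightarrow> 'a fmat" is "\<lambda>A B i j. A i j + B i j"
proof -
  fix A B :: "nat \<Rightarrow> nat \<Rightarrow> 'a"
  assume "\<exists>N. \<forall>i j. A i j \<noteq> 0 \<longrightarrow> i < N \<and> j < N" "\<exists>N. \<forall>i j. B i j \<noteq> 0 \<longrightarrow> i < N \<and> j < N"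
  then obtain N M where "\<forall>i j. A i j \<noteq> 0 \<longrightarrow> i < N \<and> j < N" "\<forall>i j. B i j \<noteq> 0 \<longrightarrow> i < M \<and> j < M"
    by blast
  then have "\<forall>i j. A i j + B i j \<noteq> 0 \<longrightarrow> i < max N M \<and> j < max N M"
    by (metis add.right_neutral less_max_iff_disj)
  then show "\<exists>N. \<forall>i j. A i j + B i j \<noteq> 0 \<longrightarrow> i < N \<and> j < N" by blast
qed

lift_definition uminus_fmat :: "'a fmat \<Rightarrow> 'a fmat" is "\<lambda>A i j. - A i j" by simp

definition minus_fmat :: "'a fmat \<Rightarrow> 'a fmat \<Rightarrow> 'a fmat" where
  "minus_fmat A B = A + - B"

lemma ent_zero [simp]: "ent 0 i j = 0"
  by (simp add: zero_fmat.rep_eq)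

lemma ent_plus [simp]: "ent (A + B) i j = ent A i j + ent B i j"
  by (simp add: plus_fmat.rep_eq)

lemma ent_uminus [simp]: "ent (- A) i j = - ent A i j"
  by (simp add: uminus_fmat.rep_eq)

lemma ent_minus [simp]: "ent (A - B) i j = ent A i j - ent B i j"
  by (simp add: minus_fmat_def)

instance
  by standard (simp_all add: fmat_eqI algebra_simps)

end

lemma ent_sum: "ent (sum f S) i j = (\<Sum>x\<in>S. ent (f x) i j)"
  by (induction S rule: infinite_finite_induct) auto

instantiation fmat :: (field) ring
begin

text \<open>Summing over the nonzero entries of a row of the left factor keeps the sum finite
  without fixing a size. \<open>ent_times_bound\<close> and \<open>ent_times_bound'\<close> later
  replace this range by any bound on the support of either factor.\<close>

lift_definition times_fmat :: "'a fmat \<Rightarrow> 'a fmat \<Rightarrow> 'a fmat" is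
  "\<lambda>A B i j. \<Sum>k | A i k \<noteq> 0. A i k * B k j"
proof -
  fix A B :: "nat \<Rightarrow> nat \<Rightarrow> 'a"
  assume "\<exists>N. \<forall>i j. A i j \<noteq> 0 \<longrightarrow> i < N \<and> j < N" "\<exists>N. \<forall>i j. B i j \<noteq> 0 \<longrightarrow> i < N \<and> j < N"
  then obtain N M where NM: "\<And>i j. A i j \<noteq> 0 \<Longrightarrow> i < N \<and> j < N" "\<And>i j. B i j \<noteq> 0 \<Longrightarrow> i < M \<and> j < M"
    by blast
  have "i < max N M \<and> j < max N M" if "(\<Sum>k | A i k \<noteq> 0. A i k * B k j) \<noteq> 0" for i j
  proof -
    obtain k where "A i k * B k j \<noteq> 0" using sum.not_neutral_contains_not_neutral[OF \<open>_ \<noteq> 0\<close>] by blast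
    then show ?thesis using NM(1)[of i k] NM(2)[of k j] by auto
  qed
  then show "\<exists>N. \<forall>i j. (\<Sum>k | A i k \<noteq> 0. A i k * B k j) \<noteq> 0 \<longrightarrow> i < N \<and> j < N" by blast
qed

lemma ent_times_bound:
  assumes "\<And>i k. ent A i k \<noteq> 0 \<Longrightarrow> k < N"
  shows "ent (A * B) i j = (\<Sum>k<N. ent A i k * ent B k j)"
  unfolding times_fmat.rep_eq
  by (rule sum.mono_neutral_left) (use assms in auto)

lemma ent_times_bound':
  assumes "\<And>k j. ent B k j \<noteq> 0 \<Longrightarrow> k < N"
  shows "ent (A * B) i j = (\<Sum>k<N. ent A i k * ent B k j)"
proof -
  obtain M where M: "\<And>i k. ent A i k \<noteq> 0 \<Longrightarrow> k < M" using ent_bound[of A] by metis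
  have "ent (A * B) i j = (\<Sum>k<max M N. ent A i k * ent B k j)"
    by (rule ent_times_bound) (use M less_max_iff_disj in blast)
  also have "\<dots> = (\<Sum>k<N. ent A i k * ent B k j)"
    by (rule sum.mono_neutral_right) (auto dest: assms)
  finally show ?thesis .
qed

instance
proof
  fix A B C :: "'a fmat"
  obtain N where N: "\<And>i k. ent A i k \<noteq> 0 \<Longrightarrow> k < N" using ent_bound[of A] by metis
  obtain M where M: "\<And>i k. ent B i k \<noteq> 0 \<Longrightarrow> k < M" using ent_bound[of B] by metis
  have AB: "k < M" if "ent (A * B) i k \<noteq> 0" for i k
  proof (rule ccontr)
    assume "\<not> k < M"
    then have "ent B l k = 0" for l using M by blast
    then show False using that by (simp add: ent_times_bound[OF N])
  qed
  show "A * B * C = A * (B * C)"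
  proof (rule fmat_eqI)
    fix i j
    have "ent (A * B * C) i j = (\<Sum>k<M. (\<Sum>l<N. ent A i l * ent B l k) * ent C k j)"
      by (subst ent_times_bound[OF AB], assumption, simp add: ent_times_bound[OF N])
    also have "\<dots> = (\<Sum>k<M. \<Sum>l<N. ent A i l * ent B l k * ent C k j)"
      by (simp add: sum_distrib_right)
    also have "\<dots> = (\<Sum>l<N. \<Sum>k<M. ent A i l * ent B l k * ent C k j)"
      by (rule sum.swap)
    also have "\<dots> = ent (A * (B * C)) i j"
      by (simp add: ent_times_bound[OF N] ent_times_bound[OF M] sum_distrib_left mult.assoc)
    finally show "ent (A * B * C) i j = ent (A * (B * C)) i j" .
  qed
  show "A * (B + C) = A * B + A * C"
    by (rule fmat_eqI) (simp add: ent_times_bound[OF N] algebra_simps sum.distrib)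
  obtain K where K: "\<And>k j. ent C k j \<noteq> 0 \<Longrightarrow> k < K" using ent_bound[of C] by metis
  show "(A + B) * C = A * C + B * C"
    by (rule fmat_eqI) (simp add: ent_times_bound'[OF K] algebra_simps sum.distrib)
qed

end

section \<open>Scalar multiples, transpose, matrix units and trace\<close>

lift_definition smul :: "'a::field \<Rightarrow> 'a fmat \<Rightarrow> 'a fmat" (infixr \<open>*f\<close> 75) is
  "\<lambda>c A i j. c * A i j"
  by (metis mult_zero_right)

lift_definition tp :: "'a::zero fmat \<Rightarrow> 'a fmat" is "\<lambda>A i j. A j i"
  by blast

definition munit :: "nat \<Rightarrow> nat \<Rightarrow> 'a::field fmat" where
  "munit k l = Fmat (\<lambda>i j. if i = k \<and> j = l then 1 else 0)"

definition tr :: "'a::field fmat \<Rightarrow> 'a" where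
  "tr A = (\<Sum>i | ent A i i \<noteq> 0. ent A i i)"

lemma ent_smul [simp]: "ent (c *f A) i j = c * ent A i j"
  by (simp add: smul.rep_eq)

lemma ent_tp [simp]: "ent (tp A) i j = ent A j i"
  by (simp add: tp.rep_eq)

lemma ent_munit: "ent (munit k l :: 'a::field fmat) i j = (if i = k \<and> j = l then 1 else 0)"
proof -
  have "\<exists>N. \<forall>i j. (if i = k \<and> j = l then 1 else (0 :: 'a)) \<noteq> 0 \<longrightarrow> i < N \<and> j < N"
    by (rule exI[of _ "Suc (max k l)"]) auto
  then have "ent (Fmat (\<lambda>i j. if i = k \<and> j = l then 1 else (0 :: 'a)))
      = (\<lambda>i j. if i = k \<and> j = l then 1 else 0)"
    by (intro Fmat_inverse) blast
  then show ?thesis by (simp add: munit_def)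
qed

lemma tr_bound:
  assumes "\<And>i. ent A i i \<noteq> 0 \<Longrightarrow> i < N"
  shows "tr A = (\<Sum>i<N. ent A i i)"
  unfolding tr_def by (rule sum.mono_neutral_left) (use assms in auto)

lemma tr_add [simp]: "tr (A + B) = tr A + tr B"
proof -
  obtain N where N: "\<And>i j. ent A i j \<noteq> 0 \<Longrightarrow> i < N \<and> j < N" using ent_bound[of A] by blast
  obtain M where M: "\<And>i j. ent B i j \<noteq> 0 \<Longrightarrow> i < M \<and> j < M" using ent_bound[of B] by blast
  have "tr (A + B) = (\<Sum>i<max N M. ent (A + B) i i)"
    by (rule tr_bound) (metis N M add.right_neutral ent_plus less_max_iff_disj)
  moreover have "tr A = (\<Sum>i<max N M. ent A i i)"
    by (rule tr_bound) (use N in force)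
  moreover have "tr B = (\<Sum>i<max N M. ent B i i)"
    by (rule tr_bound) (use M in force)
  ultimately show ?thesis by (simp add: sum.distrib)
qed

lemma tr_zero [simp]: "tr 0 = 0"
  by (simp add: tr_def)

lemma tr_smul [simp]: "tr (c *f A) = c * tr A"
proof -
  obtain N where N: "\<And>i j. ent A i j \<noteq> 0 \<Longrightarrow> i < N \<and> j < N" using ent_bound[of A] by blast
  have "tr (c *f A) = (\<Sum>i<N. ent (c *f A) i i)"
    by (rule tr_bound) (use N in force)
  moreover have "tr A = (\<Sum>i<N. ent A i i)"
    by (rule tr_bound) (use N in force)
  ultimately show ?thesis by (simp add: sum_distrib_left)
qed

lemma tr_uminus [simp]: "tr (- A) = - tr A"
  using tr_add[of A "- A"] by (simp add: eq_neg_iff_add_eq_0 add.commute)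

lemma tr_minus [simp]: "tr (A - B) = tr A - tr B"
  using tr_add[of A "- B"] by simp

lemma tr_sum: "tr (sum f S) = (\<Sum>x\<in>S. tr (f x))"
  by (induction S rule: infinite_finite_induct) auto

lemma tr_tp [simp]: "tr (tp A) = tr A"
  by (simp add: tr_def)

lemma tr_comm: "tr (A * B) = tr (B * A)"
proof -
  obtain N where N: "\<And>i j. ent A i j \<noteq> 0 \<Longrightarrow> i < N \<and> j < N" using ent_bound[of A] by blast
  obtain M where M: "\<And>i j. ent B i j \<noteq> 0 \<Longrightarrow> i < M \<and> j < M" using ent_bound[of B] by blast
  let ?K = "max N M"
  have AB: "ent (A * B) i j = (\<Sum>k<?K. ent A i k * ent B k j)" for i j
    by (rule ent_times_bound) (use N in force)
  have BA: "ent (B * A) i j = (\<Sum>k<?K. ent B i k * ent A k j)" for i j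
    by (rule ent_times_bound) (use M in force)
  have out: "ent A i k = 0" "ent B i k = 0" if "\<not> i < ?K" for i k
    using N[of i k] M[of i k] that by (auto simp: not_less)
  have "tr (A * B) = (\<Sum>i<?K. ent (A * B) i i)"
    by (rule tr_bound, rule ccontr) (simp add: AB out)
  also have "\<dots> = (\<Sum>i<?K. \<Sum>k<?K. ent A i k * ent B k i)" by (simp add: AB)
  also have "\<dots> = (\<Sum>k<?K. \<Sum>i<?K. ent A i k * ent B k i)" by (rule sum.swap)
  also have "\<dots> = (\<Sum>k<?K. ent (B * A) k k)" by (simp add: BA mult.commute)
  also have "\<dots> = tr (B * A)"
    by (rule tr_bound[symmetric], rule ccontr) (simp add: BA out)
  finally show ?thesis .
qed

lemma tp_tp [simp]: "tp (tp A) = A"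
  by (rule fmat_eqI) simp

lemma tp_zero [simp]: "tp 0 = 0"
  by (rule fmat_eqI) simp

lemma tp_add [simp]: "tp (A + B) = tp A + tp B"
  by (rule fmat_eqI) simp

lemma tp_minus [simp]: "tp (A - B) = tp A - tp B"
  by (rule fmat_eqI) simp

lemma tp_uminus [simp]: "tp (- A) = - tp A"
  by (rule fmat_eqI) simp

lemma tp_smul [simp]: "tp (c *f A) = c *f tp A"
  by (rule fmat_eqI) simp

lemma tp_munit [simp]: "tp (munit i j) = munit j i"
  by (rule fmat_eqI) (auto simp: ent_munit)

lemma tp_times [simp]: "tp (A * B) = tp B * tp (A :: 'a::field fmat)"
proof (rule fmat_eqI)
  fix i j
  obtain N where N: "\<And>i j. ent A i j \<noteq> 0 \<Longrightarrow> i < N \<and> j < N" using ent_bound[of A] by blast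
  have "ent (A * B) j i = (\<Sum>k<N. ent A j k * ent B k i)"
    by (rule ent_times_bound) (use N in force)
  moreover have "ent (tp B * tp A) i j = (\<Sum>k<N. ent (tp B) i k * ent (tp A) k j)"
    by (rule ent_times_bound') (use N in force)
  ultimately show "ent (tp (A * B)) i j = ent (tp B * tp A) i j" by (simp add: mult.commute)
qed

lemma ent_munit_left: "ent (munit k l * A) i j = (if i = k then ent A l j else 0)"
proof -
  have "ent (munit k l * A) i j = (\<Sum>m<Suc l. ent (munit k l) i m * ent A m j)"
    by (rule ent_times_bound) (auto simp: ent_munit split: if_splits)
  also have "\<dots> = (\<Sum>m<Suc l. if m = l then (if i = k then ent A l j else 0) else 0)"
    by (rule sum.cong) (auto simp: ent_munit)
  finally show ?thesis by simp
qed

lemma ent_munit_right: "ent (A * munit k l) i j = (if j = l then ent A i k else 0)"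
  using ent_munit_left[of l k "tp A" j i] tp_times[of A "munit k l"]
  by (metis ent_tp tp_munit)

lemma munit_times_munit: "munit i j * munit k l = (if j = k then munit i l else 0)"
  by (rule fmat_eqI) (auto simp: ent_munit_left ent_munit)

lemma munit_times_times_munit: "munit i j * A * munit k l = ent A j k *f munit i l"
  by (rule fmat_eqI) (auto simp: ent_munit_left ent_munit_right ent_munit)

lemma tr_munit: "tr (munit i j) = (if i = j then 1 else 0)"
proof -
  have "tr (munit i j) = (\<Sum>k<Suc i. ent (munit i j) k k)"
    by (rule tr_bound) (auto simp: ent_munit split: if_splits)
  also have "\<dots> = (\<Sum>k<Suc i. if k = i then (if i = j then 1 else 0) else 0)"
    by (rule sum.cong) (auto simp: ent_munit)
  finally show ?thesis by simp
qed

lemma tr_times_munit: "tr (A * munit i j) = ent A j i"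
proof -
  have "tr (A * munit i j) = (\<Sum>k<Suc j. ent (A * munit i j) k k)"
    by (rule tr_bound) (auto simp: ent_munit_right split: if_splits)
  also have "\<dots> = (\<Sum>k<Suc j. if k = j then ent A j i else 0)"
    by (rule sum.cong) (auto simp: ent_munit_right)
  finally show ?thesis by simp
qed

lemma smul_left [simp]: "(c *f A) * B = c *f (A * B)"
proof (rule fmat_eqI)
  fix i j
  obtain N where N: "\<And>i j. ent B i j \<noteq> 0 \<Longrightarrow> i < N \<and> j < N" using ent_bound[of B] by blast
  have "ent (X * B) i j = (\<Sum>k<N. ent X i k * ent B k j)" for X
    by (rule ent_times_bound') (use N in force)
  then show "ent (c *f A * B) i j = ent (c *f (A * B)) i j"
    by (simp add: sum_distrib_left mult.assoc)
qed

lemma smul_right [simp]: "A * (c *f B) = c *f (A * B)"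
proof -
  have "tp (A * (c *f B)) = tp (c *f (A * B))" by simp
  then show ?thesis by (metis tp_tp)
qed

lemma smul_smul [simp]: "c *f (d *f A) = (c * d) *f A"
  by (rule fmat_eqI) simp

lemma smul_one [simp]: "1 *f A = A"
  by (rule fmat_eqI) simp

lemma smul_zero_left [simp]: "0 *f A = 0"
  by (rule fmat_eqI) simp

lemma smul_zero [simp]: "c *f 0 = 0"
  by (rule fmat_eqI) simp

lemma smul_add: "c *f (A + B) = c *f A + c *f B"
  by (rule fmat_eqI) (simp add: algebra_simps)

lemma smul_eq_zero_iff [simp]: "c *f A = 0 \<longleftrightarrow> c = 0 \<or> A = 0"
proof -
  have "A = 0" if "c *f A = 0" "c \<noteq> 0"
  proof (rule fmat_eqI)
    fix i j
    show "ent A i j = ent 0 i j" using arg_cong[OF that(1), of "\<lambda>X. ent X i j"] that(2) by simp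
  qed
  then show ?thesis by auto
qed

lemma fmat_nonzero_ent: "A \<noteq> 0 \<Longrightarrow> \<exists>i j. ent A i j \<noteq> 0"
  using fmat_eqI[of A 0] by auto

lemma tr_nondegenerate: "(\<And>X. tr (A * X) = 0) \<Longrightarrow> A = 0"
  using fmat_nonzero_ent[of A] by (metis tr_times_munit)

lemma fmat_double_eq_zero:
  fixes A :: "'a::field_char_0 fmat"
  assumes "A + A = 0"
  shows "A = 0"
proof (rule fmat_eqI)
  fix i j
  have "2 * ent A i j = 0" using arg_cong[OF assms, of "\<lambda>X. ent X i j"]
    by (simp only: mult_2 ent_plus ent_zero)
  then show "ent A i j = ent 0 i j" by simp
qed

section \<open>Regularity and idempotents\<close>

lemma mult_assocI: "x * y = z \<Longrightarrow> x * (y * w) = z * w" for x :: "'a::semigroup_mult"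
  by (simp flip: mult.assoc)

definition nzrows :: "'a::zero fmat \<Rightarrow> nat set" where
  "nzrows A = {i. \<exists>j. ent A i j \<noteq> 0}"

lemma finite_nzrows: "finite (nzrows A)"
proof -
  obtain N where "\<And>i j. ent A i j \<noteq> 0 \<Longrightarrow> i < N \<and> j < N" using ent_bound[of A] by blast
  then have "nzrows A \<subseteq> {..<N}" by (auto simp: nzrows_def)
  then show ?thesis using finite_subset by blast
qed

text \<open>One step of Gaussian elimination. The subtracted rank one matrix agrees with
  \<open>x\<close> in row \<open>i\<close>, and in row \<open>k\<close> it is a multiple of row
  \<open>i\<close> with factor proportional to \<open>ent x k j\<close>, so zero rows stay zero. The
  number of nonzero rows thus serves as an induction measure.\<close>

lemma card_nzrows_pivot:
  assumes "ent x i j \<noteq> 0"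
  shows "card (nzrows (x - (1 / ent x i j) *f (x * munit j i * x))) < card (nzrows x)"
proof -
  have e: "ent (x * munit j i * x) k l = ent x k j * ent x i l" for k l
  proof -
    obtain N where N: "\<And>i j. ent x i j \<noteq> 0 \<Longrightarrow> i < N \<and> j < N" using ent_bound[of x] by blast
    have "ent (x * munit j i * x) k l = (\<Sum>m<N. (if m = i then ent x k j else 0) * ent x m l)"
      by (subst ent_times_bound'[of x N]) (use N in \<open>auto simp: ent_munit_right\<close>)
    also have "\<dots> = (\<Sum>m<N. if m = i then ent x k j * ent x i l else 0)"
      by (rule sum.cong) auto
    finally show ?thesis using N[OF assms] by simp
  qed
  have "nzrows (x - (1 / ent x i j) *f (x * munit j i * x)) \<subseteq> nzrows x - {i}"
  proof
    fix k assume "k \<in> nzrows (x - (1 / ent x i j) *f (x * munit j i * x))"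
    then obtain l where l: "ent x k l - ent x k j * ent x i l / ent x i j \<noteq> 0"
      by (auto simp: nzrows_def e)
    then have "k \<noteq> i" using assms by auto
    moreover have "ent x k l \<noteq> 0 \<or> ent x k j \<noteq> 0" using l by auto
    ultimately show "k \<in> nzrows x - {i}" by (auto simp: nzrows_def)
  qed
  moreover have "i \<in> nzrows x" using assms by (auto simp: nzrows_def)
  ultimately show ?thesis
    by (metis finite_nzrows psubset_card_mono Diff_subset card_Diff1_less card_mono finite_Diff
        order_le_less_trans)
qed

text \<open>Von Neumann regularity: an inner inverse of the remainder after one elimination step is
  corrected to an inner inverse of \<open>x\<close>.\<close>

lemma regular_aux: "\<exists>y. x * y * x = (x :: 'a::field fmat)"
proof (induction "card (nzrows x)" arbitrary: x rule: less_induct)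
  case less
  show ?case
  proof (cases "x = 0")
    case False
    then obtain i j where ij: "ent x i j \<noteq> 0" using fmat_nonzero_ent by blast
    define a where "a = (1 / ent x i j) *f munit j i"
    obtain y where y: "(x - x * a * x) * y * (x - x * a * x) = x - x * a * x"
      using less card_nzrows_pivot[OF ij] by (auto simp: a_def mult.assoc)
    \<comment> \<open>The middle factor is \<open>a + (1 - a * x) * y * (1 - x * a)\<close>,
      expanded because the ring has no unit.\<close>
    have "x * (a + y - a * x * y - y * x * a + a * x * y * x * a) * x
        = (x - x * a * x) * y * (x - x * a * x) + x * a * x"
      by (simp add: algebra_simps)
    also have "\<dots> = x" unfolding y by simp
    finally show ?thesis by blast
  qed auto
qed

lemma regular:
  obtains y where "x * y * x = (x :: 'a::field fmat)" "y * x * y = y"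
proof -
  obtain y where y: "x * y * x = x" using regular_aux by blast
  note y1 = y[unfolded mult.assoc]
  have y2: "x * (y * (x * w)) = x * w" for w
    using arg_cong[OF y, of "\<lambda>z. z * w"] by (simp only: mult.assoc)
  show ?thesis
    by (rule that[of "y * x * y"]) (simp_all add: mult.assoc y1 y2)
qed

section \<open>Standard idempotents, corners and ranks\<close>

definition dg :: "nat \<Rightarrow> 'a::field fmat" where
  "dg n = (\<Sum>k<n. munit k k)"

lemma dg_0 [simp]: "dg 0 = 0"
  by (simp add: dg_def)

lemma dg_Suc: "dg (Suc n) = dg n + munit n n"
  by (simp add: dg_def)

lemma ent_dg: "ent (dg n) i j = (if i = j \<and> i < n then 1 else 0)"
proof -
  have "ent (dg n) i j = (\<Sum>k<n. if k = i then (if i = j then 1 else 0) else 0)"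
    unfolding dg_def ent_sum by (rule sum.cong) (auto simp: ent_munit)
  then show ?thesis by auto
qed

lemma ent_dg_left: "ent (dg n * A) i j = (if i < n then ent A i j else 0)"
proof -
  have "ent (dg n * A) i j = (\<Sum>k<n. ent (dg n) i k * ent A k j)"
    by (rule ent_times_bound) (auto simp: ent_dg split: if_splits)
  also have "\<dots> = (\<Sum>k<n. if k = i then ent A i j else 0)"
    by (rule sum.cong) (auto simp: ent_dg)
  finally show ?thesis by simp
qed

lemma tp_dg [simp]: "tp (dg n) = dg n"
  by (rule fmat_eqI) (auto simp: ent_dg)

lemma ent_dg_right: "ent (A * dg n) i j = (if j < n then ent A i j else 0)"
  using ent_dg_left[of n "tp A" j i] tp_times[of A "dg n"] by (metis ent_tp tp_dg)

lemma dg_times_dg: "dg m * dg n = dg (min m n)"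
  by (rule fmat_eqI) (auto simp: ent_dg_left ent_dg)

lemma dg_munit [simp]: "dg n * munit n j = 0" "munit j n * dg n = 0"
  by (rule fmat_eqI; auto simp: ent_dg_left ent_dg_right ent_munit)+

lemma tr_dg [simp]: "tr (dg n) = of_nat n"
  by (induction n) (auto simp: dg_Suc tr_munit)

text \<open>Idempotents play the role of finite-dimensional vector spaces, with the trace as dimension, so that
  all sizes of matrices live in one ring and may be inducted on.\<close>

definition hom :: "'a::field fmat \<Rightarrow> 'a fmat \<Rightarrow> 'a fmat set" where
  "hom p q = {x. q * x = x \<and> x * p = x}"

abbreviation idem :: "'a::field fmat \<Rightarrow> bool" where
  "idem e \<equiv> e * e = e"

lemma homI: "q * x = x \<Longrightarrow> x * p = x \<Longrightarrow> x \<in> hom p q"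
  by (simp add: hom_def)

lemma homD: "x \<in> hom p q \<Longrightarrow> q * x = x" "x \<in> hom p q \<Longrightarrow> x * p = x"
  "x \<in> hom p q \<Longrightarrow> q * (x * y) = x * y" "x \<in> hom p q \<Longrightarrow> x * (p * y) = x * y"
  by (auto simp: hom_def simp flip: mult.assoc)

lemma hom_closed [intro, simp]:
  "0 \<in> hom p q"
  "x \<in> hom p q \<Longrightarrow> y \<in> hom p q \<Longrightarrow> x + y \<in> hom p q"
  "x \<in> hom p q \<Longrightarrow> y \<in> hom p q \<Longrightarrow> x - y \<in> hom p q"
  "x \<in> hom p q \<Longrightarrow> - x \<in> hom p q"
  "x \<in> hom p q \<Longrightarrow> c *f x \<in> hom p q"
  by (auto simp: hom_def algebra_simps)

lemma hom_comp [intro]: "y \<in> hom q r \<Longrightarrow> x \<in> hom p q \<Longrightarrow> y * x \<in> hom p r"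
  by (auto simp: hom_def mult.assoc) (simp flip: mult.assoc)

lemma hom_corner [intro]: "idem p \<Longrightarrow> idem q \<Longrightarrow> q * x * p \<in> hom p q"
  by (auto simp: hom_def mult.assoc) (simp flip: mult.assoc)

lemma hom_mono:
  assumes "x \<in> hom p q" "q' * q = q" "p * p' = p"
  shows "x \<in> hom p' q'"
proof (rule homI)
  have "q' * x = q' * q * x" using assms(1) by (simp add: homD mult.assoc)
  then show "q' * x = x" using assms by (simp add: homD)
  have "x * p' = x * (p * p')" using assms(1) by (simp add: homD flip: mult.assoc)
  then show "x * p' = x" using assms by (simp add: homD)
qed

text \<open>Murray-von Neumann equivalence with a standard idempotent. A pivot of \<open>e\<close>
  yields a rank one idempotent \<open>f\<close> below \<open>e\<close>; the induction hypothesis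
  handles \<open>e - f\<close>, and the extra dimension is sent to the next diagonal unit
  \<open>munit n n\<close>.\<close>

lemma idem_equiv_dg:
  assumes "idem (e :: 'a::field fmat)"
  shows "\<exists>n T P. P * T = e \<and> T * P = dg n \<and> T \<in> hom e (dg n) \<and> P \<in> hom (dg n) e"
  using assms
proof (induction "card (nzrows e)" arbitrary: e rule: less_induct)
  case less
  show ?case
  proof (cases "e = 0")
    case True
    then show ?thesis by (intro exI[of _ 0]) (simp add: hom_def)
  next
    case False
    then obtain i j where ij: "ent e i j \<noteq> 0" using fmat_nonzero_ent by blast
    define c where "c = 1 / ent e i j"
    define f where "f = c *f (e * munit j i * e)"
    note ee = less.prems mult_assocI[OF less.prems]
    have pivot: "munit k i * (e * munit j l) = (1 / c) *f munit k l" for k l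
      using munit_times_times_munit[of k i e j l] by (simp add: c_def mult.assoc)
    note pv = pivot mult_assocI[OF pivot]
    have c: "c \<noteq> 0" using ij by (simp add: c_def)
    have ff: "f * f = f"
      by (simp add: f_def mult.assoc ee pv mult_assocI[OF pivot, unfolded mult.assoc] c)
    have ef: "e * f = f" "f * e = f" by (simp_all add: f_def mult.assoc ee)
    have "idem (e - f)" by (simp add: algebra_simps ee ff ef)
    moreover have "card (nzrows (e - f)) < card (nzrows e)"
      using card_nzrows_pivot[OF ij] by (simp add: f_def c_def)
    ultimately obtain n T P where TP: "P * T = e - f" "T * P = dg n"
      "T \<in> hom (e - f) (dg n)" "P \<in> hom (dg n) (e - f)"
      using less.hyps by blast
    \<comment> \<open>With \<open>u * v = f\<close> and \<open>v * u = munit n n\<close>, this pair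
      identifies the image of \<open>f\<close> with the coordinate line of index \<open>n\<close>,
      the first one outside \<open>dg n\<close>.\<close>
    define u where "u = c *f (e * munit j n)"
    define v where "v = munit n i * e"
    have uv: "u * v = f"
      by (simp add: u_def v_def f_def mult.assoc)
         (simp add: munit_times_munit flip: mult.assoc[of "munit j n"])
    have vu: "v * u = munit n n"
      by (simp add: u_def v_def mult.assoc ee pv c)
    have fu: "f * u = u" "v * f = v"
      by (simp_all add: u_def v_def f_def mult.assoc ee pv c mult_assocI[OF pivot, unfolded mult.assoc])
    have eu: "e * u = u" "v * e = v" "u * munit n n = u" "munit n n * v = v"
      by (simp_all add: u_def v_def mult.assoc ee munit_times_munit)
         (simp add: munit_times_munit flip: mult.assoc)
    have z1: "P * v = 0"
    proof -
      have "P * v = P * (dg n * (munit n n * v))" using TP(4) eu by (simp add: homD)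
      also have "\<dots> = P * ((dg n * munit n n) * v)" by (simp only: mult.assoc)
      finally show ?thesis by simp
    qed
    have z2: "u * T = 0"
    proof -
      have "u * T = u * munit n n * (dg n * T)" using TP(3) eu by (simp add: homD)
      also have "\<dots> = u * ((munit n n * dg n) * T)" by (simp only: mult.assoc)
      finally show ?thesis by simp
    qed
    have z3: "T * u = 0"
    proof -
      have "T * u = T * ((e - f) * u)" using TP(3) by (simp add: homD)
      then show ?thesis by (simp add: left_diff_distrib fu eu)
    qed
    have z4: "v * P = 0"
    proof -
      have "v * P = v * (e - f) * P" using TP(4) by (simp add: homD mult.assoc)
      then show ?thesis by (simp add: right_diff_distrib fu eu)
    qed
    have eT: "T * e = T" "e * P = P"
    proof -
      have "(e - f) * e = e - f" "e * (e - f) = e - f" by (simp_all add: algebra_simps ee ef)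
      moreover have "T = T * (e - f)" "P = (e - f) * P" using TP by (simp_all add: homD)
      ultimately show "T * e = T" "e * P = P" by (metis mult.assoc)+
    qed
    have uP: "u * dg (Suc n) = u" "dg (Suc n) * v = v"
    proof -
      have "u * dg n = 0" "dg n * v = 0"
        unfolding u_def v_def by (simp_all add: mult.assoc) (simp flip: mult.assoc)
      then show "u * dg (Suc n) = u" "dg (Suc n) * v = v"
        by (simp_all add: dg_Suc algebra_simps eu)
    qed
    have dd: "dg (Suc n) * dg n = dg n" "dg n * dg (Suc n) = dg n"
      by (simp_all add: dg_times_dg)
    have "(P + u) * (T + v) = e" by (simp add: algebra_simps TP z1 z2 uv)
    moreover have "(T + v) * (P + u) = dg (Suc n)" by (simp add: algebra_simps TP z3 z4 vu dg_Suc)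
    moreover have "T + v \<in> hom e (dg (Suc n))"
    proof (rule homI)
      have dT: "dg n * T = T" using TP(3) by (simp add: homD)
      have "dg (Suc n) * T = dg (Suc n) * dg n * T" by (simp only: mult.assoc dT)
      also have "\<dots> = T" by (simp only: dd dT)
      finally show "dg (Suc n) * (T + v) = T + v" by (simp add: distrib_left uP)
      show "(T + v) * e = T + v" by (simp add: distrib_right eT eu)
    qed
    moreover have "P + u \<in> hom (dg (Suc n)) e"
    proof (rule homI)
      have dP: "P * dg n = P" using TP(4) by (simp add: homD)
      have "P * dg (Suc n) = P * (dg n * dg (Suc n))" by (simp only: dP flip: mult.assoc)
      also have "\<dots> = P" by (simp only: dd dP)
      finally show "(P + u) * dg (Suc n) = P + u" by (simp add: distrib_right uP)
      show "e * (P + u) = P + u" by (simp add: distrib_left eT eu)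
    qed
    ultimately show ?thesis by blast
  qed
qed

lemma idem_tr_nat: "idem e \<Longrightarrow> \<exists>n. tr e = of_nat n"
  using idem_equiv_dg[of e] tr_comm by (metis tr_dg)

text \<open>The equivalence preserves the trace, and in characteristic zero the trace determines the
  natural number \<open>n\<close>.\<close>

lemma idem_equiv_dg':
  assumes "idem (e :: 'a::field_char_0 fmat)" "tr e = of_nat n"
  obtains T P where "P * T = e" "T * P = dg n" "T \<in> hom e (dg n)" "P \<in> hom (dg n) e"
proof -
  obtain m T P where m: "P * T = e" "T * P = dg m" "T \<in> hom e (dg m)" "P \<in> hom (dg m) e"
    using idem_equiv_dg[OF assms(1)] by blast
  have "of_nat n = (of_nat m :: 'a)" using assms(2) tr_comm[of P T] m by simp
  then show ?thesis using that m by simp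
qed

lemma idem_tr_zero: "idem (e :: 'a::field_char_0 fmat) \<Longrightarrow> tr e = 0 \<Longrightarrow> e = 0"
proof -
  assume e: "idem e" "tr e = 0"
  have e0: "tr e = of_nat 0" using e by simp
  obtain T P where "P * T = e" "T \<in> hom e (dg 0)" using idem_equiv_dg'[OF e(1) e0] by blast
  then show "e = 0" by (simp add: hom_def)
qed

text \<open>Both idempotents are moved to standard position, where \<open>dg n\<close> lies below
  \<open>dg m\<close>.\<close>

lemma idem_embed:
  assumes "idem (e :: 'a::field_char_0 fmat)" "idem f" "tr e = of_nat n" "tr f = of_nat m" "n \<le> m"
  obtains T P where "T \<in> hom e f" "P \<in> hom f e" "P * T = e"
proof -
  obtain T1 P1 where 1: "P1 * T1 = e" "T1 * P1 = dg n" "T1 \<in> hom e (dg n)" "P1 \<in> hom (dg n) e"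
    using idem_equiv_dg'[OF assms(1,3)] by blast
  obtain T2 P2 where 2: "P2 * T2 = f" "T2 * P2 = dg m" "T2 \<in> hom f (dg m)" "P2 \<in> hom (dg m) f"
    using idem_equiv_dg'[OF assms(2,4)] by blast
  have dn: "dg m * dg n = dg n" "dg n * dg m = dg n"
    using assms(5) by (simp_all add: dg_times_dg min_def)
  have h: "T1 \<in> hom e (dg m)" "P1 \<in> hom (dg m) e"
    using hom_mono[OF 1(3)] hom_mono[OF 1(4)] dn assms(1) by auto
  have "P1 * T2 * (P2 * T1) = P1 * (T2 * P2 * T1)" by (simp only: mult.assoc)
  also have "\<dots> = e" using 1 2 h by (simp add: homD)
  finally show ?thesis using that[of "P2 * T1" "P1 * T2"] h 2 by blast
qed

lemma idem_sub: "idem f \<Longrightarrow> idem (e :: 'a::field fmat) \<Longrightarrow> e * f = f \<Longrightarrow> f * e = f \<Longrightarrow> idem (e - f)"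
  by (simp add: algebra_simps)

lemma retract_idem:
  assumes "T \<in> hom e f" "P \<in> hom f e" "P * T = e"
  shows "idem (T * P)" "T * P \<in> hom f f" "tr (T * P) = tr e"
proof -
  have "T * P * (T * P) = T * (P * T * P)" by (simp only: mult.assoc)
  then show "idem (T * P)" using assms by (simp add: homD)
  show "T * P \<in> hom f f" using assms by blast
  show "tr (T * P) = tr e" using assms(3) tr_comm[of T P] by simp
qed

text \<open>The complement \<open>e - f\<close> is idempotent too, so its trace is a natural number.
  This gives the inequality of ranks, and a complement of trace zero vanishes.\<close>

lemma idem_rank_diff:
  fixes e f :: "'a::field_char_0 fmat"
  assumes "idem f" "idem e" "f \<in> hom e e" "tr e = of_nat n" "tr f = of_nat m"
  shows "m \<le> n" "idem (e - f)" "tr (e - f) = of_nat (n - m)" "m = n \<Longrightarrow> f = e"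
proof -
  show id: "idem (e - f)"
    using idem_sub[OF assms(1,2)] assms(3) by (simp add: homD)
  then obtain k where k: "tr (e - f) = of_nat k" using idem_tr_nat by blast
  then have "of_nat n = (of_nat (m + k) :: 'a)" using assms by (simp add: algebra_simps)
  then have n: "n = m + k" by (simp only: of_nat_eq_iff)
  then show "m \<le> n" "tr (e - f) = of_nat (n - m)" using k by auto
  show "f = e" if "m = n" using idem_tr_zero[OF id] k n that by simp
qed

section \<open>Primeness of the matrix ring and one-sided inverses\<close>

lemma nonzero_mult_between: "A \<noteq> 0 \<Longrightarrow> B \<noteq> 0 \<Longrightarrow> \<exists>w. A * w * B \<noteq> (0 :: 'a::field fmat)"
proof -
  assume "A \<noteq> 0" "B \<noteq> 0"
  then obtain i j k l where "ent A i j \<noteq> 0" "ent B k l \<noteq> 0" using fmat_nonzero_ent by metis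
  moreover have "munit i i * (A * munit j k * B) * munit l l = (ent A i j * ent B k l) *f munit i l"
  proof -
    have "munit i i * (A * munit j k * B) * munit l l = (munit i i * A * munit j k) * B * munit l l"
      by (simp only: mult.assoc)
    then show ?thesis by (simp add: munit_times_times_munit)
  qed
  moreover have "munit i l \<noteq> (0 :: 'a fmat)"
    by (metis ent_munit ent_zero zero_neq_one)
  ultimately have "A * munit j k * B \<noteq> 0" by auto
  then show ?thesis by blast
qed

text \<open>If both defects \<open>p - y * x\<close> and \<open>q - x * y\<close> were nonzero,
  primeness would supply a nonzero map from the cokernel of \<open>x\<close> into its kernel, which
  \<open>x\<close> annihilates from both sides. In the reduction, \<open>nz\<close> comes from the
  kernel equations tested on a single unknown.\<close>

lemma inj_or_surj:
  fixes x :: "'a::field_char_0 fmat"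
  assumes "idem p" "idem q" "x \<in> hom p q"
    and nz: "\<And>z. z \<in> hom q p \<Longrightarrow> x * z = 0 \<Longrightarrow> z * x = 0 \<Longrightarrow> z = 0"
  obtains y where "y \<in> hom q p" "y * x = p" | y where "y \<in> hom q p" "x * y = q"
proof -
  obtain y0 where y0: "x * y0 * x = x" using regular by blast
  define y where "y = p * y0 * q"
  have y: "y \<in> hom q p" using assms y_def by blast
  have xyx: "x * y * x = x"
  proof -
    have "x * y * x = (x * p) * y0 * (q * x)" by (simp only: y_def mult.assoc)
    then show ?thesis using assms y0 by (simp add: homD)
  qed
  show ?thesis
  proof (cases "p - y * x = 0 \<or> q - x * y = 0")
    case True
    then show ?thesis using that y by auto
  next
    case False
    then obtain w where w: "(p - y * x) * w * (q - x * y) \<noteq> 0" using nonzero_mult_between by blast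
    let ?z = "(p - y * x) * w * (q - x * y)"
    have "p * (p - y * x) = p - y * x" "(q - x * y) * q = q - x * y"
      using assms y by (simp_all add: right_diff_distrib left_diff_distrib homD mult.assoc)
    then have "?z \<in> hom q p"
      by (intro homI) (metis mult.assoc)+
    moreover have "x * (p - y * x) = 0" "(q - x * y) * x = 0"
      using xyx assms by (simp_all add: right_diff_distrib left_diff_distrib homD mult.assoc)
    then have "x * ?z = 0" "?z * x = 0" by (metis mult.assoc mult_zero_left mult_zero_right)+
    ultimately show ?thesis using nz w by blast
  qed
qed

text \<open>If \<open>x\<close> has a right inverse \<open>y\<close> instead, then
  \<open>y * x\<close> is an idempotent of rank \<open>n\<close> inside \<open>p\<close>; since
  \<open>m \<le> n\<close> it is all of \<open>p\<close>.\<close>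

lemma inj_of_rank:
  fixes x :: "'a::field_char_0 fmat"
  assumes "idem p" "idem q" "x \<in> hom p q" "tr p = of_nat m" "tr q = of_nat n" "m \<le> n"
    and nz: "\<And>z. z \<in> hom q p \<Longrightarrow> x * z = 0 \<Longrightarrow> z * x = 0 \<Longrightarrow> z = 0"
  obtains y where "y \<in> hom q p" "y * x = p"
proof (rule inj_or_surj[OF assms(1-3) nz])
  fix y assume y: "y \<in> hom q p" "x * y = q"
  note r = retract_idem[OF y(1) assms(3) y(2)]
  have "y * x = p"
    using idem_rank_diff(1,4)[OF r(1) assms(1) r(2) assms(4), of n] r(3) assms by auto
  then show thesis using that y by blast
qed (use that in blast)+

lemma surj_of_rank:
  fixes x :: "'a::field_char_0 fmat"
  assumes "idem p" "idem q" "x \<in> hom p q" "tr p = of_nat m" "tr q = of_nat n" "n \<le> m"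
    and nz: "\<And>z. z \<in> hom q p \<Longrightarrow> x * z = 0 \<Longrightarrow> z * x = 0 \<Longrightarrow> z = 0"
  obtains y where "y \<in> hom q p" "x * y = q"
proof (rule inj_or_surj[OF assms(1-3) nz])
  fix y assume y: "y \<in> hom q p" "y * x = p"
  note r = retract_idem[OF assms(3) y]
  have "x * y = q"
    using idem_rank_diff(1,4)[OF r(1) assms(2) r(2) assms(5), of m] r(3) assms by auto
  then show thesis using that y by blast
qed (use that in blast)+

section \<open>Symmetric matrices on a corner\<close>

text \<open>A vector is encoded as a matrix supported in column 0. The diagonal of
  \<open>w * tp w\<close> consists of the squares of its entries, so isotropy of \<open>w\<close>
  does no harm.\<close>

lemma column_square_nonzero:
  assumes "w * munit 0 0 = w" "w \<noteq> (0 :: 'a::field fmat)"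
  shows "w * tp w \<noteq> 0"
proof -
  obtain i j where ij: "ent w i j \<noteq> 0" using assms(2) fmat_nonzero_ent by blast
  have "munit 0 0 * tp w = tp w" using arg_cong[OF assms(1), of tp] by simp
  then have "munit 0 i * (w * tp w) * munit i 0 = (munit 0 i * w * munit 0 0) * (munit 0 0 * tp w * munit i 0)"
    using assms(1) by (simp add: mult.assoc)
  also have "\<dots> = (ent w i 0 * ent w i 0) *f munit 0 0"
    by (simp add: munit_times_times_munit munit_times_munit)
  finally have *: "munit 0 i * (w * tp w) * munit i 0 = (ent w i 0 * ent w i 0) *f munit 0 0" .
  have "ent (w * munit 0 0) i j \<noteq> 0" using ij by (simp only: assms(1) simp_thms)
  then have "j = 0" by (simp add: ent_munit_right split: if_splits)
  moreover have "munit 0 0 \<noteq> (0 :: 'a fmat)" by (metis ent_munit ent_zero zero_neq_one)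
  ultimately show ?thesis using * ij by force
qed

lemma nonzero_column: "v \<noteq> 0 \<Longrightarrow> \<exists>j. v * munit j 0 \<noteq> (0 :: 'a::field fmat)"
  using fmat_nonzero_ent[of v] by (metis ent_munit_right ent_zero)

text \<open>An inner inverse \<open>y\<close> of \<open>S\<close> is either a left inverse, and
  transposing shows that it is symmetric and two-sided, or has a defect \<open>s - y * S\<close>
  whose columns lie in the kernel of \<open>S\<close>.\<close>

lemma symmetric_inverse_or_kernel:
  fixes S :: "'a::field_char_0 fmat"
  assumes "idem s" "tp s = s" "S \<in> hom s s" "tp S = S"
  obtains B where "B \<in> hom s s" "B * S = s" "S * B = s" "tp B = B"
  | w where "w * munit 0 0 = w" "w \<noteq> 0" "s * w = w" "S * w = 0"
proof -
  obtain y0 where y0: "S * y0 * S = S" using regular by blast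
  define y where "y = s * y0 * s"
  have y: "y \<in> hom s s" using assms y_def by blast
  have SyS: "S * y * S = S"
  proof -
    have "S * y * S = (S * s) * y0 * (s * S)" by (simp only: y_def mult.assoc)
    then show ?thesis using assms y0 by (simp add: homD)
  qed
  show ?thesis
  proof (cases "s - y * S = 0")
    case True
    then have yS: "y * S = s" by simp
    then have Sy: "S * tp y = s" using assms by (metis tp_times)
    have ty: "tp y \<in> hom s s" using y assms(2) by (auto simp: hom_def) (metis tp_times)+
    have "y = y * (S * tp y)" using Sy y by (simp add: homD)
    also have "\<dots> = s * tp y" using yS by (simp flip: mult.assoc)
    finally have "y = tp y" using ty by (simp add: homD)
    then show ?thesis using that(1) y yS Sy by metis
  next
    case False
    then obtain j where j: "(s - y * S) * munit j 0 \<noteq> 0" using nonzero_column by blast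
    have "S * (s - y * S) = 0" "s * (s - y * S) = s - y * S"
      using SyS assms y by (simp_all add: right_diff_distrib homD mult.assoc)
    then have "S * ((s - y * S) * munit j 0) = 0" "s * ((s - y * S) * munit j 0) = (s - y * S) * munit j 0"
      by (simp_all flip: mult.assoc)
    moreover have "(s - y * S) * munit j 0 * munit 0 0 = (s - y * S) * munit j 0"
      by (simp add: mult.assoc munit_times_munit)
    ultimately show ?thesis using that(2) j by blast
  qed
qed

text \<open>Some diagonal entry of \<open>s\<close> is nonzero, since the trace is. The orthogonal
  projection onto that column of \<open>s\<close> works: the square length of the column is the
  diagonal entry.\<close>

lemma symmetric_rank_one_idem:
  fixes s :: "'a::field_char_0 fmat"
  assumes "idem s" "tp s = s" "s \<noteq> 0"
  obtains f where "idem f" "tp f = f" "f \<in> hom s s" "tr f = 1"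
proof -
  have "tr s \<noteq> 0" using assms idem_tr_zero by blast
  then obtain i where i: "ent s i i \<noteq> 0" unfolding tr_def by (metis (mono_tags) sum.neutral)
  define c where "c = 1 / ent s i i"
  define f where "f = c *f (s * munit i i * s)"
  note ee = assms(1) mult_assocI[OF assms(1)]
  have pivot: "munit i i * (s * munit i i) = (1 / c) *f munit i i"
    using munit_times_times_munit[of i i s i i] by (simp add: c_def mult.assoc)
  have "f * f = f" using i
    by (simp add: f_def mult.assoc ee mult_assocI[OF pivot, unfolded mult.assoc] c_def)
  moreover have "tp f = f" by (simp add: f_def assms mult.assoc)
  moreover have "f \<in> hom s s" by (simp add: f_def hom_def mult.assoc ee)
  moreover have "tr f = c * tr (s * munit i i)"
    using tr_comm[of "s * munit i i" s] by (simp add: f_def ee flip: mult.assoc)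
  then have "tr f = 1" using i by (simp add: tr_times_munit c_def)
  ultimately show ?thesis using that by blast
qed

text \<open>Polarisation: if the basis vectors are all isotropic, the sum of the \<open>i\<close>-th
  and the \<open>j\<close>-th has value \<open>2 * ent B i j\<close>.\<close>

lemma symmetric_nonisotropic:
  fixes B :: "'a::field_char_0 fmat"
  assumes "tp B = B" "B \<noteq> 0"
  obtains w \<beta> where "w * munit 0 0 = w" "\<beta> \<noteq> 0" "tp w * B * w = \<beta> *f munit 0 0"
proof -
  obtain i j where ij: "ent B i j \<noteq> 0" using assms(2) fmat_nonzero_ent by blast
  have sym: "ent B j i = ent B i j" using arg_cong[OF assms(1), of "\<lambda>X. ent X i j"] by simp
  show ?thesis
  proof (cases "\<exists>k. ent B k k \<noteq> 0")
    case True
    then obtain k where "ent B k k \<noteq> 0" by blast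
    then show ?thesis
      using that[of "munit k 0" "ent B k k"] by (simp add: munit_times_munit munit_times_times_munit)
  next
    case False
    let ?w = "munit i 0 + munit j 0 :: 'a fmat"
    have "tp ?w * B * ?w = (2 * ent B i j) *f munit 0 0"
      using False sym
      by (simp add: algebra_simps munit_times_times_munit[unfolded mult.assoc])
         (rule fmat_eqI, simp)
    moreover have "?w * munit 0 0 = ?w" by (simp add: distrib_right munit_times_munit)
    ultimately show ?thesis using that[of ?w "2 * ent B i j"] ij by simp
  qed
qed

text \<open>Orthonormalisation of a symmetric form that is invertible on a corner: a nonisotropic
  vector is normalised, its rank one contribution is removed from \<open>B\<close>, and the rest is
  invertible on a corner of rank one less.\<close>

lemma symmetric_factorization:
  fixes s :: "'a::{alg_closed_field, field_char_0} fmat"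
  assumes "idem s" "tr s = of_nat n" "s * B = B" "tp B = B" "B * S = s"
  shows "\<exists>C D. C * D = s \<and> D * C = dg n \<and> C * tp C = B \<and> C \<in> hom (dg n) s \<and> D \<in> hom s (dg n)"
  using assms
proof (induction n arbitrary: s B S)
  case 0
  then have "s = 0" using idem_tr_zero by simp
  then show ?case using 0 by (intro exI[of _ 0]) (simp add: hom_def)
next
  case (Suc n)
  have "s \<noteq> 0" using Suc.prems(2) by (metis of_nat_eq_0_iff old.nat.distinct(2) tr_zero)
  then have "B \<noteq> 0" using Suc.prems(5) by auto
  then obtain w0 \<beta> where w0: "w0 * munit 0 0 = w0" "\<beta> \<noteq> 0" "tp w0 * B * w0 = \<beta> *f munit 0 0"
    using symmetric_nonisotropic Suc.prems(4) by blast
  \<comment> \<open>The square root for which the field has to be algebraically closed.\<close>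
  obtain \<gamma> where g: "\<gamma> ^ 2 = \<beta>" using nth_root_exists[of 2 \<beta>] by auto
  have g0: "\<gamma> \<noteq> 0" using g w0 by auto
  note ss = Suc.prems(1) mult_assocI[OF Suc.prems(1)]
  note sB = Suc.prems(3) mult_assocI[OF Suc.prems(3)]
  have Bts: "B * tp s = B" using arg_cong[OF sB(1), of tp] Suc.prems(4) by simp
  note Bts' = Bts mult_assocI[OF Bts]
  \<comment> \<open>The value of the form is the same as for \<open>w0\<close>, because
    \<open>B = s * B * tp s\<close>, but now \<open>tp w\<close> absorbs \<open>s\<close>.\<close>
  define w where "w = tp s * w0"
  have ws: "tp w * s = tp w" by (simp add: w_def mult.assoc ss)
  note ws' = ws mult_assocI[OF ws]
  have w1: "w * munit 0 0 = w" by (simp add: w_def w0 mult.assoc)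
  have w2: "munit 0 0 * tp w = tp w" using arg_cong[OF w1, of tp] by simp
  have wBw: "tp w * (B * w) = \<beta> *f munit 0 0"
    using w0(3) by (simp add: w_def mult.assoc sB Bts')
  note wBw' = wBw mult_assocI[OF wBw, unfolded mult.assoc]
  \<comment> \<open>\<open>v * u\<close> becomes the matrix unit at the new index \<open>n\<close>,
    and \<open>u * tp u = f * B\<close> is the part of \<open>B\<close> to be removed.\<close>
  define u where "u = (1 / \<gamma>) *f (B * w * munit 0 n)"
  define v where "v = (1 / \<gamma>) *f (munit n 0 * tp w)"
  define f where "f = u * v"
  have gg: "1 / (\<gamma> * \<gamma>) = 1 / \<beta>" using g by (simp add: power2_eq_square)
  have vu: "v * u = munit n n"
    using w0(2) g g0
    by (simp add: u_def v_def mult.assoc wBw' munit_times_munit power2_eq_square)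
  have su: "s * u = u" by (simp add: u_def sB flip: mult.assoc)
  have vs: "v * s = v" by (simp add: v_def mult.assoc ws)
  have un: "u * munit n n = u" by (simp add: u_def mult.assoc munit_times_munit)
  have vn: "munit n n * v = v"
    by (simp add: v_def munit_times_munit flip: mult.assoc)
  have u0: "u * dg n = 0" by (simp add: u_def mult.assoc)
  have v0: "dg n * v = 0" by (simp add: v_def flip: mult.assoc)
  have fu: "f * u = u" by (simp add: f_def mult.assoc vu un)
  have vf: "v * f = v" by (simp add: f_def vu vn flip: mult.assoc)
  have ff: "f * f = f" by (simp add: f_def mult.assoc mult_assocI[OF vu] vn)
  have sf: "s * f = f" "f * s = f" by (simp_all add: f_def mult.assoc vs) (simp add: su flip: mult.assoc)
  have uu: "u * tp u = f * B"
    by (simp add: u_def v_def f_def mult.assoc Suc.prems(4))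
  have utu: "tp (u * tp u) = u * tp u" by simp
  have Bf: "B * tp f = f * B" using utu Suc.prems(4) unfolding uu by simp
  define s' where "s' = s - f"
  define B' where "B' = B - f * B"
  have s's': "idem s'" unfolding s'_def by (rule idem_sub[OF ff Suc.prems(1) sf])
  have "tr f = 1" using tr_comm[of u v] vu by (simp add: f_def tr_munit)
  then have "tr s' = of_nat n" using Suc.prems(2) by (simp add: s'_def)
  moreover have B'1: "B' = s' * B" by (simp add: B'_def s'_def left_diff_distrib sB)
  then have "s' * B' = B'" using s's' by (simp flip: mult.assoc)
  moreover have tB': "tp B' = B'" by (simp add: B'_def Suc.prems(4) Bf)
  moreover have "B' * (S * s') = s'"
  proof -
    have "B' * (S * s') = s' * (B * S) * s'" by (simp only: B'1 mult.assoc)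
    also have "\<dots> = s' * s'" unfolding Suc.prems(5) by (simp add: s'_def algebra_simps ss sf)
    finally show ?thesis using s's' by simp
  qed
  ultimately obtain C D where CD: "C * D = s'" "D * C = dg n" "C * tp C = B'"
    "C \<in> hom (dg n) s'" "D \<in> hom s' (dg n)"
    using Suc.IH[of s' B' "S * s'"] s's' by blast
  have z1: "C * v = 0"
  proof -
    have "C * v = C * (dg n * v)" using CD(4) by (simp add: homD)
    then show ?thesis by (simp add: v0)
  qed
  have z2: "u * D = 0"
  proof -
    have "u * D = u * dg n * D" using CD(5) by (simp add: homD mult.assoc)
    then show ?thesis by (simp add: u0)
  qed
  have z3: "D * u = 0"
  proof -
    have "D * u = D * (s' * u)" using CD(5) by (simp add: homD)
    then show ?thesis by (simp add: s'_def left_diff_distrib su fu)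
  qed
  have z4: "v * C = 0"
  proof -
    have "v * C = v * s' * C" using CD(4) by (simp add: homD mult.assoc)
    then show ?thesis by (simp add: s'_def right_diff_distrib vs vf)
  qed
  have z5: "u * tp C = 0"
  proof -
    have "tp C = dg n * tp C" using arg_cong[OF homD(2)[OF CD(4)], of tp] by simp
    then have "u * tp C = u * dg n * tp C" by (metis mult.assoc)
    then show ?thesis by (simp add: u0)
  qed
  have z6: "C * tp u = 0" using arg_cong[OF z5, of tp] by simp
  have dd: "dg (Suc n) * dg n = dg n" "dg n * dg (Suc n) = dg n"
    by (simp_all add: dg_times_dg)
  have ss': "s * s' = s'" "s' * s = s'" by (simp_all add: s'_def algebra_simps ss sf)
  have h: "C \<in> hom (dg (Suc n)) s" "D \<in> hom s (dg (Suc n))"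
    using hom_mono[OF CD(4)] hom_mono[OF CD(5)] dd ss' by auto
  have "u \<in> hom (dg (Suc n)) s" "v \<in> hom s (dg (Suc n))"
    by (auto simp: hom_def su vs dg_Suc distrib_left distrib_right u0 un v0 vn)
  then have "C + u \<in> hom (dg (Suc n)) s" "D + v \<in> hom s (dg (Suc n))" using h by auto
  moreover have "(C + u) * (D + v) = s" by (simp add: algebra_simps CD z1 z2 s'_def f_def)
  moreover have "(D + v) * (C + u) = dg (Suc n)" by (simp add: algebra_simps CD z3 z4 vu dg_Suc)
  moreover have "(C + u) * tp (C + u) = B" by (simp add: algebra_simps CD z5 z6 uu B'_def)
  ultimately show ?case by blast
qed

lemma hom_annihilate:
  assumes "x \<in> hom p q"
  shows "r * q = 0 \<Longrightarrow> r * x = 0" "p * r = 0 \<Longrightarrow> x * r = 0"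
    "r * q = q \<Longrightarrow> r * x = x" "p * r = p \<Longrightarrow> x * r = x"
proof -
  have "r * x = r * q * x" "x * r = x * (p * r)"
    using assms by (simp_all add: homD mult.assoc)
  then show "r * q = 0 \<Longrightarrow> r * x = 0" "p * r = 0 \<Longrightarrow> x * r = 0"
    "r * q = q \<Longrightarrow> r * x = x" "p * r = p \<Longrightarrow> x * r = x"
    using assms by (simp_all add: homD)
qed

section \<open>The reduced kernel equations\<close>

text \<open>\<open>(X, Z, Y)\<close> are the blocks of a block lower triangular matrix with respect to \<open>(q + p, s)\<close>, and
  \<open>(F, T, G)\<close> are the blocks of the functional. The last equation says that the \<open>s\<close>-block of the commutator
  equals twice the component in the symmetric matrices, which has thereby been eliminated. In \<open>EK\<close> a
  second corner \<open>k\<close> carries no symmetry condition.\<close>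

definition HK where
  "HK q p s F T G X Y Z \<longleftrightarrow>
     X \<in> hom (q + p) (q + p) \<and> q * X * p = 0 \<and> Y \<in> hom s s \<and> tp Y = - Y \<and> Z \<in> hom (q + p) s \<and>
     T * Y = X * T \<and> q * (F * X - X * F + T * Z) = 0 \<and> (F * X - X * F + T * Z) * p = 0 \<and>
     tp (G * Y - Y * G - Z * T) = G * Y - Y * G - Z * T"

text \<open>Lie algebras of index zero are called Frobenius, whence the prefix \<open>frob\<close>.
  Parameters are quantified existentially because the index is a minimum over functionals.\<close>

definition frobH where
  "frobH q p s \<longleftrightarrow> (\<exists>F \<in> hom (q + p) (q + p). \<exists>T \<in> hom s (q + p). \<exists>G \<in> hom s s.
     \<forall>X Y Z. HK q p s F T G X Y Z \<longrightarrow> X = 0 \<and> Y = 0 \<and> Z = 0)"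

definition EK where
  "EK c k s F Ts Tk Gs Gk X Y W Zs Zk \<longleftrightarrow>
     X \<in> hom c c \<and> Y \<in> hom s s \<and> tp Y = - Y \<and> W \<in> hom k k \<and> Zs \<in> hom c s \<and> Zk \<in> hom c k \<and>
     F * X - X * F + Ts * Zs + Tk * Zk = 0 \<and> Ts * Y = X * Ts \<and> Tk * W = X * Tk \<and>
     tp (Gs * Y - Y * Gs - Zs * Ts) = Gs * Y - Y * Gs - Zs * Ts \<and> Gk * W - W * Gk - Zk * Tk = 0"

definition frobE where
  "frobE c k s \<longleftrightarrow> (\<exists>F \<in> hom c c. \<exists>Ts \<in> hom s c. \<exists>Tk \<in> hom k c. \<exists>Gs \<in> hom s s. \<exists>Gk \<in> hom k k.
     \<forall>X Y W Zs Zk. EK c k s F Ts Tk Gs Gk X Y W Zs Zk \<longrightarrow> X = 0 \<and> Y = 0 \<and> W = 0 \<and> Zs = 0 \<and> Zk = 0)"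

section \<open>Step A: \<open>Tk\<close> is surjective\<close>

text \<open>\<open>\<kappa>\<close> projects onto the kernel of the surjection \<open>Tk\<close>.
  The equation \<open>Tk * W = X * Tk\<close> says that \<open>W\<close> preserves this kernel and
  induces \<open>X\<close> on the quotient, and the last equation of \<open>EK\<close> determines
  \<open>Zk\<close>. What remains of \<open>W\<close> takes over the roles of \<open>W\<close> and
  \<open>Zk\<close>, and eliminating the old \<open>Zk\<close> shifts \<open>F\<close>.\<close>

lemma stepA_kernel:
  fixes c k s F Ts Tk Gs Gk P :: "'a::field fmat"
  assumes id: "idem c" "idem k" "idem s"
    and h: "F \<in> hom c c" "Ts \<in> hom s c" "Tk \<in> hom k c" "Gs \<in> hom s s" "Gk \<in> hom k k"
    and P: "P \<in> hom c k" "Tk * P = c"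
    and \<kappa>: "\<kappa> = k - P * Tk"
  shows "(\<forall>X Y W Zs Zk. EK c k s F Ts Tk Gs Gk X Y W Zs Zk \<longrightarrow> X = 0 \<and> Y = 0 \<and> W = 0 \<and> Zs = 0 \<and> Zk = 0)
    \<longleftrightarrow> (\<forall>X Y W Zs Zk. EK c \<kappa> s (F + Tk * Gk * P) Ts (Tk * Gk * \<kappa>) Gs (\<kappa> * Gk * \<kappa>) X Y W Zs Zk \<longrightarrow>
      X = 0 \<and> Y = 0 \<and> W = 0 \<and> Zs = 0 \<and> Zk = 0)" (is "?L \<longleftrightarrow> ?R")
proof
  note R0 = id homD(1,2)[OF h(1)] homD(1,2)[OF h(2)] homD(1,2)[OF h(3)] homD(1,2)[OF h(4)] homD(1,2)[OF h(5)]
    homD(1,2)[OF P(1)] P(2)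
  have K: "\<kappa> * \<kappa> = \<kappa>" "k * \<kappa> = \<kappa>" "\<kappa> * k = \<kappa>" "\<kappa> * P = 0" "Tk * \<kappa> = 0"
    unfolding \<kappa> by (simp_all add: algebra_simps R0 R0[THEN mult_assocI])
  {
    assume R: ?R
    show ?L
    proof (intro allI impI)
      fix X Y W Zs Zk
      assume "EK c k s F Ts Tk Gs Gk X Y W Zs Zk"
      then have X: "X \<in> hom c c" and Y: "Y \<in> hom s s" "tp Y = - Y" and W: "W \<in> hom k k"
        and Zs: "Zs \<in> hom c s" and Zk: "Zk \<in> hom c k"
        and e1: "F * X - X * F + Ts * Zs + Tk * Zk = 0" and e2: "Ts * Y = X * Ts" and e3: "Tk * W = X * Tk"
        and e4: "tp (Gs * Y - Y * Gs - Zs * Ts) = Gs * Y - Y * Gs - Zs * Ts"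
        and e5: "Gk * W - W * Gk - Zk * Tk = 0"
        by (auto simp: EK_def)
      have e1': "F * X = X * F - Ts * Zs - Tk * Zk" using e1 by (simp add: algebra_simps)
      have e5': "Gk * W = W * Gk + Zk * Tk" using e5 by (simp add: algebra_simps)
      note R1 = R0 homD(1,2)[OF X] homD(1,2)[OF W] homD(1,2)[OF Zk] e1' e3 e5'
      note R1' = R1 R1[THEN mult_assocI]
      \<comment> \<open>The part of \<open>W\<close> inside the kernel of \<open>Tk\<close> is the
        new \<open>W\<close>; the part from the complement into the kernel is the new
        \<open>Zk\<close>.\<close>
      have "EK c \<kappa> s (F + Tk * Gk * P) Ts (Tk * Gk * \<kappa>) Gs (\<kappa> * Gk * \<kappa>) X Y (\<kappa> * W * \<kappa>) Zs (\<kappa> * W * P)"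
        unfolding EK_def
      proof (intro conjI X Y Zs e2 e4)
        show "\<kappa> * W * \<kappa> \<in> hom \<kappa> \<kappa>" "\<kappa> * W * P \<in> hom c \<kappa>"
          by (simp_all add: hom_def mult.assoc K K[THEN mult_assocI] R0)
      qed (simp_all add: \<kappa> algebra_simps R1')
      with R have z: "X = 0" "Y = 0" "\<kappa> * W * \<kappa> = 0" "Zs = 0" "\<kappa> * W * P = 0" by blast+
      have "W = P * (Tk * W) + (\<kappa> * W * P) * Tk + \<kappa> * W * \<kappa>"
        by (simp add: \<kappa> algebra_simps R1')
      then have "W = 0" using z by (simp add: e3)
      moreover have "Zk = Zk * Tk * P" by (simp add: mult.assoc R1')
      then have "Zk = 0" using e5 \<open>W = 0\<close> by simp
      ultimately show "X = 0 \<and> Y = 0 \<and> W = 0 \<and> Zs = 0 \<and> Zk = 0" using z by simp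
    qed
  next
    assume L: ?L
    show ?R
    proof (intro allI impI)
      fix X Y W Zs Zk
      assume "EK c \<kappa> s (F + Tk * Gk * P) Ts (Tk * Gk * \<kappa>) Gs (\<kappa> * Gk * \<kappa>) X Y W Zs Zk"
      then have X: "X \<in> hom c c" and Y: "Y \<in> hom s s" "tp Y = - Y" and W: "W \<in> hom \<kappa> \<kappa>"
        and Zs: "Zs \<in> hom c s" and Zk: "Zk \<in> hom c \<kappa>"
        and e1: "(F + Tk * Gk * P) * X - X * (F + Tk * Gk * P) + Ts * Zs + Tk * Gk * \<kappa> * Zk = 0"
        and e2: "Ts * Y = X * Ts" and e3: "Tk * Gk * \<kappa> * W = X * (Tk * Gk * \<kappa>)"
        and e4: "tp (Gs * Y - Y * Gs - Zs * Ts) = Gs * Y - Y * Gs - Zs * Ts"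
        and e5: "\<kappa> * Gk * \<kappa> * W - W * (\<kappa> * Gk * \<kappa>) - Zk * (Tk * Gk * \<kappa>) = 0"
        by (auto simp: EK_def)
      note R1 = R0 K homD(1,2)[OF X] homD(1,2)[OF W] homD(1,2)[OF Zk]
      note R1' = R1 R1[THEN mult_assocI]
      have TkW: "Tk * W = 0" "Tk * Zk = 0" "W * P = 0" "k * W = W" "k * Zk = Zk" "W * k = W"
        using hom_annihilate[OF W] hom_annihilate[OF Zk] K by auto
      note R2' = R1' TkW TkW[THEN mult_assocI]
      \<comment> \<open>Inverse of the passage above; \<open>P * X * Tk\<close> is the block forced
        by \<open>Tk * W = X * Tk\<close>.\<close>
      define W0 where "W0 = P * X * Tk + Zk * Tk + W"
      \<comment> \<open>The last equation of \<open>EK\<close> can be solved for \<open>Zk\<close>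
        exactly when this commutator vanishes on \<open>\<kappa>\<close>, and then
        \<open>Zk = N * P\<close>.\<close>
      define N where "N = Gk * W0 - W0 * Gk"
      have kk: "k - \<kappa> = P * Tk" by (simp add: \<kappa>)
      have W0k: "W0 * \<kappa> = W" "Tk * W0 = X * Tk" "\<kappa> * W0 = Zk * Tk + W" "W0 * P = P * X + Zk"
        by (simp_all add: W0_def algebra_simps R2')
      have W0h: "W0 \<in> hom k k" by (simp add: hom_def W0_def algebra_simps R2')
      have Nh: "k * N = N" "N * k = N"
        using W0h by (simp_all add: N_def algebra_simps homD R2')
      have "Tk * (N * \<kappa>) = Tk * Gk * \<kappa> * W - X * (Tk * Gk * \<kappa>)"
        by (simp add: N_def algebra_simps W0k W0k[THEN mult_assocI] R2')
      then have n1: "Tk * (N * \<kappa>) = 0" using e3 by simp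
      have "\<kappa> * (N * \<kappa>) = \<kappa> * Gk * \<kappa> * W - W * (\<kappa> * Gk * \<kappa>) - Zk * (Tk * Gk * \<kappa>)"
        by (simp add: N_def algebra_simps W0k W0k[THEN mult_assocI] R2')
      then have n2: "\<kappa> * (N * \<kappa>) = 0" using e5 by simp
      have "N * \<kappa> = P * (Tk * (N * \<kappa>)) + \<kappa> * (N * \<kappa>)"
        by (simp add: \<kappa> algebra_simps Nh Nh[THEN mult_assocI])
      then have n3: "N * \<kappa> = 0" by (simp add: n1 n2)
      have n4: "N = N * P * Tk" using n3 Nh by (simp add: \<kappa> algebra_simps)
      have "F * X - X * F + Ts * Zs + Tk * (N * P)
          = (F + Tk * Gk * P) * X - X * (F + Tk * Gk * P) + Ts * Zs + Tk * Gk * \<kappa> * Zk"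
        by (simp add: N_def algebra_simps W0k W0k[THEN mult_assocI] R2')
      then have n5: "F * X - X * F + Ts * Zs + Tk * (N * P) = 0" using e1 by simp
      have "N \<in> hom k k" using Nh by (simp add: hom_def)
      then have "N * P \<in> hom c k" using P(1) by blast
      moreover have "Gk * W0 - W0 * Gk - N * P * Tk = 0"
        unfolding N_def[symmetric] using n4 by simp
      ultimately have "EK c k s F Ts Tk Gs Gk X Y W0 Zs (N * P)"
        unfolding EK_def using X Y Zs e2 e4 W0h W0k(2) n5 by blast
      with L have z: "X = 0" "Y = 0" "W0 = 0" "Zs = 0" by blast+
      have "W = W0 * \<kappa>" "Zk = \<kappa> * W0 * P"
        by (simp_all add: W0k algebra_simps R2')
      then show "X = 0 \<and> Y = 0 \<and> W = 0 \<and> Zs = 0 \<and> Zk = 0" using z by simp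
    qed
  }
qed

text \<open>The two parts are not symmetric because \<open>\<kappa>\<close> depends on the
  parameters: one direction produces some \<open>\<kappa>\<close>, the other must be able to start
  from the \<open>\<kappa>\<close> it constructs. They combine to an equivalence once the answer is
  known to depend on ranks only.\<close>

lemma stepA:
  fixes c k s :: "'a::field_char_0 fmat"
  assumes id: "idem c" "idem k" "idem s" and "tr c = of_nat m" "tr k = of_nat l" "m \<le> l"
  shows "frobE c k s \<Longrightarrow> \<exists>\<kappa>. idem \<kappa> \<and> tr \<kappa> = of_nat (l - m) \<and> frobE c \<kappa> s"
    and "(\<And>\<kappa>. idem \<kappa> \<Longrightarrow> tr \<kappa> = of_nat (l - m) \<Longrightarrow> frobE c \<kappa> s) \<Longrightarrow> frobE c k s"
proof -
  have rk: "idem (k - P * Tk)" "tr (k - P * Tk) = of_nat (l - m)"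
    if "Tk \<in> hom k c" "P \<in> hom c k" "Tk * P = c" for Tk P
    using idem_rank_diff(2,3)[OF retract_idem(1)[OF that(2,1,3)] id(2) retract_idem(2)[OF that(2,1,3)] assms(5)]
      retract_idem(3)[OF that(2,1,3)] assms(4) by auto
  {
    assume "frobE c k s"
    then obtain F Ts Tk Gs Gk where h: "F \<in> hom c c" "Ts \<in> hom s c" "Tk \<in> hom k c" "Gs \<in> hom s s" "Gk \<in> hom k k"
      and L: "\<forall>X Y W Zs Zk. EK c k s F Ts Tk Gs Gk X Y W Zs Zk \<longrightarrow> X = 0 \<and> Y = 0 \<and> W = 0 \<and> Zs = 0 \<and> Zk = 0"
      by (auto simp: frobE_def)
    \<comment> \<open>For a tuple with only \<open>Zk\<close> nonzero, the equations reduce to the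
      vanishing of the two products with \<open>Tk\<close>, which is the test needed for
      \<open>surj_of_rank\<close>.\<close>
    have "z = 0" if "z \<in> hom c k" "Tk * z = 0" "z * Tk = 0" for z
      using L[rule_format, of 0 0 0 0 z] that by (simp add: EK_def)
    then obtain P where P: "P \<in> hom c k" "Tk * P = c"
      using surj_of_rank[OF id(2,1) h(3) assms(5,4,6)] by blast
    note r = rk[OF h(3) P]
    have "frobE c (k - P * Tk) s"
      unfolding frobE_def
    proof (rule bexI, rule bexI, rule bexI, rule bexI, rule bexI)
      show "\<forall>X Y W Zs Zk. EK c (k - P * Tk) s (F + Tk * Gk * P) Ts (Tk * Gk * (k - P * Tk)) Gs
          ((k - P * Tk) * Gk * (k - P * Tk)) X Y W Zs Zk \<longrightarrow> X = 0 \<and> Y = 0 \<and> W = 0 \<and> Zs = 0 \<and> Zk = 0"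
        using stepA_kernel[OF id h P refl] L by blast
      show "F + Tk * Gk * P \<in> hom c c" using h P by blast
      show "Tk * Gk * (k - P * Tk) \<in> hom (k - P * Tk) c"
        using h(3) r(1) by (simp add: hom_def mult.assoc) (simp flip: mult.assoc)
      show "(k - P * Tk) * Gk * (k - P * Tk) \<in> hom (k - P * Tk) (k - P * Tk)" using r(1) by blast
    qed (use h in auto)
    then show "\<exists>\<kappa>. idem \<kappa> \<and> tr \<kappa> = of_nat (l - m) \<and> frobE c \<kappa> s" using r by blast
  next
    assume IH: "\<And>\<kappa>. idem \<kappa> \<Longrightarrow> tr \<kappa> = of_nat (l - m) \<Longrightarrow> frobE c \<kappa> s"
    obtain P Tk where P: "P \<in> hom c k" "Tk \<in> hom k c" "Tk * P = c"
      using idem_embed[OF id(1,2) assms(4-6)] by blast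
    define \<kappa> where "\<kappa> = k - P * Tk"
    have r: "idem \<kappa>" "tr \<kappa> = of_nat (l - m)" using rk[OF P(2,1,3)] by (auto simp: \<kappa>_def)
    obtain F Ts Tk1 Gs Gk1 where h: "F \<in> hom c c" "Ts \<in> hom s c" "Tk1 \<in> hom \<kappa> c" "Gs \<in> hom s s" "Gk1 \<in> hom \<kappa> \<kappa>"
      and L: "\<forall>X Y W Zs Zk. EK c \<kappa> s F Ts Tk1 Gs Gk1 X Y W Zs Zk \<longrightarrow> X = 0 \<and> Y = 0 \<and> W = 0 \<and> Zs = 0 \<and> Zk = 0"
      using IH[OF r] by (auto simp: frobE_def)
    note R0 = homD(1,2)[OF h(3)] homD(1,2)[OF h(5)] homD(1,2)[OF P(1)] homD(1,2)[OF P(2)] P(3) id(1,2)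
    have K: "\<kappa> * \<kappa> = \<kappa>" "k * \<kappa> = \<kappa>" "\<kappa> * k = \<kappa>" "\<kappa> * P = 0" "Tk * \<kappa> = 0"
      unfolding \<kappa>_def by (simp_all add: algebra_simps R0 R0[THEN mult_assocI])
    note R1 = R0 K
    have M: "Tk1 * P = 0" "Tk * Gk1 = 0" "Tk1 * k = Tk1" "k * Gk1 = Gk1" "Gk1 * k = Gk1"
      using hom_annihilate[OF h(3)] hom_annihilate[OF h(5)] K by auto
    \<comment> \<open>Chosen so that reducing the parameters returns \<open>Tk1\<close> and
      \<open>Gk1\<close> and leaves \<open>F\<close> unshifted.\<close>
    define Gk where "Gk = P * Tk1 + Gk1"
    have Gk: "Gk \<in> hom k k" by (simp add: Gk_def hom_def algebra_simps R1 R1[THEN mult_assocI] M)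
    have "F + Tk * Gk * P = F" "Tk * Gk * \<kappa> = Tk1" "\<kappa> * Gk * \<kappa> = Gk1"
    proof -
      have GP: "Gk1 * P = 0" using hom_annihilate(2)[OF h(5)] K(4) .
      show "F + Tk * Gk * P = F" "Tk * Gk * \<kappa> = Tk1" "\<kappa> * Gk * \<kappa> = Gk1"
        by (simp_all add: Gk_def algebra_simps R1 R1[THEN mult_assocI] M M[THEN mult_assocI] GP)
    qed
    then have "\<forall>X Y W Zs Zk. EK c k s F Ts Tk Gs Gk X Y W Zs Zk \<longrightarrow> X = 0 \<and> Y = 0 \<and> W = 0 \<and> Zs = 0 \<and> Zk = 0"
      using stepA_kernel[OF id h(1,2) P(2) h(4) Gk P(1,3) \<kappa>_def] L by simp
    then show "frobE c k s" unfolding frobE_def using h P Gk by blast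
  }
qed

section \<open>Step B: \<open>Tk\<close> is injective\<close>

text \<open>\<open>p\<close> projects onto the image of the injection \<open>Tk\<close>. A matching
  \<open>W\<close> exists exactly when \<open>X\<close> preserves this image, which is the block
  condition \<open>q * X * p = 0\<close>. The \<open>p\<close>-part of the first equation of
  \<open>EK\<close> gives \<open>Zk\<close>; its \<open>q\<close>-part and the last equation become
  the two vanishing conditions of \<open>HK\<close>.\<close>

lemma stepB_kernel:
  fixes c k s F Ts Tk Gs Gk P :: "'a::field fmat"
  assumes id: "idem c" "idem k" "idem s"
    and h: "F \<in> hom c c" "Ts \<in> hom s c" "Tk \<in> hom k c" "Gs \<in> hom s s" "Gk \<in> hom k k"
    and P: "P \<in> hom c k" "P * Tk = k"
    and p: "p = Tk * P" and q: "q = c - p"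
  shows "(\<forall>X Y W Zs Zk. EK c k s F Ts Tk Gs Gk X Y W Zs Zk \<longrightarrow> X = 0 \<and> Y = 0 \<and> W = 0 \<and> Zs = 0 \<and> Zk = 0)
    \<longleftrightarrow> (\<forall>X Y Z. HK q p s (F + Tk * Gk * P) Ts Gs X Y Z \<longrightarrow> X = 0 \<and> Y = 0 \<and> Z = 0)" (is "?L \<longleftrightarrow> ?R")
proof
  note R0 = id homD(1,2)[OF h(1)] homD(1,2)[OF h(2)] homD(1,2)[OF h(3)] homD(1,2)[OF h(4)] homD(1,2)[OF h(5)]
    homD(1,2)[OF P(1)] P(2)
  have qp: "q + p = c" by (simp add: q)
  {
    assume R: ?R
    show ?L
    proof (intro allI impI)
      fix X Y W Zs Zk
      assume "EK c k s F Ts Tk Gs Gk X Y W Zs Zk"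
      then have X: "X \<in> hom c c" and Y: "Y \<in> hom s s" "tp Y = - Y" and W: "W \<in> hom k k"
        and Zs: "Zs \<in> hom c s" and Zk: "Zk \<in> hom c k"
        and e1: "F * X - X * F + Ts * Zs + Tk * Zk = 0" and e2: "Ts * Y = X * Ts" and e3: "Tk * W = X * Tk"
        and e4: "tp (Gs * Y - Y * Gs - Zs * Ts) = Gs * Y - Y * Gs - Zs * Ts"
        and e5: "Gk * W - W * Gk - Zk * Tk = 0"
        by (auto simp: EK_def)
      have e1': "F * X = X * F - Ts * Zs - Tk * Zk" using e1 by (simp add: algebra_simps)
      have e5': "Gk * W = W * Gk + Zk * Tk" using e5 by (simp add: algebra_simps)
      note R1 = R0 homD(1,2)[OF X] homD(1,2)[OF W] homD(1,2)[OF Zk] homD(1,2)[OF Zs] e1' e3[symmetric] e5'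
      note R1' = R1 R1[THEN mult_assocI]
      have "HK q p s (F + Tk * Gk * P) Ts Gs X Y Zs"
        unfolding HK_def qp using X Y Zs e2 e4
        by (simp add: p q algebra_simps R1')
      with R have z: "X = 0" "Y = 0" "Zs = 0" by blast+
      have "W = P * (Tk * W)" "Zk = P * (Tk * Zk)" by (simp_all add: R0[THEN mult_assocI] homD[OF W] homD[OF Zk])
      then show "X = 0 \<and> Y = 0 \<and> W = 0 \<and> Zs = 0 \<and> Zk = 0" using z e1 e3 by simp
    qed
  next
    assume L: ?L
    show ?R
    proof (intro allI impI)
      fix X Y Z
      assume "HK q p s (F + Tk * Gk * P) Ts Gs X Y Z"
      then have X: "X \<in> hom c c" "q * X * p = 0" and Y: "Y \<in> hom s s" "tp Y = - Y" and Z: "Z \<in> hom c s"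
        and e2: "Ts * Y = X * Ts"
        and e1: "q * ((F + Tk * Gk * P) * X - X * (F + Tk * Gk * P) + Ts * Z) = 0"
        and e3: "((F + Tk * Gk * P) * X - X * (F + Tk * Gk * P) + Ts * Z) * p = 0"
        and e4: "tp (Gs * Y - Y * Gs - Z * Ts) = Gs * Y - Y * Gs - Z * Ts"
        by (auto simp: HK_def qp)
      note R1 = R0 homD(1,2)[OF X(1)] homD(1,2)[OF Z]
      note R1' = R1 R1[THEN mult_assocI]
      \<comment> \<open>Both values are forced: \<open>W\<close> by injectivity of
        \<open>Tk\<close>, and \<open>Zk\<close> by applying \<open>P\<close> to the first
        equation.\<close>
      define W where "W = P * X * Tk"
      define Zk where "Zk = - P * (F * X - X * F + Ts * Z)"
      have "q * X * p * Tk = X * Tk - Tk * W"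
        by (simp add: p q W_def algebra_simps R1')
      then have TkW: "X * Tk = Tk * W" using X(2) by simp
      note R2' = R1' TkW mult_assocI[OF TkW]
      have cc: "F * X - X * F + Ts * Z + Tk * Zk
          = q * ((F + Tk * Gk * P) * X - X * (F + Tk * Gk * P) + Ts * Z)"
        by (simp add: Zk_def p q algebra_simps R2')
      have "P * (((F + Tk * Gk * P) * X - X * (F + Tk * Gk * P) + Ts * Z) * p) * Tk = Gk * W - W * Gk - Zk * Tk"
        by (simp add: Zk_def p q W_def algebra_simps R1')
      then have kk: "Gk * W - W * Gk - Zk * Tk = 0" unfolding e3 by simp
      have "W \<in> hom k k" "Zk \<in> hom c k"
        by (simp_all add: hom_def W_def Zk_def algebra_simps R1')
      then have "EK c k s F Ts Tk Gs Gk X Y W Z Zk"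
        unfolding EK_def using X Y Z e2 e4 cc e1 TkW kk by simp
      then show "X = 0 \<and> Y = 0 \<and> Z = 0" using L by blast
    qed
  }
qed

lemma stepB:
  fixes c k s :: "'a::field_char_0 fmat"
  assumes id: "idem c" "idem k" "idem s" and "tr c = of_nat m" "tr k = of_nat l" "l \<le> m"
  shows "frobE c k s \<Longrightarrow> \<exists>q p. idem q \<and> idem p \<and> q * p = 0 \<and> p * q = 0 \<and>
      tr q = of_nat (m - l) \<and> tr p = of_nat l \<and> frobH q p s"
    and "(\<And>q p. idem q \<Longrightarrow> idem p \<Longrightarrow> q * p = 0 \<Longrightarrow> p * q = 0 \<Longrightarrow>
      tr q = of_nat (m - l) \<Longrightarrow> tr p = of_nat l \<Longrightarrow> frobH q p s) \<Longrightarrow> frobE c k s"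
proof -
  have rk: "idem (c - Tk * P)" "idem (Tk * P)" "(c - Tk * P) * (Tk * P) = 0" "(Tk * P) * (c - Tk * P) = 0"
    "tr (c - Tk * P) = of_nat (m - l)" "tr (Tk * P) = of_nat l"
    if "Tk \<in> hom k c" "P \<in> hom c k" "P * Tk = k" for Tk P
    using idem_rank_diff(2,3)[OF retract_idem(1)[OF that] id(1) retract_idem(2)[OF that] assms(4)]
      retract_idem[OF that] assms(5) homD[OF that(1)] homD[OF that(2)]
    by (auto simp: algebra_simps id that(3))
  {
    assume "frobE c k s"
    then obtain F Ts Tk Gs Gk where h: "F \<in> hom c c" "Ts \<in> hom s c" "Tk \<in> hom k c" "Gs \<in> hom s s" "Gk \<in> hom k k"
      and L: "\<forall>X Y W Zs Zk. EK c k s F Ts Tk Gs Gk X Y W Zs Zk \<longrightarrow> X = 0 \<and> Y = 0 \<and> W = 0 \<and> Zs = 0 \<and> Zk = 0"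
      by (auto simp: frobE_def)
    have "z = 0" if "z \<in> hom c k" "Tk * z = 0" "z * Tk = 0" for z
      using L[rule_format, of 0 0 0 0 z] that by (simp add: EK_def)
    then obtain P where P: "P \<in> hom c k" "P * Tk = k"
      using inj_of_rank[OF id(2,1) h(3) assms(5,4,6)] by blast
    have "frobH (c - Tk * P) (Tk * P) s"
      unfolding frobH_def
    proof (rule bexI, rule bexI, rule bexI)
      show "\<forall>X Y Z. HK (c - Tk * P) (Tk * P) s (F + Tk * Gk * P) Ts Gs X Y Z \<longrightarrow> X = 0 \<and> Y = 0 \<and> Z = 0"
        using stepB_kernel[OF id h P refl refl] L by blast
      have "F + Tk * Gk * P \<in> hom c c" using h P by blast
      then show "F + Tk * Gk * P \<in> hom (c - Tk * P + Tk * P) (c - Tk * P + Tk * P)" by simp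
    qed (use h in auto)
    then show "\<exists>q p. idem q \<and> idem p \<and> q * p = 0 \<and> p * q = 0 \<and>
      tr q = of_nat (m - l) \<and> tr p = of_nat l \<and> frobH q p s" using rk[OF h(3) P] by blast
  next
    assume IH: "\<And>q p. idem q \<Longrightarrow> idem p \<Longrightarrow> q * p = 0 \<Longrightarrow> p * q = 0 \<Longrightarrow>
      tr q = of_nat (m - l) \<Longrightarrow> tr p = of_nat l \<Longrightarrow> frobH q p s"
    obtain Tk P where P: "Tk \<in> hom k c" "P \<in> hom c k" "P * Tk = k"
      using idem_embed[OF id(2,1) assms(5,4,6)] by blast
    have "frobH (c - Tk * P) (Tk * P) s" by (rule IH; rule rk[OF P])
    \<comment> \<open>The parameters of \<open>HK\<close> are reused with \<open>Gk = 0\<close>, for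
      which the shift of \<open>F\<close> is zero.\<close>
    then obtain F Ts Gs where h: "F \<in> hom c c" "Ts \<in> hom s c" "Gs \<in> hom s s"
      and L: "\<forall>X Y Z. HK (c - Tk * P) (Tk * P) s (F + Tk * 0 * P) Ts Gs X Y Z \<longrightarrow> X = 0 \<and> Y = 0 \<and> Z = 0"
      by (auto simp: frobH_def)
    have "\<forall>X Y W Zs Zk. EK c k s F Ts Tk Gs 0 X Y W Zs Zk \<longrightarrow> X = 0 \<and> Y = 0 \<and> W = 0 \<and> Zs = 0 \<and> Zk = 0"
      using stepB_kernel[OF id h(1,2) P(1) h(3) hom_closed(1) P(2,3) refl refl] L by blast
    then show "frobE c k s" unfolding frobE_def using h P hom_closed(1) by blast
  }
qed

section \<open>Step C: \<open>T\<close> is injective already in its \<open>q\<close>-part\<close>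

text \<open>The image of \<open>T\<close> splits off, so \<open>q + p\<close> decomposes into
  \<open>q'\<close>, \<open>p'\<close> and \<open>T * P\<close>. The equation
  \<open>T * Y = X * T\<close> makes \<open>X\<close> act on that image as \<open>Y\<close>, and
  applying \<open>P\<close> to the vanishing condition determines \<open>Z\<close>. The four blocks
  of \<open>X\<close> still free are the unknowns of the new system, whose parameters are blocks of
  \<open>F\<close>; eliminating \<open>Z\<close> adds \<open>P * F * T\<close> to
  \<open>G\<close>.\<close>

lemma stepC_kernel:
  fixes q p s F T G P :: "'a::field fmat"
  assumes id: "idem q" "idem p" "q * p = 0" "p * q = 0" "idem s"
    and h: "F \<in> hom (q + p) (q + p)" "T \<in> hom s (q + p)" "G \<in> hom s s"
    and P: "P \<in> hom q s" "P * T = s"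
    and p': "p' = p - p * T * P" and q': "q' = q - q * T * P"
  shows "(\<forall>X Y Z. HK q p s F T G X Y Z \<longrightarrow> X = 0 \<and> Y = 0 \<and> Z = 0) \<longleftrightarrow>
    (\<forall>X Y W Zs Zk. EK q' p' s (q' * F * q') (q' * F * T) (q' * F * p') (G + P * F * T) (p' * F * p') X Y W Zs Zk \<longrightarrow>
      X = 0 \<and> Y = 0 \<and> W = 0 \<and> Zs = 0 \<and> Zk = 0)" (is "?L \<longleftrightarrow> ?R")
proof
  define n where "n = q + p"
  note h = h[folded n_def]
  have Pp: "P * p = 0" using hom_annihilate(2)[OF P(1) id(3)] .
  have n1: "n * q = q" "q * n = q" "n * p = p" "p * n = p" "n * n = n" "P * n = P"
    using id Pp homD(2)[OF P(1)] by (simp_all add: n_def algebra_simps)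
  note R0 = id n1 homD(1,2)[OF h(1)] homD(1,2)[OF h(2)] homD(1,2)[OF h(3)] homD(1,2)[OF P(1)] P(2) Pp
  note R0' = R0 R0[THEN mult_assocI]
  have D: "q' * q' = q'" "p' * p' = p'" "q' * p' = 0" "p' * q' = 0" "q' * T = 0" "p' * T = 0" "P * p' = 0" "P * q' = 0"
    "q * q' = q'" "q' * q = q'" "p * p' = p'" "p' * p = p" "q * p' = 0"
    "n * q' = q'" "q' * n = q'" "n * p' = p'" "p' * n = p'"
    unfolding p' q' by (simp_all add: algebra_simps R0')
  have dec: "n = q' + p' + T * P"
  proof -
    have "q' + p' + T * P = n - n * T * P + T * P" by (simp add: n_def p' q' algebra_simps)
    then show ?thesis by (simp add: R0')
  qed
  have decl: "A = q' * A + p' * A + T * (P * A)" if "n * A = A" for A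
    using that unfolding dec by (simp add: algebra_simps)
  have decr: "A = A * q' + A * p' + A * (T * P)" if "A * n = A" for A
    using that unfolding dec by (simp add: algebra_simps)
  note R1 = homD(1,2)[OF h(1)] homD(1,2)[OF h(2)] homD(1,2)[OF h(3)] homD(1)[OF P(1)] P(2) \<open>P * n = P\<close> \<open>n * n = n\<close> id(5) D
  note R1' = R1 R1[THEN mult_assocI]
  {
    assume R: ?R
    show ?L
    proof (intro allI impI)
      fix X Y Z
      assume "HK q p s F T G X Y Z"
      then have X: "X \<in> hom n n" "q * X * p = 0" and Y: "Y \<in> hom s s" "tp Y = - Y" and Z: "Z \<in> hom n s"
        and e1: "T * Y = X * T" and e2: "q * (F * X - X * F + T * Z) = 0" and e3: "(F * X - X * F + T * Z) * p = 0"
        and e4: "tp (G * Y - Y * G - Z * T) = G * Y - Y * G - Z * T"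
        by (auto simp: HK_def n_def)
      note R2 = homD(1,2)[OF X(1)] homD(1,2)[OF Y(1)] homD(1,2)[OF Z]
      note R2' = R1' R2 R2[THEN mult_assocI]
      \<comment> \<open>The block condition survives as the vanishing of the blocks of
        \<open>X\<close> from \<open>p'\<close> into \<open>q'\<close> and into the image of
        \<open>T\<close>.\<close>
      have xx: "q' * (q * X * p) * p' = q' * X * p'" "P * (q * X * p) * p' = P * X * p'"
        using homD(2)[OF P(1)] by (simp_all add: mult.assoc R1') (simp_all add: R1' homD(4)[OF P(1)])
      then have x1: "q' * (X * p') = 0" "P * (X * p') = 0"
        using xx unfolding X(2) by (simp_all add: mult.assoc)
      have x2: "X * p' = p' * (X * p')" using decl[of "X * p'"] by (simp add: x1 R2')
      have x3: "q' * (X * q') = q' * X"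
        using decr[of "q' * X"] x1 by (simp add: R2' mult.assoc e1[symmetric] e1[symmetric, THEN mult_assocI])
      have x4: "p' * (X * q') = p' * X - X * p'"
        using decr[of "p' * X"] x2 by (simp add: R2' mult.assoc e1[symmetric] e1[symmetric, THEN mult_assocI])
      have x5: "P * (X * q') = P * X - Y * P"
        using decr[of "P * X"] x1 by (simp add: R2' mult.assoc e1[symmetric] e1[symmetric, THEN mult_assocI])
      have "q' * (q * (F * X - X * F + T * Z)) = q' * (F * X) - q' * (X * F)"
        by (simp add: R2' algebra_simps)
      then have m1: "q' * (F * X) = q' * (X * F)" unfolding e2 by simp
      \<comment> \<open>Since \<open>P * q = P\<close> and \<open>P * T = s\<close>, this component
        of the equation can be solved for \<open>Z\<close>.\<close>
      have "P * (q * (F * X - X * F + T * Z)) = P * (F * X) - P * (X * F) + Z"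
        by (simp add: R2' homD(4)[OF P(1)] algebra_simps)
      then have m2: "Z = P * (X * F) - P * (F * X)" unfolding e2 by (simp add: algebra_simps)
      have "p' * ((F * X - X * F + T * Z) * p) * p' = p' * (F * (X * p')) - p' * (X * (F * p'))"
        by (simp add: R2' algebra_simps)
      then have m3: "p' * (F * (X * p')) = p' * (X * (F * p'))" unfolding e3 by simp
      note R3 = e1 x1 x2[symmetric] x3 x4 x5 m1 m3
      note R3' = R2' R3 R3[THEN mult_assocI, unfolded mult.assoc]
      have nX: "F * X = F * (q' * X) + F * (p' * X) + F * (T * (P * X))"
        using arg_cong[OF decl[OF homD(1)[OF X(1)]], of "\<lambda>z. F * z"] by (simp add: distrib_left)
      have "EK q' p' s (q' * F * q') (q' * F * T) (q' * F * p') (G + P * F * T) (p' * F * p')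
         (q' * X * q') Y (p' * X * p') (P * X * q') (p' * X * q')"
        unfolding EK_def
      proof (intro conjI Y)
        have "q' * F * q' * (q' * X * q') - q' * X * q' * (q' * F * q') + q' * F * T * (P * X * q') + q' * F * p' * (p' * X * q')
           = q' * (F * (q' * X) + F * (p' * X) + F * (T * (P * X))) * q' - (q' * X * q') * (F * q')"
          by (simp add: algebra_simps R1')
        also have "\<dots> = 0" unfolding nX[symmetric] by (simp add: mult.assoc R3')
        finally show "q' * F * q' * (q' * X * q') - q' * X * q' * (q' * F * q') + q' * F * T * (P * X * q') + q' * F * p' * (p' * X * q') = 0" .
        have N: "(G + P * F * T) * Y - Y * (G + P * F * T) - P * X * q' * (q' * F * T) = G * Y - Y * G - Z * T"
          unfolding m2 by (simp add: algebra_simps R3')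
        show "tp ((G + P * F * T) * Y - Y * (G + P * F * T) - P * X * q' * (q' * F * T)) =
          (G + P * F * T) * Y - Y * (G + P * F * T) - P * X * q' * (q' * F * T)"
          unfolding N by (rule e4)
      qed (simp_all add: hom_def algebra_simps R3')
      with R have z: "q' * X * q' = 0" "Y = 0" "p' * X * p' = 0" "P * X * q' = 0" "p' * X * q' = 0" by blast+
      have "X * q' = 0" using decl[of "X * q'"] z by (simp add: mult.assoc R2')
      moreover have "X * p' = 0" using x2 z by (simp add: mult.assoc)
      moreover have "X * T = 0" using e1 z by simp
      then have "X * (T * P) = 0" by (simp flip: mult.assoc)
      ultimately have "X = 0" using decr[of X] R2 by simp
      then show "X = 0 \<and> Y = 0 \<and> Z = 0" using z m2 by simp
    qed
  next
    assume L: ?L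
    show ?R
    proof (intro allI impI)
      fix X' Y W Zs Zk
      assume "EK q' p' s (q' * F * q') (q' * F * T) (q' * F * p') (G + P * F * T) (p' * F * p') X' Y W Zs Zk"
      then have X': "X' \<in> hom q' q'" and Y: "Y \<in> hom s s" "tp Y = - Y" and W: "W \<in> hom p' p'"
        and Zs: "Zs \<in> hom q' s" and Zk: "Zk \<in> hom q' p'"
        and e1: "q' * F * q' * X' - X' * (q' * F * q') + q' * F * T * Zs + q' * F * p' * Zk = 0"
        and e2: "q' * F * T * Y = X' * (q' * F * T)" and e3: "q' * F * p' * W = X' * (q' * F * p')"
        and e4: "tp ((G + P * F * T) * Y - Y * (G + P * F * T) - Zs * (q' * F * T))
          = (G + P * F * T) * Y - Y * (G + P * F * T) - Zs * (q' * F * T)"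
        and e5: "p' * F * p' * W - W * (p' * F * p') - Zk * (q' * F * p') = 0"
        by (auto simp: EK_def)
      have A: "p' * X' = 0" "P * X' = 0" "X' * T = 0" "X' * p' = 0" "n * X' = X'" "X' * n = X'"
        "q' * W = 0" "P * W = 0" "W * T = 0" "W * q' = 0" "n * W = W" "W * n = W"
        "Zs * T = 0" "Zs * p' = 0" "Zs * n = Zs"
        "q' * Zk = 0" "P * Zk = 0" "Zk * T = 0" "Zk * p' = 0" "n * Zk = Zk" "Zk * n = Zk"
        using hom_annihilate[OF X'] hom_annihilate[OF W] hom_annihilate[OF Zs] hom_annihilate[OF Zk] D by auto
      note R2 = homD(1,2)[OF X'] homD(1,2)[OF W] homD(1,2)[OF Zs] homD(1,2)[OF Zk] homD(1,2)[OF Y(1)] A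
      note R2' = R1' R2 R2[THEN mult_assocI]
      \<comment> \<open>\<open>X\<close> is reassembled from its blocks; \<open>T * Y * P\<close> is
        the one forced by \<open>T * Y = X * T\<close>.\<close>
      define X where "X = X' + T * Y * P + W + T * Zs + Zk"
      have x: "q' * X = X'" "X * p' = W" "X * T = T * Y" "P * X = Y * P + Zs" "X * q' = X' + T * Zs + Zk"
        "p' * X = W + Zk" "n * X = X" "X * n = X"
        by (simp_all add: X_def algebra_simps R2')
      note R3' = R2' x x[THEN mult_assocI]
      define Z where "Z = P * X * F - P * F * X"
      define M where "M = F * X - X * F + T * Z"
      have M1: "n * M = M" "M * n = M"
        by (simp_all add: M_def Z_def algebra_simps R3')
      have q'M: "q' * M = q' * F * X - X' * F" by (simp add: M_def algebra_simps R3')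
      have "q' * M * q' = q' * F * q' * X' - X' * (q' * F * q') + q' * F * T * Zs + q' * F * p' * Zk"
        unfolding q'M by (simp add: algebra_simps R3')
      moreover have "q' * M * T = q' * F * T * Y - X' * (q' * F * T)"
        unfolding q'M by (simp add: algebra_simps R3')
      moreover have "q' * M * p' = q' * F * p' * W - X' * (q' * F * p')"
        unfolding q'M by (simp add: algebra_simps R3')
      ultimately have z: "q' * M * q' = 0" "q' * M * T = 0" "q' * M * p' = 0" using e1 e2 e3 by simp_all
      have "q' * M * n = q' * M" by (simp only: mult.assoc M1)
      note dr = decr[OF this]
      have "q' * M * (T * P) = 0" using z(2) by (simp flip: mult.assoc)
      then have m1: "q' * M = 0" using z(1,3) by (subst dr) simp
      have m2: "P * M = 0" by (simp add: M_def Z_def algebra_simps R3')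
      have m3: "q * M = 0"
      proof -
        have "q * M = q * (q' * M + p' * M + T * (P * M))" using decl[OF M1(1)] by simp
        then show ?thesis using m1 m2 by (simp add: distrib_left R1')
      qed
      have "p' * (M * p') = p' * F * p' * W - W * (p' * F * p') - Zk * (q' * F * p')"
        by (simp add: M_def algebra_simps R3')
      then have m4: "p' * (M * p') = 0" using e5 by simp
      have "n * (M * p') = M * p'" using M1(1) by (simp flip: mult.assoc)
      note dl = decl[OF this]
      have "q' * (M * p') = 0" "P * (M * p') = 0" using m1 m2 by (simp_all flip: mult.assoc)
      then have m5': "M * p' = 0" using m4 by (subst dl) simp
      have "M * p = M * p' * p" by (simp only: mult.assoc D(12))
      then have m5: "M * p = 0" unfolding m5' by simp
      have "q * X * p = q * (X * p') * p" using D(12) by (simp add: mult.assoc)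
      also have "\<dots> = q * p' * W * p" using W by (simp add: x mult.assoc homD)
      finally have x5: "q * X * p = 0" by (simp add: D)
      have N: "G * Y - Y * G - Z * T = (G + P * F * T) * Y - Y * (G + P * F * T) - Zs * (q' * F * T)"
        by (simp add: Z_def algebra_simps R3')
      have "HK q p s F T G X Y Z"
        unfolding HK_def M_def[symmetric] n_def[symmetric] N
        using x5 Y x m3 m5 e4 by (simp add: hom_def) (simp add: Z_def algebra_simps R3')
      then have z: "X = 0" "Y = 0" using L by blast+
      have "Zs = P * X - Y * P" "Zk = p' * X - X * p'" using x by simp_all
      then show "X' = 0 \<and> Y = 0 \<and> W = 0 \<and> Zs = 0 \<and> Zk = 0" using z x by simp
    qed
  }
qed

text \<open>In the forward direction \<open>p'\<close> may differ from \<open>p\<close>, but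
  \<open>P * p = 0\<close> gives it the same trace. For the converse, \<open>T\<close> is chosen
  with values in \<open>q\<close>, so that \<open>p' = p\<close>.\<close>

lemma stepC:
  fixes q p s :: "'a::field_char_0 fmat"
  assumes id: "idem q" "idem p" "q * p = 0" "p * q = 0" "idem s"
    and tr: "tr q = of_nat a" "tr p = of_nat b" "tr s = of_nat r" "r \<le> a"
  shows "frobH q p s \<Longrightarrow> \<exists>c k. idem c \<and> idem k \<and> tr c = of_nat (a - r) \<and> tr k = of_nat b \<and> frobE c k s"
    and "(\<And>c k. idem c \<Longrightarrow> idem k \<Longrightarrow> tr c = of_nat (a - r) \<Longrightarrow> tr k = of_nat b \<Longrightarrow> frobE c k s) \<Longrightarrow> frobH q p s"
proof -
  {
    assume "frobH q p s"
    then obtain F T G where h: "F \<in> hom (q + p) (q + p)" "T \<in> hom s (q + p)" "G \<in> hom s s"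
      and L: "\<forall>X Y Z. HK q p s F T G X Y Z \<longrightarrow> X = 0 \<and> Y = 0 \<and> Z = 0"
      by (auto simp: frobH_def)
    have qT: "q * T \<in> hom s q" using id h(2) by (simp add: hom_def mult.assoc) (simp flip: mult.assoc)
    have "z = 0" if z: "z \<in> hom q s" "q * T * z = 0" "z * (q * T) = 0" for z
    proof -
      have "z * p = 0" using hom_annihilate(2)[OF z(1) id(3)] .
      moreover have "z * T = 0" using z by (simp add: homD)
      ultimately have "HK q p s F T G 0 0 z"
        using z by (simp add: HK_def hom_def mult.assoc distrib_left)
      then show ?thesis using L by blast
    qed
    then obtain P where P: "P \<in> hom q s" "P * (q * T) = s"
      using inj_of_rank[OF id(5,1) qT tr(3,1,4)] by blast
    have PT: "P * T = s" using P by (simp add: homD)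
    define u where "u = q * T * P"
    define q' where "q' = q - q * T * P"
    define p' where "p' = p - p * T * P"
    have Pp: "P * p = 0" using hom_annihilate(2)[OF P(1) id(3)] .
    note r = retract_idem[OF qT P]
    have q'1: "idem q'" "tr q' = of_nat (a - r)"
      using idem_rank_diff(2,3)[OF r(1) id(1) r(2) tr(1)] r(3) tr by (auto simp: q'_def)
    note R0 = id homD(1,2)[OF h(2)] homD(1,2)[OF h(1)] homD(1,2)[OF P(1)] PT Pp
    have p'1: "idem p'" by (simp add: p'_def algebra_simps R0 R0[THEN mult_assocI])
    have "tr (p * T * P) = tr (P * (p * T))" using tr_comm[of "p * T" P] by simp
    also have "\<dots> = 0" using Pp by (simp flip: mult.assoc)
    finally have p'2: "tr p' = of_nat b" using tr by (simp add: p'_def)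
    have "frobE q' p' s"
      unfolding frobE_def
    proof (rule bexI, rule bexI, rule bexI, rule bexI, rule bexI)
      show "\<forall>X Y W Zs Zk. EK q' p' s (q' * F * q') (q' * F * T) (q' * F * p') (G + P * F * T) (p' * F * p') X Y W Zs Zk
         \<longrightarrow> X = 0 \<and> Y = 0 \<and> W = 0 \<and> Zs = 0 \<and> Zk = 0"
        using stepC_kernel[OF id h P(1) PT p'_def q'_def] L by blast
      have "q' * T * s = q' * T" using h(2) by (simp add: mult.assoc homD)
      then show "q' * F * T \<in> hom s q'" "G + P * F * T \<in> hom s s" "q' * F * p' \<in> hom p' q'"
        "q' * F * q' \<in> hom q' q'" "p' * F * p' \<in> hom p' p'"
        using q'1(1) p'1 id h P(1)
        by (auto simp: hom_def mult.assoc distrib_left distrib_right) (simp_all flip: mult.assoc)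
    qed
    then show "\<exists>c k. idem c \<and> idem k \<and> tr c = of_nat (a - r) \<and> tr k = of_nat b \<and> frobE c k s"
      using q'1 p'1 p'2 by blast
  next
    assume IH: "\<And>c k. idem c \<Longrightarrow> idem k \<Longrightarrow> tr c = of_nat (a - r) \<Longrightarrow> tr k = of_nat b \<Longrightarrow> frobE c k s"
    obtain T P where TP: "T \<in> hom s q" "P \<in> hom q s" "P * T = s"
      using idem_embed[OF id(5,1) tr(3,1,4)] by blast
    define q' where "q' = q - q * T * P"
    have q'2: "q' = q - T * P" using TP by (simp add: q'_def homD)
    note r = retract_idem[OF TP]
    have q'1: "idem q'" "tr q' = of_nat (a - r)"
      using idem_rank_diff(2,3)[OF r(1) id(1) r(2) tr(1)] r(3) tr by (auto simp: q'2)
    have pT: "p * T = 0" using hom_annihilate(1)[OF TP(1) id(4)] .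
    have p': "p = p - p * T * P" by (simp add: pT)
    obtain F0 Ts Tk Gs Gk where h: "F0 \<in> hom q' q'" "Ts \<in> hom s q'" "Tk \<in> hom p q'" "Gs \<in> hom s s" "Gk \<in> hom p p"
      and L: "\<forall>X Y W Zs Zk. EK q' p s F0 Ts Tk Gs Gk X Y W Zs Zk \<longrightarrow> X = 0 \<and> Y = 0 \<and> W = 0 \<and> Zs = 0 \<and> Zk = 0"
      using IH[OF q'1(1) id(2) q'1(2) tr(2)] by (auto simp: frobE_def)
    note R0 = id homD(1,2)[OF TP(1)] homD(1,2)[OF TP(2)] TP(3) pT
    have Pp: "P * p = 0" using hom_annihilate(2)[OF TP(2) id(3)] .
    have D: "q * q' = q'" "q' * q = q'" "q' * T = 0" "P * q' = 0" "p * q' = 0" "q' * p = 0" "P * p = 0" "idem q'"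
      using q'1(1) Pp by (simp_all add: q'2 algebra_simps R0 R0[THEN mult_assocI])
    have A: "p * F0 = 0" "F0 * p = 0" "q * F0 = F0" "F0 * q = F0" "F0 * T = 0" "P * F0 = 0"
      "p * Ts = 0" "q * Ts = Ts" "P * Ts = 0"
      "p * Tk = 0" "q * Tk = Tk" "Tk * q = 0" "Tk * q' = 0" "P * Tk = 0" "Tk * T = 0"
      "Gk * q = 0" "q * Gk = 0" "Gk * q' = 0" "q' * Gk = 0" "P * Gk = 0" "Gk * T = 0"
      using hom_annihilate[OF h(1)] hom_annihilate[OF h(2)] hom_annihilate[OF h(3)] hom_annihilate[OF h(5)] D id pT by auto
    note R1 = R0 D A homD(1,2)[OF h(1)] homD(1,2)[OF h(2)] homD(1,2)[OF h(3)] homD(1,2)[OF h(4)] homD(1,2)[OF h(5)]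
    note R1' = R1 R1[THEN mult_assocI]
    \<comment> \<open>The four summands sit in different blocks, so the blocks of \<open>F\<close>
      are the prescribed parameters.\<close>
    define F where "F = F0 + Ts * P + Tk + Gk"
    have F: "F \<in> hom (q + p) (q + p)" by (simp add: F_def hom_def algebra_simps R1')
    have T: "T \<in> hom s (q + p)" using TP pT by (simp add: hom_def distrib_right)
    have e: "q' * F * q' = F0" "q' * F * T = Ts" "q' * F * p = Tk" "Gs + P * F * T = Gs" "p * F * p = Gk"
      by (simp_all add: F_def algebra_simps R1')
    have "\<forall>X Y Z. HK q p s F T Gs X Y Z \<longrightarrow> X = 0 \<and> Y = 0 \<and> Z = 0"
      using stepC_kernel[OF id F T h(4) TP(2,3) p' q'_def] L e by simp
    then show "frobH q p s" unfolding frobH_def using F T h(4) by blast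
  }
qed

section \<open>Step D: splitting off an orthogonal Lie algebra\<close>

text \<open>The stabiliser, in the orthogonal Lie algebra of \<open>s\<close>, of the functional
  given by trace against \<open>G\<close>: trace orthogonality to all skew matrices means
  symmetry.\<close>

definition skewK where
  "skewK s G Y \<longleftrightarrow> Y \<in> hom s s \<and> tp Y = - Y \<and> tp (G * Y - Y * G) = G * Y - Y * G"

definition frobSO where
  "frobSO s \<longleftrightarrow> (\<exists>G \<in> hom s s. \<forall>Y. skewK s G Y \<longrightarrow> Y = 0)"

text \<open>Now \<open>q * T\<close> is surjective onto \<open>q\<close> with right inverse
  \<open>P\<close>, and \<open>s1 = P * T\<close> is an orthogonal projection. Invariance under
  \<open>s1\<close> together with skewness makes \<open>Y\<close> block diagonal, so the system
  decouples into one on \<open>s1\<close>, which involves only the skew block, and one on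
  \<open>p'\<close> and \<open>s0\<close>. The other components of \<open>Z\<close> are determined,
  the last of them by the symmetry of the off-diagonal blocks.\<close>

lemma stepD_kernel:
  fixes q p s F T G P :: "'a::field fmat"
  assumes id: "idem q" "idem p" "q * p = 0" "p * q = 0" "idem s" "tp s = s"
    and h: "F \<in> hom (q + p) (q + p)" "T \<in> hom s (q + p)" "G \<in> hom s s"
    and P: "P \<in> hom q s" "q * T * P = q"
    and s1: "s1 = P * T" "tp s1 = s1" and s0: "s0 = s - s1" and p': "p' = p - p * T * P"
  shows "(\<forall>X Y Z. HK q p s F T G X Y Z \<longrightarrow> X = 0 \<and> Y = 0 \<and> Z = 0) \<longleftrightarrow>
    (\<forall>X Y Z. HK p' 0 s0 (p' * F * p') (p' * T) (s0 * G * s0) X Y Z \<longrightarrow> X = 0 \<and> Y = 0 \<and> Z = 0) \<and>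
    (\<forall>Y. skewK s1 (s1 * G * s1 + P * F * T * s1) Y \<longrightarrow> Y = 0)" (is "?L \<longleftrightarrow> ?R1 \<and> ?R2")
proof -
  define n where "n = q + p"
  note h = h[folded n_def]
  have Pp: "P * p = 0" using hom_annihilate(2)[OF P(1) id(3)] .
  have PqT: "P * (q * T) = P * T" using P(1) by (simp add: homD)
  have qTP: "q * (T * P) = q" using P(2) by (simp add: mult.assoc)
  have PTP: "P * (T * P) = P"
  proof -
    have "P * (T * P) = P * (q * (T * P))" using P(1) by (simp add: homD)
    then show ?thesis using P(1) by (simp add: qTP homD)
  qed
  have PTP': "P * (T * (P * w)) = P * w" for w
    using arg_cong[OF PTP, of "\<lambda>z. z * w"] by (simp add: mult.assoc)
  have n1: "n * q = q" "q * n = q" "n * p = p" "p * n = p" "n * n = n" "P * n = P" "P * q = P"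
    using id Pp homD(2)[OF P(1)] by (simp_all add: n_def algebra_simps)
  note R0 = id(1-5) n1 homD(1,2)[OF h(1)] homD(1,2)[OF h(2)] homD(1,2)[OF h(3)] homD(1,2)[OF P(1)] Pp qTP PTP
  note R0' = R0 R0[THEN mult_assocI] PTP'
  have D: "p' * p' = p'" "p * p' = p'" "p' * p = p" "q * p' = 0" "P * p' = 0" "n * p' = p'" "p' * n = p'"
    "p' * (T * P) = 0" "p' * (T * s1) = 0"
    "s1 * s1 = s1" "s * s1 = s1" "s1 * s = s1" "s0 * s0 = s0" "s0 * s1 = 0" "s1 * s0 = 0" "s * s0 = s0" "s0 * s = s0"
    "s1 * P = P" "s0 * P = 0" "p' * (T * s0) = p' * T"
    unfolding p' s0 s1(1) by (simp_all add: algebra_simps R0')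
  have PT: "P * T = s1" using s1(1) by simp
  have ts0: "tp s0 = s0" using s0 id(6) s1(2) by simp
  have dec: "n = p' + T * P"
  proof -
    have "p' + T * P = n - n * T * P + T * P - (q - q * (T * P))" by (simp add: n_def p' algebra_simps)
    then show ?thesis by (simp add: R0')
  qed
  have decl: "A = p' * A + T * (P * A)" if "n * A = A" for A
    using that unfolding dec by (simp add: algebra_simps)
  have decr: "A = A * p' + A * (T * P)" if "A * n = A" for A
    using that unfolding dec by (simp add: algebra_simps)
  note R1 = homD(1,2)[OF h(1)] homD(1,2)[OF h(2)] homD(1,2)[OF h(3)] homD(1)[OF P(1)] PT n1(5,6) id(5) D
  note R1' = R1 R1[THEN mult_assocI] R1[THEN mult_assocI, unfolded mult.assoc]
  have fwd: ?L if R: ?R1 ?R2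
  proof (intro allI impI)
    fix X Y Z
    assume "HK q p s F T G X Y Z"
    then have X: "X \<in> hom n n" "q * X * p = 0" and Y: "Y \<in> hom s s" "tp Y = - Y" and Z: "Z \<in> hom n s"
      and e1: "T * Y = X * T" and e2: "q * (F * X - X * F + T * Z) = 0" and e3: "(F * X - X * F + T * Z) * p = 0"
      and e4: "tp (G * Y - Y * G - Z * T) = G * Y - Y * G - Z * T"
      by (auto simp: HK_def n_def)
    note R2 = homD(1,2)[OF X(1)] homD(1,2)[OF Y(1)] homD(1,2)[OF Z]
    note R2' = R1' R2 R2[THEN mult_assocI]
    have xx: "P * (q * X * p) * p' = P * X * p'"
      by (simp add: mult.assoc R1') (simp add: R1' homD(4)[OF P(1)])
    then have x1: "P * (X * p') = 0"
      using xx unfolding X(2) by (simp_all add: mult.assoc)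
    have x2: "X * p' = p' * (X * p')" using decl[of "X * p'"] by (simp add: x1 R2')
    have PX: "P * X = P * (X * (T * P))"
      using decr[of "P * X"] x1 by (simp add: R2' mult.assoc)
    have s1Y: "s1 * Y = P * (X * T)"
    proof -
      have "s1 * Y = P * (T * Y)" unfolding PT[symmetric] by (simp only: mult.assoc)
      then show ?thesis unfolding e1 .
    qed
    also have "\<dots> = P * (X * (T * P)) * T" unfolding PX[symmetric] by (simp only: mult.assoc)
    also have "\<dots> = P * (T * Y) * s1" unfolding e1 by (simp add: mult.assoc PT)
    also have "\<dots> = s1 * Y * s1" by (simp add: R1' mult.assoc)
    finally have y1: "s1 * Y = s1 * Y * s1" .
    \<comment> \<open>Transposing turns one-sided invariance into commutation with
      \<open>s1\<close>, because \<open>Y\<close> is skew and \<open>s1\<close> symmetric.\<close>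
    have "Y * s1 = s1 * Y * s1" using arg_cong[OF y1, of tp] Y(2) s1(2) by (simp add: mult.assoc)
    then have y2: "s1 * Y = Y * s1" using y1 by simp
    have y3: "s0 * Y = Y * s0" using y2 Y(1) by (simp add: s0 algebra_simps homD)
    have PX2: "P * X = Y * P"
    proof -
      have "P * X = P * (T * Y) * P" unfolding e1 using PX by (simp add: mult.assoc)
      also have "\<dots> = s1 * Y * P" by (simp add: R1' mult.assoc)
      finally show ?thesis using y2 by (simp add: mult.assoc R1')
    qed
    have "P * (q * (F * X - X * F + T * Z)) = P * (F * X) - P * (X * F) + s1 * Z"
      by (simp add: R2' homD(4)[OF P(1)] algebra_simps)
    then have m2: "s1 * Z = Y * (P * F) - P * (F * X)" unfolding e2
      by (simp add: algebra_simps PX2[THEN mult_assocI])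
    have "(F * X - X * F + T * Z) * p * p' = F * (X * p') - X * (F * p') + T * (Z * p')"
      by (simp add: R2' algebra_simps)
    then have m3: "F * (X * p') = X * (F * p') - T * (Z * p')" unfolding e3 by (simp add: algebra_simps)
    have XTP: "X * (T * P) = T * (Y * P)" unfolding mult.assoc[symmetric] e1 ..
    have "p' * X = p' * (X * p') + p' * (X * (T * P))" 
      using decr[of "p' * X"] by (simp add: R2' mult.assoc)
    moreover have "p' * (X * (T * P)) = p' * (T * (s1 * (Y * P)))"
    proof -
      have "s1 * (Y * P) = Y * P" using y2 by (metis D(18) mult.assoc)
      then show ?thesis by (simp add: XTP)
    qed
    ultimately have x3: "p' * X = X * p'" using x2 by (simp add: R1')
    have x4: "X * (T * s1) = T * (Y * s1)" unfolding mult.assoc[symmetric] e1 ..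
    define N where "N = G * Y - Y * G - Z * T"
    have tN: "tp N = N" unfolding N_def by (rule e4)
    note R3 = e1[symmetric] x3 y2 y3 m2 PX2
    note R3' = R2' R3 R3[THEN mult_assocI] R3[THEN mult_assocI, unfolded mult.assoc] m3 XTP x4
    have TT: "T * (s0 * w) = T * w - T * (s1 * w)" for w
      using h(2) by (simp add: s0 algebra_simps homD)
    have ZT: "Z * (p' * (T * w)) = Z * (T * w) - Z * (T * (s1 * w))" for w
    proof -
      have "Z * (T * w) = Z * ((p' + T * P) * (T * w))" using Z by (simp add: homD flip: dec)
      then show ?thesis by (simp add: algebra_simps R1')
    qed
    have n0: "s0 * N * s0 = s0 * G * s0 * (Y * s0) - Y * s0 * (s0 * G * s0) - s0 * Z * p' * (p' * T)"
    proof -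
      have "s0 * (Z * (p' * T)) = s0 * (Z * (p' * (T * s0)))" by (simp add: D)
      also have "\<dots> = s0 * (Z * (T * s0))" unfolding ZT by (simp add: D)
      finally show ?thesis
        by (simp add: N_def algebra_simps R1' y3 y3[THEN mult_assocI] y3[THEN mult_assocI, unfolded mult.assoc])
    qed
    have n1: "s1 * N * s1 = (s1 * G * s1 + P * F * T * s1) * (Y * s1) - Y * s1 * (s1 * G * s1 + P * F * T * s1)"
      by (simp add: N_def algebra_simps R3')
    have J: "HK p' 0 s0 (p' * F * p') (p' * T) (s0 * G * s0) (X * p') (Y * s0) (s0 * Z * p')"
      unfolding HK_def n0[symmetric]
    proof (intro conjI)
      show "X * p' \<in> hom (p' + 0) (p' + 0)" using x2 by (simp add: hom_def mult.assoc D)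
      show "Y * s0 \<in> hom s0 s0" by (simp add: hom_def mult.assoc D mult_assocI[OF y3])
      show "tp (Y * s0) = - (Y * s0)" using y3 Y(2) ts0 by simp
      show "s0 * Z * p' \<in> hom (p' + 0) s0" by (simp add: hom_def mult.assoc D) (simp add: D flip: mult.assoc)
      show "p' * T * (Y * s0) = X * p' * (p' * T)"
      proof -
        have "X * (p' * T) = p' * (X * T)" unfolding mult.assoc[symmetric] x3 ..
        also have "\<dots> = p' * (T * Y)" by (simp add: e1)
        also have "\<dots> = p' * (T * s0) * Y" unfolding D(20) by (simp only: mult.assoc)
        also have "\<dots> = p' * (T * (Y * s0))" by (simp add: mult.assoc y3)
        finally show ?thesis by (simp add: mult.assoc R1')
      qed
      have "p' * (p' * F * p' * (X * p') - X * p' * (p' * F * p') + p' * T * (s0 * Z * p'))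
         = p' * (F * (X * p') - X * (F * p') + T * (Z * p'))"
        by (simp add: algebra_simps x3 x3[THEN mult_assocI] x2[symmetric] R1' D(20)[THEN mult_assocI, unfolded mult.assoc])
      then show "p' * (p' * F * p' * (X * p') - X * p' * (p' * F * p') + p' * T * (s0 * Z * p')) = 0"
        by (simp add: m3)
      show "tp (s0 * N * s0) = s0 * N * s0" by (simp add: tN ts0 mult.assoc)
    qed simp_all
    have S: "skewK s1 (s1 * G * s1 + P * F * T * s1) (Y * s1)"
      unfolding skewK_def n1[symmetric]
    proof (intro conjI)
      show "Y * s1 \<in> hom s1 s1" by (simp add: hom_def mult.assoc D mult_assocI[OF y2])
      show "tp (Y * s1) = - (Y * s1)" using y2 Y(2) s1(2) by simp
      show "tp (s1 * N * s1) = s1 * N * s1" by (simp add: tN s1(2) mult.assoc)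
    qed
    have z: "X * p' = 0" "Y * s0 = 0" "s0 * Z * p' = 0" "Y * s1 = 0" using R J S by blast+
    have "Y = Y * s0 + Y * s1" using Y(1) by (simp add: s0 algebra_simps homD)
    then have Y0: "Y = 0" using z by simp
    have "X * (T * P) = 0" unfolding XTP Y0 by simp
    then have X0: "X = 0" using decr[of X] R2 z by simp
    have z1: "s1 * Z = 0" using m2 X0 Y0 by simp
    \<comment> \<open>With \<open>Y = 0\<close> only \<open>Z * T\<close> is left in the symmetric
      matrix \<open>N\<close>. Its off-diagonal blocks are transposes of each other, which carries
      the vanishing of \<open>s1 * Z\<close> over to \<open>s0 * Z * T * s1\<close>.\<close>
    have N0: "N = - (Z * T)" by (simp add: N_def Y0)
    have "s1 * N * s0 = 0" using z1 by (simp add: N0) (simp flip: mult.assoc)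
    moreover have "tp (s1 * N * s0) = s0 * N * s1" by (simp only: tp_times tN s1(2) ts0 mult.assoc)
    ultimately have "s0 * N * s1 = 0" by simp
    then have "s0 * (Z * (T * s1)) = 0" by (simp add: N0 mult.assoc)
    then have "s0 * (Z * (T * s1)) * P = 0" by simp
    then have zTP: "s0 * Z * (T * P) = 0" by (simp add: mult.assoc R1')
    have "s0 * Z * n = s0 * Z" using Z by (simp add: mult.assoc homD)
    note dr = decr[OF this]
    have "s0 * Z = 0" using z(3) zTP by (subst dr) simp
    moreover have "Z = s0 * Z + s1 * Z" using Z by (simp add: s0 algebra_simps homD)
    ultimately have "Z = 0" using z1 by simp
    then show "X = 0 \<and> Y = 0 \<and> Z = 0" using X0 Y0 by simp
  qed
  have bwd: "X2 = 0 \<and> Y0 = 0 \<and> Z2 = 0 \<and> Y1 = 0" if L: ?L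
    and J: "HK p' 0 s0 (p' * F * p') (p' * T) (s0 * G * s0) X2 Y0 Z2"
    and S: "skewK s1 (s1 * G * s1 + P * F * T * s1) Y1" for X2 Y0 Z2 Y1
  proof -
    from J have X2: "X2 \<in> hom p' p'" and Y0: "Y0 \<in> hom s0 s0" "tp Y0 = - Y0" and Z2: "Z2 \<in> hom p' s0"
      and e1: "p' * T * Y0 = X2 * (p' * T)" and e2: "p' * (p' * F * p' * X2 - X2 * (p' * F * p') + p' * T * Z2) = 0"
      and e3: "tp (s0 * G * s0 * Y0 - Y0 * (s0 * G * s0) - Z2 * (p' * T)) = s0 * G * s0 * Y0 - Y0 * (s0 * G * s0) - Z2 * (p' * T)"
      by (auto simp: HK_def)
    from S have Y1: "Y1 \<in> hom s1 s1" "tp Y1 = - Y1"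
      and e4: "tp ((s1 * G * s1 + P * F * T * s1) * Y1 - Y1 * (s1 * G * s1 + P * F * T * s1))
         = (s1 * G * s1 + P * F * T * s1) * Y1 - Y1 * (s1 * G * s1 + P * F * T * s1)"
      by (auto simp: skewK_def)
    have A: "P * X2 = 0" "n * X2 = X2" "X2 * n = X2" "X2 * (T * P) = 0" "X2 * (T * s1) = 0"
      "s1 * Y0 = 0" "Y0 * s1 = 0" "s * Y0 = Y0" "Y0 * s = Y0" "Y0 * P = 0"
      "s0 * Y1 = 0" "Y1 * s0 = 0" "s * Y1 = Y1" "Y1 * s = Y1"
      "s1 * Z2 = 0" "s * Z2 = Z2" "Z2 * n = Z2" "Z2 * (T * P) = 0" "Z2 * (T * s1) = 0"
      using hom_annihilate[OF X2] hom_annihilate[OF Y0(1)] hom_annihilate[OF Y1(1)] hom_annihilate[OF Z2] D by auto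
    note R2 = homD(1,2)[OF X2] homD(1,2)[OF Y0(1)] homD(1,2)[OF Y1(1)] homD(1,2)[OF Z2] A
    note R2' = R1' R2 R2[THEN mult_assocI] R2[THEN mult_assocI, unfolded mult.assoc]
    have TY0: "T * Y0 = X2 * T"
    proof -
      have "n * (T * Y0) = T * Y0" by (simp add: R1')
      from decl[OF this] have "T * Y0 = p' * (T * Y0)" by (simp add: R2')
      also have "\<dots> = X2 * T" using e1 by (simp add: mult.assoc R2')
      finally show ?thesis .
    qed
    define X where "X = X2 + T * Y1 * P"
    define Y where "Y = Y0 + Y1"
    \<comment> \<open>The component \<open>s1 * Z\<close>, forced by applying \<open>P\<close> to
      the vanishing condition.\<close>
    define A1 where "A1 = Y1 * P * F - P * F * X"
    define N0 where "N0 = G * Y - Y * G"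
    \<comment> \<open>\<open>K\<close> is the still free component \<open>s0 * Z * T * s1\<close>,
      set to the value that makes the off-diagonal blocks of \<open>N\<close> transposes of each
      other.\<close>
    define K where "K = s0 * N0 * s1 - tp (s1 * N0 * s0 - A1 * T * s0)"
    define Z where "Z = A1 + Z2 + K * P"
    have "p' * (T * Y1) = p' * (T * (s1 * Y1))" using Y1(1) by (simp add: homD)
    then have pTY: "p' * (T * Y1) = 0"
      by (simp only: D(9)[THEN mult_assocI, unfolded mult.assoc] mult_zero_left)
    have x: "P * X = Y1 * P" "X * p' = X2" "p' * X = X2" "n * X = X" "X * n = X" "X * T = T * Y"
      by (simp_all add: X_def Y_def algebra_simps R2' TY0 pTY pTY[THEN mult_assocI, unfolded mult.assoc])
    have a: "s1 * A1 = A1" "A1 * n = A1" "s * A1 = A1" "s0 * A1 = 0"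
      by (simp_all add: A1_def algebra_simps R2' x)
    have tA1: "tp A1 * s1 = tp A1" using arg_cong[OF a(1), of tp] s1(2) by simp
    have k: "s0 * K = K" "K * s1 = K" "s1 * K = 0" "s * K = K"
      using s1(2) ts0 by (simp_all add: K_def algebra_simps R1' tA1 tA1[THEN mult_assocI])
    have "K * s1 * s = K * s1" by (simp only: mult.assoc D(12))
    then have k5: "K * s = K" using k(2) by simp
    note R3 = R2 x a k k5
    note R3' = R2' R3 R3[THEN mult_assocI] R3[THEN mult_assocI, unfolded mult.assoc]
    define M where "M = F * X - X * F + T * Z"
    have M1: "n * M = M" by (simp add: M_def Z_def algebra_simps R3')
    have PM: "P * M = 0"
    proof -
      have "P * M = P * F * X - Y1 * P * F + A1"
        by (simp add: M_def Z_def algebra_simps R3')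
      then show ?thesis by (simp add: A1_def)
    qed
    have qM: "q * M = 0"
    proof -
      have "q * M = q * (p' * M + T * (P * M))" using decl[OF M1] by simp
      then show ?thesis using PM by (simp add: distrib_left D(4)[THEN mult_assocI])
    qed
    have p'TA: "p' * (T * A1) = 0"
    proof -
      have "p' * (T * A1) = p' * (T * (s1 * A1))" by (simp only: a)
      then show ?thesis by (simp only: D(9)[THEN mult_assocI, unfolded mult.assoc] mult_zero_left)
    qed
    have "p' * (M * p') = p' * (p' * F * p' * X2 - X2 * (p' * F * p') + p' * T * Z2)"
      by (simp add: M_def Z_def algebra_simps R3' p'TA p'TA[THEN mult_assocI, unfolded mult.assoc])
    then have pMp: "p' * (M * p') = 0" using e2 by simp
    have "n * (M * p') = M * p'" using M1 by (simp flip: mult.assoc)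
    note dl = decl[OF this]
    have "P * (M * p') = 0" using PM by (simp flip: mult.assoc)
    then have Mp': "M * p' = 0" using pMp by (subst dl) simp
    have "M * p = M * p' * p" by (simp only: mult.assoc D(3))
    then have Mp: "M * p = 0" unfolding Mp' by simp
    define N where "N = N0 - Z * T"
    have N1: "s1 * N * s1 = (s1 * G * s1 + P * F * T * s1) * Y1 - Y1 * (s1 * G * s1 + P * F * T * s1)"
      by (simp add: N_def N0_def Z_def A1_def algebra_simps R3' Y_def)
    have N2: "s0 * N * s0 = s0 * G * s0 * Y0 - Y0 * (s0 * G * s0) - Z2 * (p' * T)"
    proof -
      have "Z2 * (T * s0) = Z2 * T" using h(2) A by (simp add: s0 algebra_simps homD)
      moreover have "K * (s1 * s0) = K * s0" using k by (simp flip: mult.assoc)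
      ultimately show ?thesis
        by (simp add: N_def N0_def Z_def algebra_simps R3' Y_def)
    qed
    have N3: "s0 * N * s1 = tp (s1 * N * s0)"
    proof -
      have "s0 * N * s1 = s0 * N0 * s1 - K"
        by (simp add: N_def Z_def algebra_simps R3')
      also have "\<dots> = tp (s1 * N0 * s0 - A1 * T * s0)" by (simp add: K_def)
      also have "s1 * N0 * s0 - A1 * T * s0 = s1 * N * s0"
        by (simp add: N_def Z_def algebra_simps R3')
      finally show ?thesis .
    qed
    have tN: "tp N = N"
    proof -
      have N4: "s * N = N" "N * s = N"
        by (simp_all add: N_def N0_def Z_def Y_def algebra_simps R3')
      have ss: "s = s0 + s1" by (simp add: s0)
      have "N = (s0 + s1) * N * (s0 + s1)" using N4 by (simp flip: ss)
      then have eq: "N = s0 * N * s0 + s0 * N * s1 + s1 * N * s0 + s1 * N * s1" by (simp add: algebra_simps)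
      have "tp (s0 * N * s1) = s1 * N * s0" unfolding N3 by (rule tp_tp)
      moreover have "tp (s1 * N * s0) = s0 * N * s1" unfolding N3 ..
      moreover have "tp (s0 * N * s0) = s0 * N * s0" unfolding N2 by (rule e3)
      moreover have "tp (s1 * N * s1) = s1 * N * s1" unfolding N1 by (rule e4)
      moreover have "tp N = tp (s0 * N * s0) + tp (s0 * N * s1) + tp (s1 * N * s0) + tp (s1 * N * s1)"
        using arg_cong[OF eq, of tp] by (simp only: tp_add)
      ultimately have "tp N = s0 * N * s0 + s1 * N * s0 + s0 * N * s1 + s1 * N * s1" by (simp only:)
      also have "\<dots> = s0 * N * s0 + s0 * N * s1 + s1 * N * s0 + s1 * N * s1" by (simp only: ac_simps)
      also have "\<dots> = N" by (rule eq[symmetric])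
      finally show ?thesis .
    qed
    have qXp: "q * X * p = 0"
    proof -
      have "q * X * p = q * (X * p') * p" using D(3) by (simp add: mult.assoc)
      also have "\<dots> = q * p' * X2 * p" using X2 by (simp add: x mult.assoc homD)
      finally show ?thesis by (simp add: D)
    qed
    have "HK q p s F T G X Y Z"
      unfolding HK_def M_def[symmetric] n_def[symmetric] N0_def[symmetric] N_def[symmetric]
    proof (intro conjI qXp qM Mp tN)
      show "X \<in> hom n n" using x by (simp add: hom_def)
      show "Y \<in> hom s s" "Z \<in> hom n s" by (simp_all add: hom_def Y_def Z_def algebra_simps R3')
      show "tp Y = - Y" using Y0 Y1 by (simp add: Y_def)
      show "T * Y = X * T" using x by simp
    qed
    then have z: "X = 0" "Y = 0" "Z = 0" using L by blast+
    have "X2 = X * p'" "Y0 = Y * s0" "Y1 = Y * s1" by (simp_all add: x Y_def distrib_right R2)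
    moreover have "Z2 = s0 * Z * p'" by (simp add: Z_def algebra_simps R3')
    ultimately show ?thesis using z by simp
  qed
  have S0: "skewK s1 (s1 * G * s1 + P * F * T * s1) 0" by (simp add: skewK_def)
  have J0: "HK p' 0 s0 (p' * F * p') (p' * T) (s0 * G * s0) 0 0 0" by (simp add: HK_def)
  show ?thesis using fwd bwd S0 J0 by blast
qed

text \<open>A corner of rank at most one consists of multiples of \<open>s\<close>, which are
  symmetric; a matrix that is both symmetric and skew vanishes.\<close>

lemma skew_rank_le_one:
  fixes s :: "'a::field_char_0 fmat"
  assumes "idem s" "tp s = s" "tr s = of_nat r" "r \<le> 1" "Y \<in> hom s s" "tp Y = - Y"
  shows "Y = 0"
proof (cases "r = 0")
  case True
  then have "s = 0" using assms idem_tr_zero by simp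
  then show ?thesis using assms(5) by (simp add: hom_def)
next
  case False
  then have r1: "r = 1" using assms(4) by simp
  obtain T P where TP: "P * T = s" "T * P = dg 1" "T \<in> hom s (dg 1)" "P \<in> hom (dg 1) s"
    using idem_equiv_dg'[OF assms(1,3)] r1 by blast
  have dg1: "dg 1 = (munit 0 0 :: 'a fmat)" by (simp add: dg_def)
  define c where "c = ent (T * Y * P) 0 0"
  have "Y = s * Y * s" using assms(5) by (simp add: homD)
  also have "\<dots> = P * (T * Y * P) * T" by (simp add: mult.assoc flip: TP(1))
  also have "\<dots> = P * (munit 0 0 * (T * Y * P) * munit 0 0) * T"
    using TP(3,4) by (simp add: homD mult.assoc flip: dg1)
  also have "\<dots> = c *f (P * dg 1 * T)"
    unfolding munit_times_times_munit c_def[symmetric] by (simp only: dg1 smul_left smul_right)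
  also have "P * dg 1 * T = s" using TP by (simp add: homD)
  finally have Y: "Y = c *f s" .
  then have "tp Y = Y" using assms(2) by simp
  then have "Y + Y = 0" using assms(6) by (metis add.right_inverse)
  then show ?thesis by (rule fmat_double_eq_zero)
qed

text \<open>If the kernel is trivial, the skew part of \<open>G\<close> vanishes, and then every
  skew matrix lies in the kernel. So all of the corner is symmetric, hence commutative, which forces
  rank at most one.\<close>

lemma frobSO_iff:
  fixes s :: "'a::field_char_0 fmat"
  assumes s: "idem s" "tp s = s" "tr s = of_nat r"
  shows "frobSO s \<longleftrightarrow> r \<le> 1"
proof
  assume "r \<le> 1"
  then show "frobSO s"
    unfolding frobSO_def skewK_def using skew_rank_le_one[OF s] hom_closed(1)[of s s] by blast
next
  assume "frobSO s"
  then obtain G where G: "G \<in> hom s s" "\<And>Y. skewK s G Y \<Longrightarrow> Y = 0" by (auto simp: frobSO_def)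
  have thom: "tp x \<in> hom s s" if "x \<in> hom s s" for x
    using arg_cong[OF homD(1)[OF that], of tp] arg_cong[OF homD(2)[OF that], of tp] s(2)
    by (simp add: hom_def)
  \<comment> \<open>The commutator of \<open>G\<close> with \<open>G - tp G\<close> is
    \<open>tp G * G - G * tp G\<close>, which is symmetric.\<close>
  have "skewK s G (G - tp G)"
    using G(1) thom by (auto simp: skewK_def algebra_simps)
  then have G0: "tp G = G" using G(2) by fastforce
  have sym: "tp x = x" if "x \<in> hom s s" for x
  proof -
    have "skewK s G (x - tp x)"
      using that thom by (auto simp: skewK_def algebra_simps G0)
    then show ?thesis using G(2) by fastforce
  qed
  have comm: "x * y = y * x" if "x \<in> hom s s" "y \<in> hom s s" for x y
  proof -
    have "x * y \<in> hom s s" using that by blast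
    then have "tp (x * y) = x * y" by (rule sym)
    then show ?thesis using sym that by simp
  qed
  \<comment> \<open>In rank two or more, a rank one projection and its complement are joined by a
    nonzero map, which does not commute with the projection.\<close>
  show "r \<le> 1"
  proof (rule ccontr)
    assume r: "\<not> r \<le> 1"
    then have "s \<noteq> 0" using s(3) by auto
    then obtain f where f: "idem f" "tp f = f" "f \<in> hom s s" "tr f = 1"
      using symmetric_rank_one_idem[OF s(1,2)] by blast
    have "tr f = of_nat 1" using f by simp
    note d = idem_rank_diff(3)[OF f(1) s(1) f(3) s(3) this]
    have "s - f \<noteq> 0" using d r by auto
    moreover have "f \<noteq> 0" using f(4) by auto
    ultimately obtain w where w: "f * w * (s - f) \<noteq> 0" using nonzero_mult_between by blast
    let ?x = "f * w * (s - f)"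
    have "?x \<in> hom s s"
    proof -
      have sf: "s * f = f" "(s - f) * s = s - f" using f(3) s(1) by (simp_all add: left_diff_distrib homD)
      show ?thesis by (simp add: hom_def mult.assoc sf mult_assocI[OF sf(1)])
    qed
    then have "f * ?x = ?x * f" using comm f(3) by blast
    moreover have "f * ?x = ?x" using f(1) by (simp flip: mult.assoc)
    moreover have "?x * f = 0" using f(1,3) by (simp add: algebra_simps homD)
    ultimately show False using w by simp
  qed
qed

lemma frobH_zero: "frobH 0 0 s \<longleftrightarrow> frobSO s"
  by (auto simp: frobH_def frobSO_def HK_def skewK_def hom_def)

lemma not_frobE_zero:
  assumes "idem k" "k \<noteq> 0"
  shows "\<not> frobE 0 k s"
proof
  assume "frobE 0 k s"
  then obtain F Ts Tk Gs Gk where h: "Tk \<in> hom k 0" "Gk \<in> hom k k" and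
    L: "\<forall>X Y W Zs Zk. EK 0 k s F Ts Tk Gs Gk X Y W Zs Zk \<longrightarrow> X = 0 \<and> Y = 0 \<and> W = 0 \<and> Zs = 0 \<and> Zk = 0"
    by (auto simp: frobE_def)
  have "EK 0 k s F Ts Tk Gs Gk 0 0 k 0 0"
    using h assms(1) by (simp add: EK_def hom_def)
  then show False using L assms(2) by blast
qed

text \<open>In the absence of a symmetric part the identity of \<open>q + p\<close> commutes with
  everything and lies in every kernel.\<close>

lemma not_frobH_zero:
  assumes "idem q" "idem p" "q * p = 0" "p * q = 0" "q + p \<noteq> 0"
  shows "\<not> frobH q p 0"
proof
  assume "frobH q p 0"
  then obtain F T G where h: "F \<in> hom (q + p) (q + p)" "T \<in> hom 0 (q + p)" and
    L: "\<forall>X Y Z. HK q p 0 F T G X Y Z \<longrightarrow> X = 0 \<and> Y = 0 \<and> Z = 0"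
    by (auto simp: frobH_def)
  have T: "T = 0" using h(2) by (simp add: hom_def)
  have "q + p \<in> hom (q + p) (q + p)" using assms by (simp add: hom_def algebra_simps)
  moreover have "q * (q + p) * p = 0" using assms by (simp add: algebra_simps)
  ultimately have "HK q p 0 F T G (q + p) 0 0"
    using homD[OF h(1)] by (simp add: HK_def T hom_def)
  then show False using L assms(5) by blast
qed

text \<open>The delicate point is a right inverse \<open>P\<close> of \<open>q * T\<close> for which
  \<open>P * T\<close> is symmetric. The orthogonal one, transpose times inverse Gram matrix, is the
  natural candidate, so the Gram matrix has to be shown invertible.\<close>

lemma stepD:
  fixes q p s :: "'a::field_char_0 fmat"
  assumes id: "idem q" "idem p" "q * p = 0" "p * q = 0" "idem s" "tp s = s"
    and tr: "tr q = of_nat a" "tr p = of_nat b" "tr s = of_nat r" "a \<le> r"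
  shows "frobH q p s \<Longrightarrow> \<exists>(s1 :: 'a fmat) (s0 :: 'a fmat) p'. idem s1 \<and> tp s1 = s1 \<and> tr s1 = of_nat a \<and>
      idem s0 \<and> tp s0 = s0 \<and> tr s0 = of_nat (r - a) \<and> idem p' \<and> tr p' = of_nat b \<and>
      frobSO s1 \<and> frobH p' 0 s0"
    and "a \<le> 1 \<Longrightarrow> (\<And>s0. idem s0 \<Longrightarrow> tp s0 = s0 \<Longrightarrow> tr s0 = of_nat (r - a) \<Longrightarrow> frobH p 0 s0) \<Longrightarrow> frobH q p s"
proof -
  {
    assume "frobH q p s"
    then obtain F T G where h: "F \<in> hom (q + p) (q + p)" "T \<in> hom s (q + p)" "G \<in> hom s s"
      and L: "\<forall>X Y Z. HK q p s F T G X Y Z \<longrightarrow> X = 0 \<and> Y = 0 \<and> Z = 0"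
      by (auto simp: frobH_def)
    have qT: "q * T \<in> hom s q" using id h(2) by (simp add: hom_def mult.assoc) (simp flip: mult.assoc)
    \<comment> \<open>A sharper test than in the other steps: \<open>z * T\<close> need only be
      symmetric, as the last equation of \<open>HK\<close> asks for no more.\<close>
    have nz: "z = 0" if z: "z \<in> hom q s" "q * T * z = 0" "tp (z * T) = z * T" for z
    proof -
      have "z * p = 0" using hom_annihilate(2)[OF z(1) id(3)] .
      then have "HK q p s F T G 0 0 z"
        using z by (simp add: HK_def hom_def mult.assoc distrib_left)
      then show ?thesis using L by blast
    qed
    have nz': "z = 0" if z: "z \<in> hom q s" "q * T * z = 0" "z * (q * T) = 0" for z
    proof -
      have "z * T = 0" using z by (simp add: homD)
      then have "tp (z * T) = z * T" by simp
      then show ?thesis by (rule nz[OF z(1,2)])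
    qed
    obtain P0 where P0: "P0 \<in> hom q s" "q * T * P0 = q"
      using surj_of_rank[OF id(5,1) qT tr(3,1,4) nz'] by blast
    \<comment> \<open>Transposition is not compatible with \<open>q\<close>, so \<open>q * T\<close>
      is moved to standard coordinates before a Gram matrix is formed.\<close>
    obtain T1 P1 where TP1: "P1 * T1 = q" "T1 * P1 = dg a" "T1 \<in> hom q (dg a)" "P1 \<in> hom (dg a) q"
      using idem_equiv_dg'[OF id(1) tr(1)] by blast
    define T2 where "T2 = T1 * (q * T)"
    have T2: "T2 \<in> hom s (dg a)" using TP1(3) qT unfolding T2_def by blast
    have tT2: "tp T2 \<in> hom (dg a) s"
      using arg_cong[OF homD(1)[OF T2], of tp] arg_cong[OF homD(2)[OF T2], of tp] id(6) by (simp add: hom_def)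
    have P1T2: "P1 * T2 = q * T" using TP1 qT by (simp add: T2_def homD flip: mult.assoc)
    have T1T: "T1 * T = T2" using TP1(3) by (simp add: T2_def homD)
    have dd: "idem (dg a :: 'a fmat)" by (simp add: dg_times_dg)
    define S where "S = T2 * tp T2"
    have S: "S \<in> hom (dg a) (dg a)" "tp S = S" using T2 tT2 by (auto simp: S_def)
    obtain B where B: "B \<in> hom (dg a) (dg a)" "S * B = dg a" "tp B = B"
    proof (rule symmetric_inverse_or_kernel[OF dd tp_dg S])
      fix w :: "'a fmat"
      assume w: "w * munit 0 0 = w" "w \<noteq> 0" "dg a * w = w" "S * w = 0"
      \<comment> \<open>A vector in the kernel of the Gram matrix yields a rank one \<open>z\<close>
        with \<open>q * T * z = 0\<close> and \<open>z * T\<close> symmetric, which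
        \<open>nz\<close> excludes.\<close>
      define z where "z = tp T2 * w * tp w * T1"
      have "z \<in> hom q s"
        using tT2 TP1(3) by (simp add: z_def hom_def mult.assoc) (simp flip: mult.assoc)
      moreover have "q * T * z = P1 * (S * w) * tp w * T1"
        by (simp add: z_def S_def mult.assoc flip: P1T2)
      then have "q * T * z = 0" using w by simp
      moreover have "z * T = tp T2 * w * tp w * T2" by (simp add: z_def mult.assoc T1T)
      then have "tp (z * T) = z * T" by (simp add: mult.assoc)
      ultimately have z0: "z = 0" by (rule nz)
      \<comment> \<open>A right inverse of \<open>T2\<close>; it recovers \<open>w * tp w\<close>
        from \<open>z\<close>.\<close>
      define P2 where "P2 = P0 * P1"
      have "T2 * P2 = T1 * (q * T * P0) * P1" by (simp add: P2_def T2_def mult.assoc)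
      also have "\<dots> = dg a" using TP1 by (simp add: P0(2) homD)
      finally have "tp (T2 * P2) = dg a" by simp
      then have e: "tp P2 * tp T2 = dg a" by simp
      have tw: "tp w * dg a = tp w" using arg_cong[OF w(3), of tp] by simp
      have "tp P2 * z * P1 = (tp P2 * tp T2) * w * (tp w * (T1 * P1))"
        by (simp add: z_def mult.assoc)
      also have "\<dots> = w * tp w" by (simp add: e TP1 tw w)
      finally show thesis using z0 column_square_nonzero[OF w(1,2)] by simp
    qed (use that in blast)
    \<comment> \<open>\<open>B\<close> inverts the Gram matrix, so this is the orthogonal right
      inverse, and \<open>P * T = tp T2 * B * T2\<close> is visibly symmetric.\<close>
    define P where "P = tp T2 * B * T1"
    have P: "P \<in> hom q s" using tT2 B(1) TP1(3) unfolding P_def by blast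
    have qTP: "q * T * P = q"
    proof -
      have "q * T * P = P1 * (S * B) * T1" by (simp add: P_def S_def mult.assoc flip: P1T2)
      also have "\<dots> = q" unfolding B(2) using TP1 by (simp add: homD)
      finally show ?thesis .
    qed
    define s1 where "s1 = P * T"
    have PqT: "P * (q * T) = s1" using P by (simp add: s1_def homD)
    have s1: "tp s1 = s1" by (simp add: s1_def P_def mult.assoc T1T B)
    define s0 where "s0 = s - s1"
    define p' where "p' = p - p * T * P"
    note r = retract_idem[OF qT P]
    have s1i: "idem s1" "s1 \<in> hom s s" "tr s1 = of_nat a"
      using retract_idem[OF P qT qTP] tr(1) by (simp_all add: PqT)
    have s0i: "idem s0" "tr s0 = of_nat (r - a)" "tp s0 = s0"
      using idem_rank_diff(2,3)[OF s1i(1) id(5) s1i(2) tr(3) s1i(3)] s1 id(6) by (auto simp: s0_def)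
    have Pp: "P * p = 0" using hom_annihilate(2)[OF P(1) id(3)] .
    have p'1: "idem p'"
    proof -
      have "p' * p = p" by (simp add: p'_def left_diff_distrib mult.assoc Pp id)
      moreover have "p' * p' = p' * p - p' * p * T * P" by (simp add: p'_def right_diff_distrib mult.assoc)
      ultimately show ?thesis by (simp add: p'_def)
    qed
    have "tr (p * T * P) = tr (P * (p * T))" using tr_comm[of "p * T" P] by simp
    also have "\<dots> = 0" using Pp by (simp flip: mult.assoc)
    finally have p'2: "tr p' = of_nat b" using tr by (simp add: p'_def)
    note K = iffD1[OF stepD_kernel[OF id h P qTP s1_def s1 s0_def p'_def] L]
    have s1P: "s1 * P = P"
    proof -
      have "s1 * P = P * (q * T * P)" by (simp add: mult.assoc flip: PqT)
      then show ?thesis using P by (simp add: qTP homD)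
    qed
    have p'Ts1: "p' * (T * s1) = 0"
    proof -
      have "p' * (T * P) = p * T * P - p * T * (P * T * P)" by (simp add: p'_def algebra_simps)
      also have "P * T * P = P" using s1P by (simp add: s1_def)
      finally have "p' * (T * P) = 0" by simp
      then have "p' * (T * P) * T = 0" by simp
      then show ?thesis by (simp add: s1_def mult.assoc)
    qed
    have so: "frobSO s1"
      unfolding frobSO_def
    proof (rule bexI)
      show "\<forall>Y. skewK s1 (s1 * G * s1 + P * F * T * s1) Y \<longrightarrow> Y = 0" using K by blast
      show "s1 * G * s1 + P * F * T * s1 \<in> hom s1 s1"
        using s1i(1) by (simp add: hom_def mult.assoc distrib_left distrib_right)
          (simp add: s1P flip: mult.assoc)
    qed
    have H: "frobH p' 0 s0"
      unfolding frobH_def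
    proof (rule bexI, rule bexI, rule bexI)
      show "\<forall>X Y Z. HK p' 0 s0 (p' * F * p') (p' * T) (s0 * G * s0) X Y Z \<longrightarrow> X = 0 \<and> Y = 0 \<and> Z = 0"
        using K by blast
      show "s0 * G * s0 \<in> hom s0 s0" using s0i by blast
      show "p' * T \<in> hom s0 (p' + 0)"
        using p'1 p'Ts1 h(2) by (simp add: hom_def s0_def right_diff_distrib mult.assoc) (simp flip: mult.assoc)
      show "p' * F * p' \<in> hom (p' + 0) (p' + 0)" using p'1 by (simp add: hom_corner)
    qed
    show "\<exists>(s1 :: 'a fmat) (s0 :: 'a fmat) p'. idem s1 \<and> tp s1 = s1 \<and> tr s1 = of_nat a \<and>
      idem s0 \<and> tp s0 = s0 \<and> tr s0 = of_nat (r - a) \<and> idem p' \<and> tr p' = of_nat b \<and>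
      frobSO s1 \<and> frobH p' 0 s0"
      by (rule exI[of _ s1], rule exI[of _ s0], rule exI[of _ p'], intro conjI)
        (fact s1i s1 s0i p'1 p'2 so H)+
  next
    assume a: "a \<le> 1" and IH: "\<And>s0. idem s0 \<Longrightarrow> tp s0 = s0 \<Longrightarrow> tr s0 = of_nat (r - a) \<Longrightarrow> frobH p 0 s0"
    \<comment> \<open>A symmetric idempotent of rank at most one, on which the skew matrices vanish,
      so that no condition arises from this factor.\<close>
    obtain s1 where s1: "idem s1" "tp s1 = s1" "s1 \<in> hom s s" "tr s1 = of_nat a"
    proof (cases "a = 0")
      case True
      then show ?thesis using that[of 0] by simp
    next
      case False
      then have "a = 1" "s \<noteq> 0" using a tr(3,4) by auto
      then show ?thesis using symmetric_rank_one_idem[OF id(5,6)] that by auto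
    qed
    obtain T1 P where TP: "T1 \<in> hom s1 q" "P \<in> hom q s1" "P * T1 = s1"
      using idem_embed[OF s1(1) id(1) s1(4) tr(1)] by blast
    note r = retract_idem[OF TP]
    have TPq: "T1 * P = q"
      using idem_rank_diff(4)[OF r(1) id(1) r(2) tr(1)] r(3) s1(4) by auto
    define s0 where "s0 = s - s1"
    have s0: "idem s0" "tr s0 = of_nat (r - a)" "tp s0 = s0"
      using idem_rank_diff(2,3)[OF s1(1) id(5) s1(3) tr(3) s1(4)] s1 id(6) by (auto simp: s0_def)
    have ss: "s0 * s1 = 0" "s1 * s0 = 0" "s * s0 = s0" "s0 * s = s0" "s * s1 = s1" "s1 * s = s1"
      using s1 id(5) by (simp_all add: s0_def algebra_simps homD)
    obtain F T2 G where h: "F \<in> hom p p" "T2 \<in> hom s0 p" "G \<in> hom s0 s0"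
      and L: "\<forall>X Y Z. HK p 0 s0 F T2 G X Y Z \<longrightarrow> X = 0 \<and> Y = 0 \<and> Z = 0"
      using IH[OF s0(1,3,2)] by (auto simp: frobH_def)
    define T where "T = T1 + T2"
    have A: "q * T2 = 0" "p * T1 = 0" "P * T2 = 0" "T2 * P = 0" "T1 * s = T1" "T2 * s = T2" "s * P = P"
      "F * q = 0" "q * F = 0" "s * G = G" "G * s = G"
      using hom_annihilate[OF TP(1)] hom_annihilate[OF TP(2)] hom_annihilate[OF h(1)] hom_annihilate[OF h(2)]
        hom_annihilate[OF h(3)] id ss by auto
    have "P * p = 0" using hom_annihilate(2)[OF TP(2) id(3)] .
    then have A2: "P * T2 = 0" using hom_annihilate(1)[OF h(2)] by blast
    note R = homD(1,2)[OF TP(1)] homD(1,2)[OF TP(2)] homD(1,2)[OF h(1)] homD(1,2)[OF h(2)] homD(1,2)[OF h(3)] A A2 TPq TP(3)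
    note R' = R R[THEN mult_assocI]
    have F: "F \<in> hom (q + p) (q + p)" and T: "T \<in> hom s (q + p)" and G: "G \<in> hom s s" and P: "P \<in> hom q s"
      by (simp_all add: hom_def T_def algebra_simps R')
    have e: "q * T * P = q" "s1 = P * T" "p = p - p * T * P" "p * T = T2" "p * F * p = F" "s0 * G * s0 = G"
      by (simp_all add: T_def algebra_simps R')
    have "\<forall>Y. skewK s1 (s1 * G * s1 + P * F * T * s1) Y \<longrightarrow> Y = 0"
      using skew_rank_le_one[OF s1(1,2,4) a] by (auto simp: skewK_def)
    then have "\<forall>X Y Z. HK q p s F T G X Y Z \<longrightarrow> X = 0 \<and> Y = 0 \<and> Z = 0"
      using stepD_kernel[OF id F T G P e(1,2) s1(2) s0_def e(3)] L unfolding e(4-6) by blast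
    then show "frobH q p s" unfolding frobH_def using F T G by blast
  }
qed

section \<open>The arithmetic criterion\<close>

definition condH :: "nat \<Rightarrow> nat \<Rightarrow> nat \<Rightarrow> bool" where
  "condH a b r \<longleftrightarrow> r = 1 \<and> gcd (a + b) (b + 1) = 1 \<or> r = 2 \<and> gcd (a + b) (b + 2) = 1 \<or>
     r = 3 \<and> odd a \<and> odd b \<and> gcd (a + b) (b + 3) = 2"

text \<open>The gcd equals that of \<open>c\<close> and \<open>k + r\<close>. Step A replaces
  \<open>k\<close> by \<open>k - c\<close>, step B has \<open>c = a + b\<close> and
  \<open>k = b\<close>, step C has \<open>c = a - r\<close> and \<open>k = b\<close>; each leaves it
  unchanged. The parity of \<open>c\<close> is that of \<open>a - 3\<close> for odd
  \<open>a\<close>.\<close>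

definition condE :: "nat \<Rightarrow> nat \<Rightarrow> nat \<Rightarrow> bool" where
  "condE c k r \<longleftrightarrow> r = 1 \<and> gcd (c + k + 1) (k + 1) = 1 \<or> r = 2 \<and> gcd (c + k + 2) (k + 2) = 1 \<or>
     r = 3 \<and> even c \<and> odd k \<and> gcd (c + k + 3) (k + 3) = 2"

lemma condE_stepA:
  assumes "m \<le> l"
  shows "condE m l r \<longleftrightarrow> condE m (l - m) r"
proof -
  obtain d where l: "l = m + d" using assms le_iff_add by blast
  have "gcd (m + l + t) (l + t) = gcd (m + (l - m) + t) (l - m + t)" for t
  proof -
    have "gcd (m + l + t) (l + t) = gcd m (m + (d + t))"
      using gcd_add1[of m "l + t"] by (simp add: l ac_simps)
    also have "\<dots> = gcd m (d + t)" by (rule gcd_add2)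
    also have "\<dots> = gcd (m + (d + t)) (d + t)" by simp
    finally show ?thesis by (simp add: l ac_simps)
  qed
  moreover have "even m \<and> odd l \<longleftrightarrow> even m \<and> odd (l - m)" by (auto simp: l)
  ultimately show ?thesis unfolding condE_def by metis
qed

lemma condE_stepB:
  assumes "l \<le> m"
  shows "condE m l r \<longleftrightarrow> condH (m - l) l r"
proof -
  obtain d where m: "m = l + d" using assms le_iff_add by blast
  have "gcd (m + l + t) (l + t) = gcd (m - l + l) (l + t)" for t
    using gcd_add1[of "l + d" "l + t"] by (simp add: m ac_simps)
  moreover have "even m \<and> odd l \<longleftrightarrow> odd (m - l) \<and> odd l" by (auto simp: m)
  ultimately show ?thesis unfolding condE_def condH_def by metis
qed

lemma condH_stepC:
  assumes "r \<le> a"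
  shows "condH a b r \<longleftrightarrow> condE (a - r) b r"
proof -
  have "gcd (a - r + b + r) (b + r) = gcd (a + b) (b + r)" using assms by simp
  moreover have "r = 3 \<Longrightarrow> odd a \<longleftrightarrow> even (a - r)" using assms by auto
  ultimately show ?thesis unfolding condE_def condH_def by metis
qed

lemma condE_zero: "0 < k \<Longrightarrow> \<not> condE 0 k r"
  by (auto simp: condE_def)

text \<open>For \<open>a = 0\<close> both sides involve \<open>gcd b r\<close>. For
  \<open>a = 1\<close> they reduce to the parity of \<open>b\<close>: consecutive numbers are
  coprime, and \<open>b + 1\<close>, \<open>b + 3\<close> have gcd 2 exactly for odd
  \<open>b\<close>. For larger \<open>a\<close>, neither side can hold: \<open>a = 2\<close> leaves
  only \<open>r = 3\<close>, which wants \<open>a\<close> odd.\<close>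

lemma condH_stepD:
  assumes "a < r" "\<not> (a = 0 \<and> b = 0)"
  shows "condH a b r \<longleftrightarrow> a \<le> 1 \<and> condH b 0 (r - a)"
proof -
  have "coprime (Suc b) (Suc (Suc b))" by simp
  then have 1: "gcd (Suc b) (Suc (Suc b)) = Suc 0" by (simp only: coprime_iff_gcd_eq_1 One_nat_def)
  have "gcd (Suc b) (b + 3) = gcd (Suc b) 2"
    using gcd_add2[of "Suc b" 2] by (simp add: eval_nat_numeral)
  moreover have "gcd (Suc b) 2 = 2 \<longleftrightarrow> even (Suc b)"
    by (metis gcd_nat.absorb_iff2)
  ultimately have 2: "gcd (Suc b) (b + 3) = 2 \<longleftrightarrow> odd b" by simp
  have "coprime b 2 \<longleftrightarrow> odd b" by simp
  then have 3: "gcd b 2 = Suc 0 \<longleftrightarrow> odd b" by (simp only: coprime_iff_gcd_eq_1 One_nat_def)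
  have 4: "gcd b (Suc (Suc 0)) = Suc 0 \<longleftrightarrow> odd b" by (metis 3 numeral_2_eq_2)
  consider "a = 0" | "a = 1" "r = 2" | "a = 1" "r = 3" | "a = 1" "4 \<le> r" | "a = 2" | "3 \<le> a"
    using assms by linarith
  then show ?thesis
  proof cases
    case 1
    have *: "gcd (0 + b) (b + t) = gcd (b + 0) (0 + t)" for t by simp
    show ?thesis unfolding condH_def 1 by (simp only: * minus_nat.diff_0) simp
  qed (use assms 1 2 3 4 in \<open>auto simp: condH_def\<close>)
qed

text \<open>The measure is three times the total size plus a tie-breaker. The total stays constant
  only in step B with \<open>k\<close> of rank 0 and in step D with \<open>a = 0\<close>; the
  summands 2 for \<open>EK\<close>, 1 for \<open>HK\<close> with \<open>a = 0\<close> and 0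
  otherwise make these steps decrease as well.\<close>

lemma frob_criterion:
  fixes q p s c k :: "'a::field_char_0 fmat"
  shows "\<lbrakk>idem q; idem p; q * p = 0; p * q = 0; idem s; tp s = s;
      tr q = of_nat a; tr p = of_nat b; tr s = of_nat r; 0 < r; m = 3 * (a + b + r) + (if a = 0 then 1 else 0)\<rbrakk>
      \<Longrightarrow> frobH q p s \<longleftrightarrow> condH a b r"
    and "\<lbrakk>idem c; idem k; idem s; tp s = s; tr c = of_nat a; tr k = of_nat b; tr s = of_nat r; 0 < r;
      m = 3 * (a + b + r) + 2\<rbrakk>
      \<Longrightarrow> frobE c k s \<longleftrightarrow> condE a b r"
proof (induction m arbitrary: q p s c k a b r rule: less_induct)
  case (less m)
  note IHH = less.IH(1) and IHE = less.IH(2)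
  {
    fix q p s :: "'a fmat" and a b r :: nat
    assume id: "idem q" "idem p" "q * p = 0" "p * q = 0" "idem s" "tp s = s"
      and tr: "tr q = of_nat a" "tr p = of_nat b" "tr s = of_nat r" and r: "0 < r"
      and m: "m = 3 * (a + b + r) + (if a = 0 then 1 else 0)"
    consider (C) "r \<le> a" | (Z) "a = 0" "b = 0" | (D) "a < r" "\<not> (a = 0 \<and> b = 0)" by linarith
    then show "frobH q p s \<longleftrightarrow> condH a b r"
    proof cases
      case C
      have E: "frobE c k s \<longleftrightarrow> condE (a - r) b r"
        if "idem c" "idem k" "tr c = of_nat (a - r)" "tr k = of_nat b" for c k
        by (rule IHE[OF _ that(1,2) id(5,6) that(3,4) tr(3) r refl]) (use m C r in auto)
      show ?thesis
        unfolding condH_stepC[OF C] using stepC[OF id(1-5) tr C] E by metis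
    next
      case Z
      then have "q = 0" "p = 0" using idem_tr_zero id tr by auto
      then show ?thesis
        using frobSO_iff[OF id(5,6) tr(3)] r Z by (auto simp: frobH_zero condH_def)
    next
      case D
      have H: "frobH p 0 s0 \<longleftrightarrow> condH b 0 (r - a)"
        if "idem p" "tr p = of_nat b" "idem s0" "tp s0 = s0" "tr s0 = of_nat (r - a)" for p s0 :: "'a fmat"
        by (rule IHH[of "3 * (b + 0 + (r - a)) + (if b = 0 then 1 else 0)"])
          (use that m D in \<open>auto split: if_splits\<close>)
      have le: "a \<le> r" using D by simp
      show ?thesis
        unfolding condH_stepD[OF D]
      proof
        assume "frobH q p s"
        then obtain s1 s0 p' :: "'a fmat" where *: "idem s1" "tp s1 = s1" "tr s1 = of_nat a"
          "idem s0" "tp s0 = s0" "tr s0 = of_nat (r - a)" "idem p'" "tr p' = of_nat b" "frobSO s1" "frobH p' 0 s0"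
          using stepD(1)[OF id tr le] by blast
        then show "a \<le> 1 \<and> condH b 0 (r - a)"
          using frobSO_iff[OF *(1-3)] H[OF *(7,8,4,5,6)] by blast
      next
        assume "a \<le> 1 \<and> condH b 0 (r - a)"
        then show "frobH q p s" using stepD(2)[OF id tr le] H[OF id(2) tr(2)] by blast
      qed
    qed
  next
    fix c k s :: "'a fmat" and a b r :: nat
    assume id: "idem c" "idem k" "idem s" "tp s = s"
      and tr: "tr c = of_nat a" "tr k = of_nat b" "tr s = of_nat r" and r: "0 < r"
      and m: "m = 3 * (a + b + r) + 2"
    consider (A) "0 < a" "a < b" | (B) "b \<le> a" | (Z) "a = 0" "0 < b" by linarith
    then show "frobE c k s \<longleftrightarrow> condE a b r"
    proof cases
      case A
      have E: "frobE c \<kappa> s \<longleftrightarrow> condE a (b - a) r"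
        if "idem \<kappa>" "tr \<kappa> = of_nat (b - a)" for \<kappa>
        by (rule IHE[OF _ id(1) that(1) id(3,4) tr(1) that(2) tr(3) r refl]) (use m A in auto)
      have le: "a \<le> b" using A by simp
      show ?thesis
        unfolding condE_stepA[OF le] using stepA[OF id(1-3) tr(1,2) le] E by metis
    next
      case B
      have H: "frobH q p s \<longleftrightarrow> condH (a - b) b r"
        if "idem q" "idem p" "q * p = 0" "p * q = 0" "tr q = of_nat (a - b)" "tr p = of_nat b" for q p
        by (rule IHH[OF _ that(1-4) id(3,4) that(5,6) tr(3) r refl]) (use m B in auto)
      show ?thesis
        unfolding condE_stepB[OF B] using stepB[OF id(1-3) tr(1,2) B] H by metis
    next
      case Z
      then have "c = 0" "k \<noteq> 0" using idem_tr_zero id tr by auto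
      then show ?thesis using not_frobE_zero[OF id(2)] condE_zero Z by simp
    qed
  }
qed

section \<open>Reduction from the semidirect product\<close>

text \<open>The part of the seaweed lying in the Levi factor gl(n) of the maximal parabolic
  subalgebra belonging to the long root; it is itself block triangular.\<close>

definition levi :: "'a::field fmat \<Rightarrow> 'a fmat \<Rightarrow> 'a fmat \<Rightarrow> 'a fmat set" where
  "levi q p s = {A. A \<in> hom (q + p + s) (q + p + s) \<and> q * A * p = 0 \<and> (q + p) * A * s = 0}"

definition symm :: "'a::field fmat \<Rightarrow> 'a fmat set" where
  "symm s = {B. B \<in> hom s s \<and> tp B = B}"

text \<open>\<open>(A, B)\<close> is an element of the semidirect product, with \<open>A\<close>
  acting on symmetric matrices by \<open>A * B + B * tp A\<close>. By
  \<open>two_block_functional\<close>, trace pairings with \<open>F\<close> and \<open>S\<close>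
  exhaust the linear functionals.\<close>

definition frobG where
  "frobG q p s \<longleftrightarrow> (\<exists>F S. \<forall>A \<in> levi q p s. \<forall>B \<in> symm s.
     (\<forall>A' \<in> levi q p s. \<forall>B' \<in> symm s.
        tr (F * (A * A' - A' * A)) + tr (S * (A * B' - B * tp A' - A' * B + B' * tp A)) = 0)
     \<longrightarrow> A = 0 \<and> B = 0)"

text \<open>The trace form pairs each corner perfectly with the opposite one.\<close>

lemma corner_zero:
  assumes "\<And>M. tr (N * (e * M * f)) = 0"
  shows "f * N * e = (0 :: 'a::field fmat)"
proof (rule tr_nondegenerate)
  fix M
  have "tr (f * N * e * M) = tr (f * (N * e * M))" by (simp only: mult.assoc)
  also have "\<dots> = tr (N * e * M * f)" by (rule tr_comm)
  finally show "tr (f * N * e * M) = 0" using assms[of M] by (simp add: mult.assoc)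
qed

lemma tp_hom:
  assumes "x \<in> hom p q"
  shows "tp x \<in> hom (tp q) (tp p)"
  using arg_cong[OF homD(1)[OF assms], of tp] arg_cong[OF homD(2)[OF assms], of tp] by (simp add: hom_def)

lemma tr_four:
  fixes F :: "'a::field fmat"
  shows "tr (F * (A * A' - A' * A)) = tr ((F * A - A * F) * A')"
  using tr_comm[of "F * A'" A] by (simp add: right_diff_distrib left_diff_distrib mult.assoc)

lemma tr_symm_pair:
  fixes S :: "'a::field fmat"
  assumes "tp S = S" "tp B = B"
  shows "tr (S * (B * tp M)) = tr (B * S * M)" "tr (S * (M * B)) = tr (B * S * M)"
proof -
  have "tr (S * (B * tp M)) = tr (tp (S * (B * tp M)))" by (simp only: tr_tp)
  also have "\<dots> = tr (M * (B * S))" by (simp only: tp_times tp_tp assms mult.assoc)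
  also have "\<dots> = tr (B * S * M)" by (rule tr_comm)
  finally show "tr (S * (B * tp M)) = tr (B * S * M)" .
  have "tr (S * (M * B)) = tr (S * M * B)" by (simp only: mult.assoc)
  also have "\<dots> = tr (B * (S * M))" by (rule tr_comm)
  finally show "tr (S * (M * B)) = tr (B * S * M)" by (simp only: mult.assoc)
qed

text \<open>Take the identity \<open>s\<close> as symmetric part of the functional. Testing a
  radical element against symmetric matrices makes its \<open>s\<close>-block \<open>Y\<close> skew;
  testing against block triangular ones gives the remaining equations of \<open>HK\<close> and
  expresses \<open>B + B\<close> by the other blocks.\<close>

lemma frobG_if_frobH:
  fixes q p s :: "'a::field_char_0 fmat"
  assumes id: "idem q" "idem p" "idem s" "q * p = 0" "p * q = 0" "q * s = 0" "s * q = 0" "p * s = 0" "s * p = 0"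
    and ts: "tp s = s" and H: "frobH q p s"
  shows "frobG q p s"
proof -
  define n where "n = q + p"
  obtain F T G where h: "F \<in> hom n n" "T \<in> hom s n" "G \<in> hom s s"
    and L: "\<forall>X Y Z. HK q p s F T G X Y Z \<longrightarrow> X = 0 \<and> Y = 0 \<and> Z = 0"
    using H by (auto simp: frobH_def n_def)
  have n: "n * n = n" "n * s = 0" "s * n = 0" "n * q = q" "q * n = q" "n * p = p" "p * n = p"
    using id by (simp_all add: n_def algebra_simps)
  have An: "s * F = 0" "F * s = 0" "s * T = 0" "T * n = 0" "n * G = 0" "G * n = 0"
    using hom_annihilate[OF h(1)] hom_annihilate[OF h(2)] hom_annihilate[OF h(3)] n by auto
  note R = id n An homD(1,2)[OF h(1)] homD(1,2)[OF h(2)] homD(1,2)[OF h(3)]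
  note R' = R R[THEN mult_assocI]
  define F0 where "F0 = F + T + G"
  have "A = 0 \<and> B = 0" if A: "A \<in> levi q p s" and B: "B \<in> symm s"
    and K: "\<forall>A' \<in> levi q p s. \<forall>B' \<in> symm s.
        tr (F0 * (A * A' - A' * A)) + tr (s * (A * B' - B * tp A' - A' * B + B' * tp A)) = 0" for A B
  proof -
    have A1: "A \<in> hom (n + s) (n + s)" "q * A * p = 0" "n * A * s = 0" using A by (auto simp: levi_def n_def)
    have B1: "B \<in> hom s s" "tp B = B" using B by (auto simp: symm_def)
    have z: "(0 :: 'a fmat) \<in> levi q p s" "(0 :: 'a fmat) \<in> symm s" by (simp_all add: levi_def symm_def)
    define X where "X = n * A * n"
    define Y where "Y = s * A * s"
    define Z where "Z = s * A * n"
    have Adec: "A = X + Y + Z"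
    proof -
      have "A = (n + s) * A * (n + s)" using A1(1) by (simp add: homD)
      then show ?thesis using A1(3) by (simp add: X_def Y_def Z_def algebra_simps)
    qed
    have Xh: "X \<in> hom n n" and Yh: "Y \<in> hom s s" and Zh: "Z \<in> hom n s"
      by (simp_all add: X_def Y_def Z_def hom_def mult.assoc R')
    have An2: "s * X = 0" "X * s = 0" "n * Y = 0" "Y * n = 0" "n * Z = 0" "Z * s = 0" "n * B = 0" "B * n = 0"
      using hom_annihilate[OF Xh] hom_annihilate[OF Yh] hom_annihilate[OF Zh] hom_annihilate[OF B1(1)] n by auto
    have An3: "F * Z = 0" "F * Y = 0" "T * X = 0" "G * X = 0" "X * G = 0" "Y * T = 0" "Y * F = 0" "Z * G = 0"
      using hom_annihilate[OF Xh] hom_annihilate[OF Yh] hom_annihilate[OF Zh] n An by auto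
    note R2' = R' An2 An2[THEN mult_assocI] An3 An3[THEN mult_assocI] homD(1,2)[OF Xh] homD(1,2)[OF Yh] homD(1,2)[OF Zh] homD(1,2)[OF B1(1)]
      homD(3,4)[OF Xh] homD(3,4)[OF Yh] homD(3,4)[OF Zh] homD(3,4)[OF B1(1)]
    have skew: "Y + tp Y = 0"
    proof -
      have "s * (Y + tp Y) * s = 0"
      proof (rule corner_zero)
        fix M
        \<comment> \<open>\<open>M\<close> is symmetrised to a legitimate test matrix; its two
          halves contribute the traces of \<open>Y\<close> and of \<open>tp Y\<close> against the
          same matrix.\<close>
        let ?B = "s * M * s + s * tp M * s"
        have B': "?B \<in> symm s" by (simp add: symm_def hom_def ts mult.assoc R' distrib_left distrib_right add.commute)
        have "tr (s * (A * ?B + ?B * tp A)) = 0" using K z(1) B' by fastforce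
        moreover have "tr (s * (?B * tp A)) = tr (Y * ?B)"
        proof -
          have "tr (s * (?B * tp A)) = tr (tp (s * (?B * tp A)))" by (simp only: tr_tp)
          also have "tp (s * (?B * tp A)) = A * ?B"
          proof -
            have "tp ?B = ?B" "?B * s = ?B" using B' by (simp_all add: symm_def hom_def)
            then show ?thesis by (simp only: tp_times tp_tp ts mult.assoc)
          qed
          also have "A * ?B = A * s * ?B" using B' by (simp add: symm_def hom_def mult.assoc)
          also have "tr \<dots> = tr (?B * (A * s))" using tr_comm by blast
          also have "?B * (A * s) = ?B * Y" by (simp add: Y_def algebra_simps R')
          finally show ?thesis using tr_comm by metis
        qed
        moreover have "s * (A * ?B) = Y * ?B" by (simp add: Y_def algebra_simps R')
        ultimately have "tr (Y * ?B) + tr (Y * ?B) = 0"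
          by (simp only: distrib_left[of s "A * ?B" "?B * tp A"] tr_add)
        then have "tr (Y * ?B) = 0" by (simp only: mult_2[symmetric] mult_eq_0_iff) simp
        moreover have "tr (Y * (s * tp M * s)) = tr (tp Y * (s * M * s))"
        proof -
          have "tr (Y * (s * tp M * s)) = tr (tp (Y * (s * tp M * s)))" by (simp only: tr_tp)
          also have "\<dots> = tr (s * M * s * tp Y)" by (simp only: tp_times tp_tp ts mult.assoc)
          finally show ?thesis using tr_comm by metis
        qed
        ultimately show "tr ((Y + tp Y) * (s * M * s)) = 0" by (simp add: distrib_left distrib_right)
      qed
      moreover have "tp Y \<in> hom s s" using tp_hom[OF Yh] by (simp only: ts)
      ultimately show ?thesis using Yh by (simp add: distrib_left distrib_right homD)
    qed
    \<comment> \<open>For \<open>B' = 0\<close> the form is the trace pairing of \<open>A'\<close>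
      with \<open>N\<close>; each of the two terms of the action on \<open>B\<close> contributes
      \<open>tr (B * A')\<close>, whence \<open>B + B\<close>.\<close>
    define N where "N = F0 * A - A * F0 - (B + B)"
    have NA: "tr (N * A') = 0" if "A' \<in> levi q p s" for A'
    proof -
      have "tr (F0 * (A * A' - A' * A)) + tr (s * (- (B * tp A') - A' * B)) = 0"
        using K that z(2) by fastforce
      moreover have "tr (s * (B * tp A')) = tr (B * A')" "tr (s * (A' * B)) = tr (B * A')"
        using tr_symm_pair[OF ts B1(2), of A'] B1(1) by (simp_all add: homD)
      ultimately show ?thesis
        unfolding tr_four N_def by (simp add: algebra_simps)
    qed
    \<comment> \<open>These are the corners opposite to the blocks allowed in
      \<open>levi q p s\<close>.\<close>
    have c: "q * N * q = 0" "q * N * p = 0" "p * N * p = 0" "q * N * s = 0" "p * N * s = 0" "s * N * s = 0"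
      by (rule corner_zero, rule NA, simp add: levi_def hom_def algebra_simps id id[THEN mult_assocI])+
    have N1: "n * N * n = F * X - X * F + T * Z" "n * N * s = T * Y - X * T"
      "s * N * s = G * Y - Y * G - Z * T - (B + B)"
      by (simp_all add: N_def Adec F0_def algebra_simps R2')
    have "q * (F * X - X * F + T * Z) = q * N * q + q * N * p"
      unfolding N1(1)[symmetric] by (simp add: n_def algebra_simps id id[THEN mult_assocI])
    moreover have "(F * X - X * F + T * Z) * p = q * N * p + p * N * p"
      unfolding N1(1)[symmetric] by (simp add: n_def algebra_simps id id[THEN mult_assocI])
    moreover have "T * Y - X * T = q * N * s + p * N * s"
      unfolding N1(2)[symmetric] by (simp add: n_def distrib_right)
    moreover have sN: "G * Y - Y * G - Z * T = B + B" using N1(3) c by simp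
    moreover have "q * X * p = q * A * p" by (simp add: X_def mult.assoc R')
    ultimately have "HK q p s F T G X Y Z"
      unfolding HK_def n_def[symmetric] sN using Xh Yh Zh skew A1 c B1(2)
      by (simp add: eq_neg_iff_add_eq_0 add.commute)
    then have "X = 0" "Y = 0" "Z = 0" using L by blast+
    moreover from this have "B + B = 0" using sN by simp
    ultimately show ?thesis using Adec fmat_double_eq_zero by simp
  qed
  then show ?thesis unfolding frobG_def by blast
qed

text \<open>Here the symmetric part of the functional is given, not chosen. If \<open>w\<close> were
  in its kernel, \<open>w * tp w\<close> would lie in the radical; so it is invertible and factors
  as \<open>tp D * D\<close>, and the change of basis by \<open>D\<close> replaces \<open>s\<close>
  by \<open>dg r\<close> and the form by the identity.\<close>

lemma frobH_if_frobG:
  fixes q p s :: "'a::{alg_closed_field, field_char_0} fmat"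
  assumes id: "idem q" "idem p" "idem s" "q * p = 0" "p * q = 0" "q * s = 0" "s * q = 0" "p * s = 0" "s * p = 0"
    and ts: "tp s = s" and r: "tr s = of_nat r" and G: "frobG q p s"
  shows "frobH q p (dg r)"
proof -
  define n where "n = q + p"
  have n: "n * n = n" "n * s = 0" "s * n = 0" "n * q = q" "q * n = q" "n * p = p" "p * n = p"
    using id by (simp_all add: n_def algebra_simps)
  obtain F0 S0 where K0: "\<And>A B. A \<in> levi q p s \<Longrightarrow> B \<in> symm s \<Longrightarrow> (\<And>A' B'. A' \<in> levi q p s \<Longrightarrow> B' \<in> symm s \<Longrightarrow>
        tr (F0 * (A * A' - A' * A)) + tr (S0 * (A * B' - B * tp A' - A' * B + B' * tp A)) = 0)
      \<Longrightarrow> A = 0 \<and> B = 0"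
    using G unfolding frobG_def by blast
  \<comment> \<open>Symmetrising \<open>S0\<close> to \<open>S0 + tp S0\<close> doubles its pairing
    with symmetric matrices, so \<open>F0\<close> is doubled along with it.\<close>
  define F2 where "F2 = F0 + F0"
  define S where "S = s * (S0 + tp S0) * s"
  have S: "S \<in> hom s s" "tp S = S"
    by (simp_all add: S_def hom_def mult.assoc id id[THEN mult_assocI] ts add.commute)
  have split: "A = n * A * n + s * A * n + s * A * s" if "A \<in> levi q p s" for A
  proof -
    have "A \<in> hom (n + s) (n + s)" and 0: "n * A * s = 0" using that by (simp_all add: levi_def n_def)
    then have "A = (n + s) * A * (n + s)" by (simp add: homD)
    with 0 show ?thesis by (simp add: algebra_simps)
  qed
  have K: "A = 0 \<and> B = 0" if AB: "A \<in> levi q p s" "B \<in> symm s"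
    and h: "\<And>A' B'. A' \<in> levi q p s \<Longrightarrow> B' \<in> symm s \<Longrightarrow>
        tr (F2 * (A * A' - A' * A)) + tr (S * (A * B' - B * tp A' - A' * B + B' * tp A)) = 0" for A B
  proof (rule K0[OF AB])
    fix A' B' assume AB': "A' \<in> levi q p s" "B' \<in> symm s"
    define \<beta> where "\<beta> = A * B' - B * tp A' - A' * B + B' * tp A"
    have Bs: "s * B = B" "B * s = B" "s * B' = B'" "B' * s = B'" "tp B = B" "tp B' = B'"
      using AB AB' by (simp_all add: symm_def hom_def)
    have b1: "tp \<beta> = \<beta>" by (simp add: \<beta>_def Bs)
    have As: "A * s = s * A * s" "A' * s = s * A' * s"
      using arg_cong[OF split[OF AB(1)], of "\<lambda>z. z * s"] arg_cong[OF split[OF AB'(1)], of "\<lambda>z. z * s"]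
      by (simp_all add: distrib_right mult.assoc n id)
    have "A * B' = s * (A * B')" "A' * B = s * (A' * B)"
    proof -
      have "A * B' = A * s * B'" "A' * B = A' * s * B" using Bs by (simp_all add: mult.assoc)
      then show "A * B' = s * (A * B')" "A' * B = s * (A' * B)" unfolding As using Bs by (simp_all add: mult.assoc)
    qed
    moreover have "s * (B * tp A') = B * tp A'" "s * (B' * tp A) = B' * tp A"
      using Bs by (simp_all flip: mult.assoc)
    ultimately have b2: "s * \<beta> = \<beta>" by (simp add: \<beta>_def right_diff_distrib distrib_left)
    have b3: "\<beta> * s = \<beta>" using arg_cong[OF b2, of tp] by (simp only: tp_times b1 ts)
    have "tr (tp S0 * \<beta>) = tr (S0 * \<beta>)"
    proof -
      have "tr (tp S0 * \<beta>) = tr (tp (tp S0 * \<beta>))" by (simp only: tr_tp)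
      also have "\<dots> = tr (\<beta> * S0)" by (simp only: tp_times tp_tp b1)
      finally show ?thesis using tr_comm by metis
    qed
    moreover have "tr (S * \<beta>) = tr ((S0 + tp S0) * \<beta>)"
    proof -
      have "tr (S * \<beta>) = tr (s * ((S0 + tp S0) * \<beta>))" by (simp add: S_def mult.assoc b2)
      also have "\<dots> = tr ((S0 + tp S0) * \<beta> * s)" by (rule tr_comm)
      finally show ?thesis by (simp add: mult.assoc b3)
    qed
    ultimately have S2: "tr (S * \<beta>) = tr (S0 * \<beta>) + tr (S0 * \<beta>)" by (simp add: distrib_right)
    have F2': "tr (F2 * c) = tr (F0 * c) + tr (F0 * c)" for c by (simp add: F2_def distrib_right)
    have dbl: "2 * (a + b) = 0" if "(a + a) + (b + b) = 0" for a b :: 'a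
      using that by (simp add: algebra_simps)
    have "2 * (tr (F0 * (A * A' - A' * A)) + tr (S0 * \<beta>)) = 0"
      by (rule dbl) (use h[OF AB', folded \<beta>_def] in \<open>simp only: F2' S2\<close>)
    then show "tr (F0 * (A * A' - A' * A)) + tr (S0 * (A * B' - B * tp A' - A' * B + B' * tp A)) = 0"
      unfolding \<beta>_def[symmetric] by (simp only: mult_eq_0_iff) simp
  qed
  obtain B0 where B0: "B0 \<in> hom s s" "B0 * S = s" "S * B0 = s" "tp B0 = B0"
  proof (rule symmetric_inverse_or_kernel[OF id(3) ts S])
    fix w :: "'a fmat"
    assume w: "w * munit 0 0 = w" "w \<noteq> 0" "s * w = w" "S * w = 0"
    let ?B = "w * tp w"
    have tw: "tp w * s = tp w" using arg_cong[OF w(3), of tp] ts by simp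
    have tS: "tp w * S = 0" using arg_cong[OF w(4), of tp] S by simp
    have B: "?B \<in> symm s" using w(3) by (simp add: symm_def hom_def mult.assoc tw) (simp flip: mult.assoc)
    have SB: "S * ?B = 0" "?B * S = 0" using w(4) by (simp_all add: mult.assoc tS) (simp flip: mult.assoc)
    have "?B = 0"
    proof (rule K[THEN conjunct2, of 0])
      fix A' B' :: "'a fmat"
      have "tr (S * (A' * ?B)) = tr (?B * S * A')" "tr (S * (?B * tp A')) = tr (?B * S * A')"
        using tr_symm_pair[OF S(2), of ?B A'] by simp_all
      then show "tr (F2 * (0 * A' - A' * 0)) + tr (S * (0 * B' - ?B * tp A' - A' * ?B + B' * tp 0)) = 0"
        using SB by (simp add: right_diff_distrib)
    qed (use B in \<open>simp_all add: levi_def\<close>)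
    then show thesis using column_square_nonzero[OF w(1,2)] by simp
  qed (use that in blast)
  obtain C D where CD: "C * D = s" "D * C = dg r" "C * tp C = B0" "C \<in> hom (dg r) s" "D \<in> hom s (dg r)"
    using symmetric_factorization[OF id(3) r homD(1)[OF B0(1)] B0(4,2)] by blast
  have tD: "s * tp D = tp D" using arg_cong[OF homD(2)[OF CD(5)], of tp] ts by simp
  have tC: "tp C * tp D = dg r" using arg_cong[OF CD(2), of tp] by simp
  have Sf: "S = tp D * D"
  proof -
    have "B0 * (tp D * D) = C * (tp C * tp D) * D" by (simp only: CD(3)[symmetric] mult.assoc)
    also have "\<dots> = s" using CD by (simp add: tC homD)
    finally have "S * (B0 * (tp D * D)) = S * s" by simp
    then have "s * (tp D * D) = S * s" using B0(3) by (simp flip: mult.assoc)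
    then show ?thesis using S(1) tD by (simp add: homD flip: mult.assoc)
  qed
  have An: "n * C = 0" "D * n = 0"
    using hom_annihilate[OF CD(4)] hom_annihilate[OF CD(5)] n by auto
  have dd: "dg r * dg r = (dg r :: 'a fmat)" by (simp add: dg_times_dg)
  define F where "F = n * F2 * n"
  define T where "T = n * F2 * C"
  define G where "G = D * F2 * C"
  note R = id n An CD(1,2) homD(1,2)[OF CD(4)] homD(1,2)[OF CD(5)] dd
  note R' = R R[THEN mult_assocI]
  have FTG: "F \<in> hom n n" "T \<in> hom (dg r) n" "G \<in> hom (dg r) (dg r)"
    by (simp_all add: F_def T_def G_def hom_def mult.assoc R')
  have "X = 0 \<and> Y = 0 \<and> Z = 0" if HK: "HK q p (dg r) F T G X Y Z" for X Y Z
  proof -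
    from HK have X: "X \<in> hom n n" "q * X * p = 0" and Y: "Y \<in> hom (dg r) (dg r)" "tp Y = - Y" and Z: "Z \<in> hom n (dg r)"
      and e1: "T * Y = X * T" and e2: "q * (F * X - X * F + T * Z) = 0" and e3: "(F * X - X * F + T * Z) * p = 0"
      and e4: "tp (G * Y - Y * G - Z * T) = G * Y - Y * G - Z * T"
      by (auto simp: HK_def n_def)
    have An2: "s * X = 0" "X * s = 0" "X * C = 0" "D * X = 0" "Z * C = 0" "Z * s = 0"
      using hom_annihilate[OF X(1)] hom_annihilate[OF Z] n An by auto
    define A where "A = X + C * Z + C * Y * D"
    define P0 where "P0 = F2 * A - A * F2"
    define Rm where "Rm = G * Y - Y * G - Z * T"
    \<comment> \<open>The symmetric component that \<open>HK\<close> has eliminated: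
      \<open>B * S + B * S\<close> must be the \<open>s\<close>-block of the commutator
      \<open>P0\<close>.\<close>
    define B where "B = (1 / 2) *f (C * Rm * tp C)"
    note R2 = An2 homD(1,2)[OF X(1)] homD(1,2)[OF Y(1)] homD(1,2)[OF Z]
    note R2' = R' R2 R2[THEN mult_assocI]
    have tCs: "tp C * s = tp C" using arg_cong[OF homD(1)[OF CD(4)], of tp] ts by simp
    have AL: "A \<in> levi q p s"
    proof -
      have qC: "q * C = 0" using hom_annihilate(1)[OF CD(4) id(6)] .
      have "q * A * p = q * X * p + q * C * Z * p + q * C * Y * D * p"
        by (simp only: A_def distrib_left distrib_right mult.assoc)
      then have "q * A * p = 0" unfolding X(2) qC by simp
      moreover have "A \<in> hom (n + s) (n + s)" "n * A * s = 0"
        by (simp_all add: A_def hom_def algebra_simps R2')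
      ultimately show ?thesis by (simp add: levi_def n_def)
    qed
    have BS: "B \<in> symm s"
      using e4 by (simp add: B_def symm_def hom_def mult.assoc Rm_def[symmetric] tCs R2')
    have BSS: "B * S + B * S = C * Rm * D"
    proof -
      have "C * Rm * tp C * S = C * Rm * D"
        unfolding Sf using mult_assocI[OF tC, of D] CD(5) by (simp add: mult.assoc homD)
      then have "B * S + B * S = (1 / 2) *f (C * Rm * D) + (1 / 2) *f (C * Rm * D)" by (simp add: B_def)
      also have "\<dots> = C * Rm * D" by (rule fmat_eqI) simp
      finally show ?thesis .
    qed
    have P: "s * P0 * s = C * Rm * D" "n * P0 * s = 0" "n * P0 * n = F * X - X * F + T * Z"
    proof -
      have "D * P0 * C = Rm"
        by (simp add: P0_def A_def Rm_def G_def T_def algebra_simps R2')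
      then have "C * (D * P0 * C) * D = C * Rm * D" by simp
      then show "s * P0 * s = C * Rm * D" by (simp add: CD(1)[symmetric] mult.assoc)
      have "n * P0 * C = T * Y - X * T"
        by (simp add: P0_def A_def T_def algebra_simps R2')
      then have "n * P0 * C * D = 0" using e1 by simp
      then show "n * P0 * s = 0" by (simp add: CD(1) mult.assoc)
      show "n * P0 * n = F * X - X * F + T * Z"
        by (simp add: P0_def A_def T_def F_def algebra_simps R2')
    qed
    have "A = 0 \<and> B = 0"
    proof (rule K[OF AL BS])
      fix A' B' assume A': "A' \<in> levi q p s" and B': "B' \<in> symm s"
      have B'1: "s * B' = B'" "B' * s = B'" "tp B' = B'" using B' by (simp_all add: symm_def hom_def)
      define W where "W = tp D * Y * D"
      have tW: "tp W = - W" using Y(2) by (simp add: W_def mult.assoc)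
      have SA: "S * (A * B') = W * B'"
      proof -
        have "A * B' = C * Y * D * B'"
        proof -
          have "A * B' = A * s * B'" using B'1 by (simp add: mult.assoc)
          also have "A * s = C * Y * D" by (simp add: A_def algebra_simps R2')
          finally show ?thesis .
        qed
        then show ?thesis by (simp add: W_def Sf mult.assoc R2')
      qed
      have "tr (S * (B' * tp A)) = tr (tp (S * (B' * tp A)))" by (simp only: tr_tp)
      also have "\<dots> = tr (A * B' * S)" by (simp only: tp_times tp_tp S(2) B'1(3))
      also have "\<dots> = tr (S * (A * B'))" by (rule tr_comm)
      finally have t1: "tr (S * (B' * tp A)) = tr (W * B')" unfolding SA .
      have "tr (W * B') = tr (tp (W * B'))" by (simp only: tr_tp)
      also have "\<dots> = - tr (B' * W)" by (simp add: tW B'1 del: tr_tp)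
      also have "\<dots> = - tr (W * B')" using tr_comm by metis
      finally have "tr (W * B') + tr (W * B') = 0" by (simp add: eq_neg_iff_add_eq_0)
      then have t2: "tr (S * (A * B')) + tr (S * (B' * tp A)) = 0" unfolding SA t1 .
      have tB: "tr (S * (B * tp A')) = tr (B * S * A')" "tr (S * (A' * B)) = tr (B * S * A')"
        using tr_symm_pair[OF S(2), of B A'] BS by (simp_all add: symm_def)
      have "tr (P0 * A') = tr (s * P0 * s * A')"
      proof -
        have "tr (P0 * A') = tr (P0 * (n * A' * n + s * A' * n + s * A' * s))" using split[OF A'] by simp
        also have "\<dots> = tr (P0 * (n * A' * n)) + tr (P0 * (s * A' * n)) + tr (P0 * (s * A' * s))"
          by (simp add: distrib_left)
        also have "tr (P0 * (s * A' * s)) = tr (s * P0 * s * A')"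
          using tr_comm[of "P0 * s * A'" s] by (simp add: mult.assoc)
        also have "tr (P0 * (s * A' * n)) = tr (n * P0 * s * A')"
          using tr_comm[of "P0 * s * A'" n] by (simp add: mult.assoc)
        also have "tr (P0 * (n * A' * n)) = tr (n * P0 * n * A')"
          using tr_comm[of "P0 * n * A'" n] by (simp add: mult.assoc)
        also have "tr (n * P0 * n * A') = 0"
        proof -
          \<comment> \<open>Only the block \<open>p * Q * q\<close> survives, and it is paired with
            \<open>q * A' * p\<close>, which is zero.\<close>
          define Q where "Q = n * P0 * n"
          have "q * Q = 0" "Q * p = 0" using e2 e3 P(3) by (simp_all add: Q_def)
          moreover have "Q = n * Q * n" by (simp add: Q_def mult.assoc n n[THEN mult_assocI])
          ultimately have "Q = p * Q * q" by (simp add: n_def distrib_left distrib_right mult.assoc)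
          then have "tr (Q * A') = tr (p * (Q * q * A'))" by (metis mult.assoc)
          also have "\<dots> = tr (Q * q * A' * p)" by (rule tr_comm)
          also have "\<dots> = tr (Q * (q * A' * p))" by (simp only: mult.assoc)
          also have "q * A' * p = 0" using A' by (simp add: levi_def)
          finally show ?thesis by (simp add: Q_def)
        qed
        finally show ?thesis using P(2) by simp
      qed
      then have "tr (P0 * A') = tr (B * S * A') + tr (B * S * A')"
        unfolding P(1) BSS[symmetric] by (simp add: distrib_right)
      then show "tr (F2 * (A * A' - A' * A)) + tr (S * (A * B' - B * tp A' - A' * B + B' * tp A)) = 0"
        unfolding tr_four P0_def[symmetric] using t2 tB by (simp add: distrib_left right_diff_distrib algebra_simps)
    qed
    then have A0: "A = 0" by simp
    have "X = n * A * n" "Z = D * A * n" "Y = D * A * C"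
      by (simp_all add: A_def algebra_simps R2')
    then show ?thesis using A0 by simp
  qed
  then show ?thesis unfolding frobH_def n_def[symmetric] using FTG by blast
qed

text \<open>The two implications concern \<open>frobH\<close> for \<open>s\<close> and for
  \<open>dg r\<close>. They close up to an equivalence because the criterion for
  \<open>frobH\<close> depends on ranks only.\<close>

theorem frobG_criterion:
  fixes q p s :: "'a::{alg_closed_field, field_char_0} fmat"
  assumes id: "idem q" "idem p" "idem s" "q * p = 0" "p * q = 0" "q * s = 0" "s * q = 0" "p * s = 0" "s * p = 0"
    and ts: "tp s = s" and tr: "tr q = of_nat a" "tr p = of_nat b" "tr s = of_nat r" and ab: "0 < a + b"
  shows "frobG q p s \<longleftrightarrow> condH a b r"
proof (cases "r = 0")
  case True
  then have "s = 0" using idem_tr_zero id tr by simp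
  moreover have "q + p \<noteq> 0"
  proof
    assume "q + p = 0"
    then have "tr (q + p) = 0" by simp
    then have "(of_nat (a + b) :: 'a) = 0" using tr by simp
    then show False using ab by (simp only: of_nat_eq_0_iff)
  qed
  ultimately have "\<not> frobH q p (dg r)" using not_frobH_zero[OF id(1,2,4,5)] True by simp
  then have "\<not> frobG q p s" using frobH_if_frobG[OF id ts tr(3)] by blast
  then show ?thesis using True by (simp add: condH_def)
next
  case False
  have "idem (dg r :: 'a fmat)" by (simp add: dg_times_dg)
  then have "frobH q p (dg r) \<longleftrightarrow> condH a b r"
    using frob_criterion(1)[OF id(1,2,4,5) _ tp_dg tr(1,2) tr_dg _ refl] False by blast
  moreover have "frobH q p s \<longleftrightarrow> condH a b r"
    using frob_criterion(1)[OF id(1,2,4,5,3) ts tr _ refl] False by blast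
  ultimately show ?thesis using frobH_if_frobG[OF id ts tr(3)] frobG_if_frobH[OF id ts] by blast
qed

section \<open>The symplectic Lie algebra in coordinates\<close>

text \<open>With indices from 0, the antidiagonal pairs \<open>i\<close> with
  \<open>2 * n - 1 - i\<close>; \<open>sg\<close> records the signs of the symplectic form on the
  two halves.\<close>

definition mir :: "nat \<Rightarrow> nat \<Rightarrow> nat" where
  "mir n i = 2 * n - 1 - i"

definition sg :: "nat \<Rightarrow> nat \<Rightarrow> 'a::field" where
  "sg n i = (if i < n then 1 else - 1)"

lemma mir_lt [simp]: "i < 2 * n \<Longrightarrow> mir n i < 2 * n"
  by (auto simp: mir_def)

lemma mir_mir [simp]: "i < 2 * n \<Longrightarrow> mir n (mir n i) = i"
  by (auto simp: mir_def)

lemma mir_eq_iff: "i < 2 * n \<Longrightarrow> j < 2 * n \<Longrightarrow> mir n i = mir n j \<longleftrightarrow> i = j"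
  by (auto simp: mir_def)

lemma mir_eq_swap: "i < 2 * n \<Longrightarrow> j < 2 * n \<Longrightarrow> mir n i = j \<longleftrightarrow> i = mir n j"
  by (auto simp: mir_def)

lemma sg_mir: "i < 2 * n \<Longrightarrow> sg n (mir n i) = - (sg n i :: 'a::field)"
  by (auto simp: sg_def mir_def)

lemma sg_square [simp]: "sg n i * sg n i = (1 :: 'a::field)" "sg n i * (sg n i * c) = (c :: 'a::field)"
  by (auto simp: sg_def)

lemma sg_pair [simp]:
  "sg n i * sg n j * (sg n i * sg n j) = (1 :: 'a::field)"
  "sg n i * (sg n j * (sg n i * sg n j)) = (1 :: 'a::field)"
  "sg n i * (sg n j * (sg n i * (sg n j * c))) = (c :: 'a::field)"
  "sg n i * sg n j * (sg n i * sg n j * c) = (c :: 'a::field)"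
  by (auto simp: sg_def)

lemma bij_mir: "bij_betw (mir n) {..<2 * n} {..<2 * n}"
  by (rule bij_betw_byWitness[of _ "mir n"]) auto

text \<open>Skewness for the antidiagonal symplectic form, one equation in place of conditions on
  four blocks. The product of signs is -1 exactly on the off-diagonal blocks, where the equation
  becomes symmetry about the antidiagonal.\<close>

lemma sp_iff:
  "x \<in> sp n \<longleftrightarrow> x \<in> carrier_mat (2 * n) (2 * n) \<and>
    (\<forall>i < 2 * n. \<forall>j < 2 * n. x $$ (mir n j, mir n i) = - (sg n i * sg n j * x $$ (i, j)))"
    (is "_ \<longleftrightarrow> ?R")
proof
  assume "x \<in> sp n"
  then obtain A B C where x: "x = four_block_mat A B C (- anti_transpose A)"
    and A: "A \<in> carrier_mat n n" and B: "B \<in> carrier_mat n n" and C: "C \<in> carrier_mat n n"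
    and sB: "B = anti_transpose B" and sC: "C = anti_transpose C"
    by (auto simp: sp_def)
  have D: "- anti_transpose A \<in> carrier_mat n n" using A by (auto simp: anti_transpose_def)
  have eD: "(- anti_transpose A) $$ (i, j) = - A $$ (n - 1 - j, n - 1 - i)" if "i < n" "j < n" for i j
    using that A by (auto simp: anti_transpose_def)
  have eB: "B $$ (n - 1 - j, n - 1 - i) = B $$ (i, j)" if "i < n" "j < n" for i j
    using arg_cong[OF sB, of "\<lambda>M. M $$ (i, j)"] that B by (auto simp: anti_transpose_def)
  have eC: "C $$ (n - 1 - j, n - 1 - i) = C $$ (i, j)" if "i < n" "j < n" for i j
    using arg_cong[OF sC, of "\<lambda>M. M $$ (i, j)"] that C by (auto simp: anti_transpose_def)
  have car: "x \<in> carrier_mat (2 * n) (2 * n)" unfolding x using four_block_carrier_mat[OF A D] by (simp add: mult_2)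
  have ent: "x $$ (i, j) = (if i < n then if j < n then A $$ (i, j) else B $$ (i, j - n)
      else if j < n then C $$ (i - n, j) else - A $$ (2 * n - 1 - j, 2 * n - 1 - i))"
    if "i < 2 * n" "j < 2 * n" for i j
  proof -
    have "x $$ (i, j) = (if i < n then if j < n then A $$ (i, j) else B $$ (i, j - n)
      else if j < n then C $$ (i - n, j) else (- anti_transpose A) $$ (i - n, j - n))"
      unfolding x using that A D by (subst index_mat_four_block) auto
    moreover have "n - 1 - (k - n) = 2 * n - 1 - k" if "\<not> k < n" for k using that by auto
    ultimately show ?thesis using that eD[of "i - n" "j - n"] by auto
  qed
  have "x $$ (mir n j, mir n i) = - (sg n i * sg n j * x $$ (i, j))" if ij: "i < 2 * n" "j < 2 * n" for i j
  proof -
    consider "i < n" "j < n" | "i < n" "\<not> j < n" | "\<not> i < n" "j < n" | "\<not> i < n" "\<not> j < n" by blast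
    then show ?thesis
    proof cases
      case 2
      have "mir n j = n - 1 - (j - n)" "mir n i - n = n - 1 - i" using 2 ij by (auto simp: mir_def)
      then have "B $$ (mir n j, mir n i - n) = B $$ (i, j - n)" using eB[of i "j - n"] 2 ij by auto
      moreover have "mir n j < n" "\<not> mir n i < n" using 2 ij by (auto simp: mir_def)
      ultimately show ?thesis using 2 ent[OF ij] ent[OF mir_lt[OF ij(2)] mir_lt[OF ij(1)]] by (simp add: sg_def)
    next
      case 3
      have "mir n i = n - 1 - (i - n)" "mir n j - n = n - 1 - j" using 3 ij by (auto simp: mir_def)
      then have "C $$ (mir n j - n, mir n i) = C $$ (i - n, j)" using eC[of "i - n" j] 3 ij by auto
      moreover have "mir n i < n" "\<not> mir n j < n" using 3 ij by (auto simp: mir_def)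
      ultimately show ?thesis using 3 ent[OF ij] ent[OF mir_lt[OF ij(2)] mir_lt[OF ij(1)]] by (simp add: sg_def)
    next
      case 1
      then have "\<not> mir n i < n" "\<not> mir n j < n" using ij by (auto simp: mir_def)
      moreover have "2 * n - 1 - mir n i = i" "2 * n - 1 - mir n j = j" using ij by (auto simp: mir_def)
      ultimately show ?thesis using 1 ent[OF ij] ent[OF mir_lt[OF ij(2)] mir_lt[OF ij(1)]] by (simp add: sg_def)
    next
      case 4
      then have "mir n i < n" "mir n j < n" using ij by (auto simp: mir_def)
      moreover have "2 * n - 1 - i = mir n i" "2 * n - 1 - j = mir n j" by (auto simp: mir_def)
      ultimately show ?thesis using 4 ent[OF ij] ent[OF mir_lt[OF ij(2)] mir_lt[OF ij(1)]] by (simp add: sg_def)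
    qed
  qed
  then show ?R using car by blast
next
  assume R: ?R
  then have car: "x \<in> carrier_mat (2 * n) (2 * n)"
    and e: "\<And>i j. i < 2 * n \<Longrightarrow> j < 2 * n \<Longrightarrow> x $$ (mir n j, mir n i) = - (sg n i * sg n j * x $$ (i, j))" by auto
  define A where "A = mat n n (\<lambda>(i, j). x $$ (i, j))"
  define B where "B = mat n n (\<lambda>(i, j). x $$ (i, j + n))"
  define C where "C = mat n n (\<lambda>(i, j). x $$ (i + n, j))"
  have "B = anti_transpose B"
  proof (rule eq_matI)
    fix i j assume "i < dim_row (anti_transpose B)" "j < dim_col (anti_transpose B)"
    then have ij: "i < n" "j < n" by (auto simp: anti_transpose_def B_def)
    have "mir n (j + n) = n - 1 - j" "mir n i = n - 1 - i + n" using ij by (auto simp: mir_def)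
    then have "x $$ (n - 1 - j, n - 1 - i + n) = x $$ (i, j + n)" using e[of i "j + n"] ij by (simp add: sg_def)
    then show "B $$ (i, j) = anti_transpose B $$ (i, j)" using ij by (auto simp: anti_transpose_def B_def)
  qed (auto simp: anti_transpose_def B_def)
  moreover have "C = anti_transpose C"
  proof (rule eq_matI)
    fix i j assume "i < dim_row (anti_transpose C)" "j < dim_col (anti_transpose C)"
    then have ij: "i < n" "j < n" by (auto simp: anti_transpose_def C_def)
    have "mir n j = n - 1 - j + n" "mir n (i + n) = n - 1 - i" using ij by (auto simp: mir_def)
    then have "x $$ (n - 1 - j + n, n - 1 - i) = x $$ (i + n, j)" using e[of "i + n" j] ij by (simp add: sg_def)
    then show "C $$ (i, j) = anti_transpose C $$ (i, j)" using ij by (auto simp: anti_transpose_def C_def)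
  qed (auto simp: anti_transpose_def C_def)
  moreover have "x = four_block_mat A B C (- anti_transpose A)"
  proof (rule eq_matI)
    fix i j assume "i < dim_row (four_block_mat A B C (- anti_transpose A))"
      "j < dim_col (four_block_mat A B C (- anti_transpose A))"
    then have ij: "i < 2 * n" "j < 2 * n" by (auto simp: anti_transpose_def A_def)
    have D: "x $$ (i, j) = - x $$ (n - 1 - (j - n), n - 1 - (i - n))" if "\<not> i < n" "\<not> j < n"
    proof -
      have "n - 1 - (j - n) = mir n j" "n - 1 - (i - n) = mir n i" using that by (auto simp: mir_def)
      then show ?thesis using e[OF ij] that by (simp add: sg_def)
    qed
    show "x $$ (i, j) = four_block_mat A B C (- anti_transpose A) $$ (i, j)"
      using ij D by (subst index_mat_four_block) (auto simp: A_def B_def C_def anti_transpose_def)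
  qed (use car in \<open>auto simp: anti_transpose_def A_def\<close>)
  moreover have "A \<in> carrier_mat n n" "B \<in> carrier_mat n n" "C \<in> carrier_mat n n"
    by (simp_all add: A_def B_def C_def)
  ultimately show "x \<in> sp n"
    unfolding sp_def mem_Collect_eq by (intro exI conjI)
qed

lemma sp_carrier: "x \<in> sp n \<Longrightarrow> x \<in> carrier_mat (2 * n) (2 * n)"
  and sp_entry: "x \<in> sp n \<Longrightarrow> i < 2 * n \<Longrightarrow> j < 2 * n \<Longrightarrow>
    x $$ (mir n j, mir n i) = - (sg n i * sg n j * x $$ (i, j))"
  by (auto simp: sp_iff)

lemma bracket_carrier:
  "x \<in> carrier_mat m m \<Longrightarrow> y \<in> carrier_mat m m \<Longrightarrow> bracket x y \<in> carrier_mat m m"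
  by (auto simp: bracket_def)

lemma mult_entry:
  assumes "x \<in> carrier_mat m m" "y \<in> carrier_mat m m" "i < m" "j < m"
  shows "(x * y) $$ (i, j) = (\<Sum>k<m. x $$ (i, k) * y $$ (k, j))"
  using assms by (auto simp: scalar_prod_def atLeast0LessThan)

lemma bracket_entry:
  assumes "x \<in> carrier_mat m m" "y \<in> carrier_mat m m" "i < m" "j < m"
  shows "bracket x y $$ (i, j) = (\<Sum>k<m. x $$ (i, k) * y $$ (k, j)) - (\<Sum>k<m. y $$ (i, k) * x $$ (k, j))"
  using assms mult_entry[OF assms] mult_entry[OF assms(2,1,3,4)] by (auto simp: bracket_def)

lemma sp_bracket:
  assumes "x \<in> sp n" "y \<in> sp n"
  shows "bracket x y \<in> sp n"
proof -
  note c = sp_carrier[OF assms(1)] sp_carrier[OF assms(2)]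
  have "(\<Sum>k<2 * n. u $$ (mir n j, k) * v $$ (k, mir n i)) = sg n i * sg n j * (\<Sum>k<2 * n. v $$ (i, k) * u $$ (k, j))"
    if "u \<in> sp n" "v \<in> sp n" "i < 2 * n" "j < 2 * n" for u v i j
  proof -
    have "(\<Sum>k<2 * n. u $$ (mir n j, k) * v $$ (k, mir n i))
        = (\<Sum>k<2 * n. u $$ (mir n j, mir n k) * v $$ (mir n k, mir n i))"
      by (rule sum.reindex_bij_betw[OF bij_mir, symmetric])
    also have "\<dots> = (\<Sum>k<2 * n. sg n i * sg n j * (v $$ (i, k) * u $$ (k, j)))"
      by (rule sum.cong) (use that in \<open>auto simp: sp_entry ac_simps\<close>)
    finally show ?thesis by (simp add: sum_distrib_left)
  qed
  note e = this
  have "bracket x y $$ (mir n j, mir n i) = - (sg n i * sg n j * bracket x y $$ (i, j))"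
    if ij: "i < 2 * n" "j < 2 * n" for i j
    unfolding bracket_entry[OF c ij] bracket_entry[OF c mir_lt[OF ij(2)] mir_lt[OF ij(1)]]
      e[OF assms ij] e[OF assms(2,1) ij]
    by (simp add: right_diff_distrib)
  then show ?thesis unfolding sp_iff using bracket_carrier[OF c] by blast
qed

section \<open>Weight components\<close>

text \<open>Twice the projection of a matrix unit to \<open>sp n\<close>: a root vector, or a Cartan
  element for \<open>i = j\<close>. For a long root, where \<open>mir n j = i\<close>, both terms
  hit the same position and add up to 2.\<close>

definition rootmat :: "nat \<Rightarrow> nat \<Rightarrow> nat \<Rightarrow> 'a::field mat" where
  "rootmat n i j = mat (2 * n) (2 * n) (\<lambda>(k, l). of_bool (k = i \<and> l = j)
     - sg n k * sg n l * of_bool (mir n l = i \<and> mir n k = j))"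

lemma rootmat_carrier [simp]: "rootmat n i j \<in> carrier_mat (2 * n) (2 * n)"
  by (simp add: rootmat_def)

lemma rootmat_entry: "k < 2 * n \<Longrightarrow> l < 2 * n \<Longrightarrow>
    rootmat n i j $$ (k, l) = of_bool (k = i \<and> l = j) - sg n k * sg n l * of_bool (mir n l = i \<and> mir n k = j)"
  by (simp add: rootmat_def)

lemma rootmat_sp: "rootmat n i j \<in> sp n"
  by (auto simp: sp_iff rootmat_entry sg_mir)

lemma sp_entry_rootmat:
  assumes "x \<in> sp n" "k < 2 * n" "l < 2 * n" "i < 2 * n" "j < 2 * n"
  shows "x $$ (i, j) * rootmat n i j $$ (k, l)
    = x $$ (k, l) * (of_bool (k = i \<and> l = j) + of_bool (mir n l = i \<and> mir n k = j))"
  using sp_entry[OF assms(1-3)] assms(2,3) by (auto simp: rootmat_entry sg_mir)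

lemma rootmat_mir:
  assumes "i < 2 * n" "j < 2 * n"
  shows "rootmat n (mir n j) (mir n i) = (- (sg n i * sg n j)) \<cdot>\<^sub>m (rootmat n i j :: 'a::field mat)"
proof (rule eq_matI)
  fix k l assume "k < dim_row ((- (sg n i * sg n j)) \<cdot>\<^sub>m (rootmat n i j :: 'a mat))"
    "l < dim_col ((- (sg n i * sg n j)) \<cdot>\<^sub>m (rootmat n i j :: 'a mat))"
  then have kl: "k < 2 * n" "l < 2 * n" by (auto simp: rootmat_def)
  have m: "mir n l = mir n j \<longleftrightarrow> l = j" "mir n k = mir n i \<longleftrightarrow> k = i" "mir n l = i \<longleftrightarrow> l = mir n i"
    "mir n k = j \<longleftrightarrow> k = mir n j"
    using kl assms mir_eq_iff mir_eq_swap by blast+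
  have q: "sg n k * sg n l * of_bool (l = j \<and> k = i) = sg n i * sg n j * (of_bool (k = i \<and> l = j) :: 'a)" by auto
  have p: "sg n i * sg n j * (sg n k * sg n l * of_bool (l = mir n i \<and> k = mir n j)) = (of_bool (k = mir n j \<and> l = mir n i) :: 'a)"
    using assms by (auto simp: sg_mir) (auto simp: sg_def)
  have alg: "- a * (b - c) = a * c - a * b" for a b c :: 'a by (simp add: algebra_simps)
  have "((- (sg n i * sg n j)) \<cdot>\<^sub>m (rootmat n i j :: 'a mat)) $$ (k, l) = - (sg n i * sg n j) * rootmat n i j $$ (k, l)"
    using kl by (intro index_smult_mat) (auto simp: rootmat_def)
  then show "rootmat n (mir n j) (mir n i) $$ (k, l) = ((- (sg n i * sg n j)) \<cdot>\<^sub>m (rootmat n i j :: 'a mat)) $$ (k, l)"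
    unfolding rootmat_entry[OF kl] m alg p q by (simp only:)
qed (auto simp: rootmat_def)

lemma rootmat_mult:
  assumes "i < 2 * n" "j < 2 * n" "a < 2 * n" "b < 2 * n" "k < 2 * n" "l < 2 * n"
  shows "(\<Sum>m<2 * n. rootmat n i j $$ (k, m) * rootmat n a b $$ (m, l)) =
    of_bool (k = i \<and> j = a \<and> l = b) - sg n j * sg n l * of_bool (k = i \<and> mir n l = a \<and> mir n j = b)
    + sg n k * sg n i * of_bool (mir n i = a \<and> mir n k = j \<and> l = b)
    + sg n k * sg n l * (of_bool (mir n k = j \<and> mir n l = a \<and> i = b) :: 'a::field)"
proof -
  have "(\<Sum>m<2 * n. rootmat n i j $$ (k, m) * rootmat n a b $$ (m, l)) =
     (\<Sum>m<2 * n. (if m = j then of_bool (k = i \<and> j = a \<and> l = b) else 0)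
       - (if m = j then sg n j * sg n l * of_bool (k = i \<and> mir n l = a \<and> mir n j = b) else 0)
       + (if m = mir n i then sg n k * sg n i * of_bool (mir n i = a \<and> mir n k = j \<and> l = b) else 0)
       + (if m = mir n i then sg n k * sg n l * (of_bool (mir n k = j \<and> mir n l = a \<and> i = b) :: 'a) else 0))"
  proof (rule sum.cong[OF refl])
    fix m assume "m \<in> {..<2 * n}"
    then have m: "m < 2 * n" by simp
    have mi: "mir n m = i \<longleftrightarrow> m = mir n i" using m assms mir_eq_swap by blast
    have t1: "of_bool (k = i \<and> m = j) * of_bool (m = a \<and> l = b)
        = (if m = j then of_bool (k = i \<and> j = a \<and> l = b) else (0 :: 'a))" by auto
    have t2: "of_bool (k = i \<and> m = j) * (sg n m * sg n l * of_bool (mir n l = a \<and> mir n m = b))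
        = (if m = j then sg n j * sg n l * of_bool (k = i \<and> mir n l = a \<and> mir n j = b) else (0 :: 'a))" by auto
    have t3: "sg n k * sg n m * of_bool (m = mir n i \<and> mir n k = j) * of_bool (m = a \<and> l = b)
        = (if m = mir n i then sg n k * sg n (mir n i) * of_bool (mir n i = a \<and> mir n k = j \<and> l = b) else (0 :: 'a))" by auto
    have t4: "sg n k * sg n m * of_bool (m = mir n i \<and> mir n k = j) * (sg n m * sg n l * of_bool (mir n l = a \<and> mir n m = b))
        = (if m = mir n i then sg n k * sg n l * (of_bool (mir n k = j \<and> mir n l = a \<and> mir n (mir n i) = b) :: 'a) else 0)"
      by (auto simp: mult.assoc)
    have prod: "(A - B) * (C - D) = A * C - A * D - B * C + B * D" for A B C D :: 'a
      by (simp add: algebra_simps)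
    show "rootmat n i j $$ (k, m) * rootmat n a b $$ (m, l) = (if m = j then of_bool (k = i \<and> j = a \<and> l = b) else 0)
       - (if m = j then sg n j * sg n l * of_bool (k = i \<and> mir n l = a \<and> mir n j = b) else 0)
       + (if m = mir n i then sg n k * sg n i * of_bool (mir n i = a \<and> mir n k = j \<and> l = b) else 0)
       + (if m = mir n i then sg n k * sg n l * (of_bool (mir n k = j \<and> mir n l = a \<and> i = b) :: 'a) else 0)"
      unfolding rootmat_entry[OF assms(5) m] rootmat_entry[OF m assms(6)] mi prod t1 t2 t3 t4
        sg_mir[OF assms(1)] mir_mir[OF assms(1)] by simp
  qed
  then show ?thesis using assms by (simp add: sum.distrib sum_subtractf)
qed

text \<open>A diagonal matrix separating the roots: the coefficients in a relation between at most four
  signed powers of 5 are bounded by 4, so the relation is trivial.\<close>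

definition hz :: "nat \<Rightarrow> nat \<Rightarrow> int" where
  "hz n k = (if k < n then 5 ^ k else - (5 ^ mir n k))"

text \<open>A multiple of 5 of absolute value at most 4 is zero; this removes the lowest digit, and
  the rest is divided by 5.\<close>

lemma base5_unique:
  assumes "(\<Sum>m<n. c m * 5 ^ m) = (0 :: int)" "\<And>m. m < n \<Longrightarrow> \<bar>c m\<bar> \<le> 4" "m < n"
  shows "c m = 0"
  using assms
proof (induction n arbitrary: c m)
  case (Suc n)
  define S where "S = (\<Sum>m<n. c (Suc m) * 5 ^ m)"
  have "(\<Sum>m<Suc n. c m * 5 ^ m) = c 0 * 5 ^ 0 + (\<Sum>m<n. c (Suc m) * 5 ^ Suc m)"
    by (rule sum.lessThan_Suc_shift)
  also have "(\<Sum>m<n. c (Suc m) * 5 ^ Suc m) = 5 * S"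
    unfolding S_def sum_distrib_left by (rule sum.cong) auto
  finally have e: "c 0 + 5 * S = 0" using Suc.prems(1) by simp
  moreover have "\<bar>c 0\<bar> \<le> 4" using Suc.prems(2)[of 0] by simp
  ultimately have c0: "c 0 = 0" and s: "S = 0" by presburger+
  show ?case
  proof (cases m)
    case (Suc m')
    then show ?thesis using Suc.IH[of "\<lambda>m. c (Suc m)" m'] s[unfolded S_def] Suc.prems(2,3) by simp
  qed (simp add: c0)
qed simp

text \<open>Two equal differences of signed basis vectors, compared at the only coordinates that can
  be nonzero. The difference on the right being nonzero, its terms agree with those on the left up
  to exchanging them with a change of sign.\<close>

lemma four_signs:
  fixes A B C D :: nat and a b c d :: int
  assumes "(if C = A then c else 0) - (if D = A then d else 0) = (if A = A then a else 0) - (if B = A then b else 0)"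
    "(if C = B then c else 0) - (if D = B then d else 0) = (if A = B then a else 0) - (if B = B then b else 0)"
    "(if C = C then c else 0) - (if D = C then d else 0) = (if A = C then a else 0) - (if B = C then b else 0)"
    "(if C = D then c else 0) - (if D = D then d else 0) = (if A = D then a else 0) - (if B = D then b else 0)"
    "a = 1 \<or> a = - 1" "b = 1 \<or> b = - 1" "c = 1 \<or> c = - 1" "d = 1 \<or> d = - 1" "\<not> (A = B \<and> a = b)"
  shows "C = A \<and> D = B \<and> c = a \<and> d = b \<or> D = A \<and> C = B \<and> d = - a \<and> c = - b"
  using assms(5-8) assms(1-4,9)
  by (elim disjE) (auto split: if_split_asm)

text \<open>The second alternative is the mirrored position, which belongs to the same root in
  \<open>sp n\<close>. Uniqueness of the digits reduces the claim to \<open>four_signs\<close>,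
  after an index is split into its absolute position and a sign.\<close>

lemma hz_separates:
  assumes "i < 2 * n" "j < 2 * n" "k < 2 * n" "l < 2 * n" "i \<noteq> j" "hz n k - hz n l = hz n i - hz n j"
  shows "k = i \<and> l = j \<or> mir n l = i \<and> mir n k = j"
proof -
  define d :: "nat \<Rightarrow> nat \<Rightarrow> int" where "d k m = of_bool (k = m) - of_bool (mir n k = m)" for k m
  have hz: "hz n k = (\<Sum>m<n. d k m * 5 ^ m)" if "k < 2 * n" for k
  proof -
    have "(\<Sum>m<n. d k m * 5 ^ m) = (\<Sum>m<n. (if m = k then 5 ^ k else 0)) - (\<Sum>m<n. (if m = mir n k then 5 ^ mir n k else 0))"
      unfolding sum_subtractf[symmetric] by (rule sum.cong) (auto simp: d_def)
    then show ?thesis using that by (auto simp: hz_def mir_def)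
  qed
  have "(\<Sum>m<n. (d k m - d l m - (d i m - d j m)) * 5 ^ m) = 0"
  proof -
    have "(\<Sum>m<n. (d k m - d l m - (d i m - d j m)) * 5 ^ m) = hz n k - hz n l - (hz n i - hz n j)"
      by (simp only: left_diff_distrib sum_subtractf hz[OF assms(1)] hz[OF assms(2)] hz[OF assms(3)] hz[OF assms(4)])
    then show ?thesis using assms(6) by linarith
  qed
  moreover have "\<bar>d k m - d l m - (d i m - d j m)\<bar> \<le> 4" for m
  proof -
    have "\<bar>d t m\<bar> \<le> 1" for t by (auto simp: d_def)
    from this[of k] this[of l] this[of i] this[of j] show ?thesis by linarith
  qed
  ultimately have "d k m - d l m - (d i m - d j m) = 0" if "m < n" for m
    using base5_unique[where c = "\<lambda>m. d k m - d l m - (d i m - d j m)", OF _ _ that] by blast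
  then have e: "d k m - d l m = d i m - d j m" if "m < n" for m using that eq_iff_diff_eq_0 by blast
  define ab where "ab t = (if t < n then t else mir n t)" for t
  define si :: "nat \<Rightarrow> int" where "si t = (if t < n then 1 else - 1)" for t
  have si: "si t = 1 \<or> si t = - 1" for t by (simp add: si_def)
  have ab: "ab t < n" if "t < 2 * n" for t using that by (auto simp: ab_def mir_def)
  have dd: "d t m = (if ab t = m then si t else 0)" if "t < 2 * n" "m < n" for t m
    using that by (auto simp: d_def ab_def mir_def si_def)
  have inj: "t = u \<longleftrightarrow> ab t = ab u \<and> si t = si u" if "t < 2 * n" "u < 2 * n" for t u
    using that by (auto simp: ab_def mir_def si_def)
  have minj: "mir n t = u \<longleftrightarrow> ab t = ab u \<and> si t = - si u" if "t < 2 * n" "u < 2 * n" for t u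
    using that by (auto simp: ab_def mir_def si_def)
  have "(if ab k = m then si k else 0) - (if ab l = m then si l else 0)
      = (if ab i = m then si i else 0) - (if ab j = m then si j else 0)" if "m < n" for m
    using e[OF that] unfolding dd[OF assms(1) that] dd[OF assms(2) that] dd[OF assms(3) that] dd[OF assms(4) that] .
  note E = this[OF ab[OF assms(1)]] this[OF ab[OF assms(2)]] this[OF ab[OF assms(3)]] this[OF ab[OF assms(4)]]
  have "\<not> (ab i = ab j \<and> si i = si j)" using assms(5) inj[OF assms(1,2)] by blast
  then have "ab k = ab i \<and> ab l = ab j \<and> si k = si i \<and> si l = si j \<or>
      ab l = ab i \<and> ab k = ab j \<and> si l = - si i \<and> si k = - si j"
    by (rule four_signs[OF E si si si si])
  then show ?thesis
    unfolding inj[OF assms(3,1)] inj[OF assms(4,2)] minj[OF assms(4,1)] minj[OF assms(3,2)] by blast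
qed

section \<open>Subalgebras containing the lower Borel subalgebra\<close>

definition hgen :: "nat \<Rightarrow> 'a::field mat" where
  "hgen n = mat (2 * n) (2 * n) (\<lambda>(k, l). if k = l then of_int (hz n k) else 0)"

lemma hz_mir: "k < 2 * n \<Longrightarrow> hz n (mir n k) = - hz n k"
  by (auto simp: hz_def mir_def)

lemma hgen_cartan: "hgen n \<in> cartan n"
proof -
  have "hgen n \<in> sp n"
    by (auto simp: sp_iff hgen_def mir_eq_iff hz_mir)
  then show ?thesis by (auto simp: cartan_def diagonal_mat_def hgen_def)
qed

lemma bracket_diagonal_entry:
  assumes "h \<in> carrier_mat m m" "diagonal_mat h" "x \<in> carrier_mat m m" "k < m" "l < m"
  shows "bracket h x $$ (k, l) = (h $$ (k, k) - h $$ (l, l)) * x $$ (k, l)"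
proof -
  have "(\<Sum>r<m. h $$ (k, r) * x $$ (r, l)) = (\<Sum>r<m. if r = k then h $$ (k, k) * x $$ (k, l) else 0)"
    by (rule sum.cong) (use assms in \<open>auto simp: diagonal_mat_def\<close>)
  moreover have "(\<Sum>r<m. x $$ (k, r) * h $$ (r, l)) = (\<Sum>r<m. if r = l then h $$ (l, l) * x $$ (k, l) else 0)"
    by (rule sum.cong) (use assms in \<open>auto simp: diagonal_mat_def\<close>)
  ultimately show ?thesis using assms by (simp add: bracket_entry algebra_simps)
qed

lemma lie_subalgebra_sp_iff:
  fixes p :: "'a::field mat set"
  shows "lie_subalgebra_sp n p \<longleftrightarrow> p \<subseteq> sp n \<and> 0\<^sub>m (2 * n) (2 * n) \<in> p \<and> (\<forall>x\<in>p. \<forall>y\<in>p. x + y \<in> p) \<and>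
    (\<forall>c. \<forall>x\<in>p. c \<cdot>\<^sub>m x \<in> p) \<and> (\<forall>x\<in>p. \<forall>y\<in>p. bracket x y \<in> p)"
proof -
  let ?V = "module_mat TYPE('a) (2 * n) (2 * n)"
  have vs: "vectorspace class_ring ?V" by (rule matrix_vs)
  then have m: "module class_ring ?V" by (simp add: vectorspace_def)
  have "VectorSpace.subspace class_ring p ?V \<longleftrightarrow> submodule class_ring p ?V"
    using vs by (auto simp: VectorSpace.subspace_def)
  also have "\<dots> \<longleftrightarrow> p \<subseteq> carrier_mat (2 * n) (2 * n) \<and> 0\<^sub>m (2 * n) (2 * n) \<in> p \<and>
      (\<forall>x\<in>p. \<forall>y\<in>p. x + y \<in> p) \<and> (\<forall>c. \<forall>x\<in>p. c \<cdot>\<^sub>m x \<in> p)"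
  proof
    assume s: "submodule class_ring p ?V"
    show "p \<subseteq> carrier_mat (2 * n) (2 * n) \<and> 0\<^sub>m (2 * n) (2 * n) \<in> p \<and>
      (\<forall>x\<in>p. \<forall>y\<in>p. x + y \<in> p) \<and> (\<forall>c. \<forall>x\<in>p. c \<cdot>\<^sub>m x \<in> p)"
      using submodule.subset[OF s] submodule.zero_closed[OF s] submodule.m_closed[OF s] submodule.smult_closed[OF s]
      unfolding module_mat_simps by simp
  next
    assume a: "p \<subseteq> carrier_mat (2 * n) (2 * n) \<and> 0\<^sub>m (2 * n) (2 * n) \<in> p \<and>
      (\<forall>x\<in>p. \<forall>y\<in>p. x + y \<in> p) \<and> (\<forall>c. \<forall>x\<in>p. c \<cdot>\<^sub>m x \<in> p)"
    show "submodule class_ring p ?V"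
      by (rule submodule.intro, rule m) (use a in \<open>simp_all add: module_mat_simps\<close>)
  qed
  finally have e: "VectorSpace.subspace class_ring p ?V \<longleftrightarrow> \<dots>" .
  have "p \<subseteq> sp n \<Longrightarrow> p \<subseteq> carrier_mat (2 * n) (2 * n)" using sp_carrier by blast
  then show ?thesis unfolding lie_subalgebra_sp_def e by argo
qed

lemma dim_rootmat [simp]: "dim_row (rootmat n i j) = 2 * n" "dim_col (rootmat n i j) = 2 * n"
  by (simp_all add: rootmat_def)

lemma rootmat_nonzero:
  assumes "i < 2 * n" "j < 2 * n"
  shows "rootmat n i j $$ (i, j) = (1 + of_bool (mir n j = i) :: 'a::field)"
proof -
  have m: "mir n j = i \<and> mir n i = j \<longleftrightarrow> mir n j = i" using assms by auto
  have "sg n i * sg n j * of_bool (mir n j = i) = (- of_bool (mir n j = i) :: 'a)"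
    using assms sg_mir[of j n, where 'a = 'a] by (cases "mir n j = i") auto
  then show ?thesis unfolding rootmat_entry[OF assms] m by simp
qed

locale borel_minus_subalgebra =
  fixes n :: nat and p :: "'a::field_char_0 mat set"
  assumes subalg: "lie_subalgebra_sp n p" and borel: "cartan n \<union> u_minus n \<subseteq> p"
begin

lemma sub_sp: "x \<in> p \<Longrightarrow> x \<in> sp n" and zero: "0\<^sub>m (2 * n) (2 * n) \<in> p"
  and add: "x \<in> p \<Longrightarrow> y \<in> p \<Longrightarrow> x + y \<in> p" and smult: "x \<in> p \<Longrightarrow> c \<cdot>\<^sub>m x \<in> p"
  and bracket: "x \<in> p \<Longrightarrow> y \<in> p \<Longrightarrow> bracket x y \<in> p"
  using subalg by (auto simp: lie_subalgebra_sp_iff)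

lemma carrier: "x \<in> p \<Longrightarrow> x \<in> carrier_mat (2 * n) (2 * n)"
  using sub_sp sp_carrier by blast

text \<open>A polynomial in the adjoint action of \<open>hgen n\<close>, applied to
  \<open>x\<close>: this action multiplies the entry at \<open>(k, l)\<close> by
  \<open>hz n k - hz n l\<close>, so the subalgebra admits Lagrange interpolation.\<close>

lemma lagrange:
  assumes "finite A" "x \<in> p"
  shows "mat (2 * n) (2 * n) (\<lambda>(k, l). (\<Prod>\<mu>\<in>A. of_int (hz n k - hz n l) - \<mu>) * x $$ (k, l)) \<in> p"
  using assms(1)
proof (induction A rule: finite_induct)
  case empty
  have "mat (2 * n) (2 * n) (\<lambda>(k, l). x $$ (k, l)) = x" using carrier[OF assms(2)] by auto
  then show ?case using assms(2) by simp
next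
  case (insert \<mu> A)
  let ?y = "mat (2 * n) (2 * n) (\<lambda>(k, l). (\<Prod>\<mu>\<in>A. of_int (hz n k - hz n l) - \<mu>) * x $$ (k, l))"
  have h: "hgen n \<in> carrier_mat (2 * n) (2 * n)" "diagonal_mat (hgen n)" "hgen n \<in> p"
    using hgen_cartan[of n] borel by (auto simp: cartan_def hgen_def)
  have "bracket (hgen n) ?y + (- \<mu>) \<cdot>\<^sub>m ?y
      = mat (2 * n) (2 * n) (\<lambda>(k, l). (\<Prod>\<mu>\<in>insert \<mu> A. of_int (hz n k - hz n l) - \<mu>) * x $$ (k, l))"
  proof (rule eq_matI, goal_cases)
    case (1 k l)
    then have kl: "k < 2 * n" "l < 2 * n" by auto
    have "bracket (hgen n) ?y $$ (k, l) = of_int (hz n k - hz n l) * ?y $$ (k, l)"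
      using bracket_diagonal_entry[OF h(1,2) _ kl, of ?y] kl by (simp add: hgen_def)
    then show ?case using kl insert(1,2) by (simp add: algebra_simps)
  qed (use bracket_carrier[OF h(1), of ?y] in auto)
  then show ?case using add[OF bracket[OF h(3) insert(3)] smult[OF insert(3), of "- \<mu>"]] by simp
qed

text \<open>The interpolation polynomial with all eigenvalues but one as roots isolates the weight
  of \<open>(i, j)\<close>, and by \<open>hz_separates\<close> that weight occurs only at this
  position and its mirror.\<close>

lemma component:
  assumes "x \<in> p" "i < 2 * n" "j < 2 * n" "i \<noteq> j"
  shows "x $$ (i, j) \<cdot>\<^sub>m rootmat n i j \<in> p"
proof -
  let ?d = "\<lambda>(k, l). of_int (hz n k - hz n l) :: 'a"
  let ?A = "?d ` ({..<2 * n} \<times> {..<2 * n}) - {?d (i, j)}"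
  define c where "c = (\<Prod>\<mu>\<in>?A. ?d (i, j) - \<mu>)"
  define y where "y = mat (2 * n) (2 * n) (\<lambda>(k, l). (\<Prod>\<mu>\<in>?A. of_int (hz n k - hz n l) - \<mu>) * x $$ (k, l))"
  have y: "y \<in> p" unfolding y_def by (rule lagrange[OF _ assms(1)]) simp
  have c0: "c \<noteq> 0" by (auto simp: c_def)
  have ye: "y $$ (k, l) = (if ?d (k, l) = ?d (i, j) then c * x $$ (k, l) else 0)" if "k < 2 * n" "l < 2 * n" for k l
  proof (cases "?d (k, l) = ?d (i, j)")
    case True
    then show ?thesis using that unfolding y_def c_def by simp
  next
    case False
    then have "?d (k, l) \<in> ?A" using that by blast
    then have "(\<Prod>\<mu>\<in>?A. ?d (k, l) - \<mu>) = 0" by (intro prod_zero) auto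
    then show ?thesis using that False unfolding y_def by simp
  qed
  have dd: "?d (k, l) = ?d (i, j) \<longleftrightarrow> k = i \<and> l = j \<or> mir n l = i \<and> mir n k = j" if "k < 2 * n" "l < 2 * n" for k l
  proof
    assume "?d (k, l) = ?d (i, j)"
    then have "hz n k - hz n l = hz n i - hz n j" by (simp only: split of_int_eq_iff)
    then show "k = i \<and> l = j \<or> mir n l = i \<and> mir n k = j" using hz_separates assms that by blast
  next
    assume "k = i \<and> l = j \<or> mir n l = i \<and> mir n k = j"
    then show "?d (k, l) = ?d (i, j)"
    proof
      assume m: "mir n l = i \<and> mir n k = j"
      have "hz n i = - hz n l" "hz n j = - hz n k" using m hz_mir that by auto
      then show ?thesis by simp
    qed simp
  qed
  \<comment> \<open>For a long root the two positions coincide and the root vector has entry 2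
    there.\<close>
  define e :: 'a where "e = (if mir n j = i then 2 else 1)"
  have "x $$ (i, j) \<cdot>\<^sub>m rootmat n i j = (e / c) \<cdot>\<^sub>m y"
  proof (rule eq_matI, goal_cases)
    case (1 k l)
    then have kl: "k < 2 * n" "l < 2 * n" using carrier[OF y] by auto
    have "x $$ (i, j) * rootmat n i j $$ (k, l)
        = x $$ (k, l) * (of_bool (k = i \<and> l = j) + of_bool (mir n l = i \<and> mir n k = j))"
      by (rule sp_entry_rootmat[OF sub_sp[OF assms(1)] kl assms(2,3)])
    also have "\<dots> = e / c * y $$ (k, l)"
    proof (cases "k = i \<and> l = j \<or> mir n l = i \<and> mir n k = j")
      case True
      then have "of_bool (k = i \<and> l = j) + of_bool (mir n l = i \<and> mir n k = j) = e"
        using kl assms by (auto simp: e_def mir_mir)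
      then show ?thesis using c0 ye[OF kl] dd[OF kl] True by simp
    next
      case False
      then show ?thesis using ye[OF kl] dd[OF kl] by auto
    qed
    finally show ?case using kl carrier[OF y] by simp
  qed (use carrier[OF y] in auto)
  then show ?thesis using smult[OF y] by simp
qed

lemma rootmat_mem:
  assumes "x \<in> p" "i < 2 * n" "j < 2 * n" "i \<noteq> j" "x $$ (i, j) \<noteq> 0"
  shows "rootmat n i j \<in> p"
proof -
  have "(1 / x $$ (i, j)) \<cdot>\<^sub>m (x $$ (i, j) \<cdot>\<^sub>m rootmat n i j) = rootmat n i j"
    using assms(5) by (intro eq_matI) auto
  then show ?thesis using smult[OF component[OF assms(1-4)], of "1 / x $$ (i, j)"] by simp
qed

lemma rootmat_mir_mem:
  assumes "i < 2 * n" "j < 2 * n"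
  shows "rootmat n (mir n j) (mir n i) \<in> p \<longleftrightarrow> rootmat n i j \<in> p"
proof -
  have "rootmat n (mir n j) (mir n i) \<in> p" if "rootmat n i j \<in> p" "i < 2 * n" "j < 2 * n" for i j
    unfolding rootmat_mir[OF that(2,3)] by (rule smult[OF that(1)])
  from this[of i j] this[of "mir n j" "mir n i"] show ?thesis using assms by auto
qed

lemma rootmat_lower:
  assumes "i < 2 * n" "j \<le> i"
  shows "rootmat n i j \<in> p"
proof (cases "j = i")
  case True
  have "diagonal_mat (rootmat n i i :: 'a mat)"
    using assms by (auto simp: diagonal_mat_def rootmat_entry mir_eq_iff)
  then show ?thesis using borel rootmat_sp True by (auto simp: cartan_def)
next
  case False
  have "(rootmat n i j :: 'a mat) $$ (k, l) = 0" if "l < 2 * n" "k \<le> l" for k l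
    using that assms False by (auto simp: rootmat_entry mir_def)
  then have "(rootmat n i j :: 'a mat) \<in> u_minus n" unfolding u_minus_def using rootmat_sp by blast
  then show ?thesis using borel by blast
qed

text \<open>Bracketing with the lower root vector at \<open>(j, j - 1)\<close> moves the column.
  Coincidences of mirrored indices only add further ones to the coefficient, which is therefore
  nonzero in characteristic zero.\<close>

lemma shrink_right:
  assumes "rootmat n i j \<in> p" "i + 1 < j" "j < 2 * n"
  shows "rootmat n i (j - 1) \<in> p"
proof -
  have l: "i < 2 * n" "j - 1 < 2 * n" using assms by auto
  let ?X = "rootmat n i j :: 'a mat" and ?Y = "rootmat n j (j - 1) :: 'a mat"
  have "bracket ?X ?Y \<in> p" using assms rootmat_lower by (intro bracket) auto
  moreover have "bracket ?X ?Y $$ (i, j - 1) = 1 + of_bool (mir n (j - 1) = j) + of_bool (mir n i = j) + of_bool (mir n i = j - 1)"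
  proof -
    have 1: "mir n (j - 1) = j \<and> mir n j = j - 1 \<longleftrightarrow> mir n (j - 1) = j" using assms by (auto simp: mir_def)
    have 2: "mir n (j - 1) = j \<Longrightarrow> sg n j * sg n (j - 1) = (- 1 :: 'a)"
      using assms by (auto simp: sg_def mir_def)
    have 3: "mir n i = j - 1 \<and> mir n (j - 1) = i \<longleftrightarrow> mir n i = j - 1" using assms by (auto simp: mir_def)
    have 4: "mir n i = j - 1 \<Longrightarrow> sg n i * sg n (j - 1) = (- 1 :: 'a)"
      using assms by (auto simp: sg_def mir_def)
    have t2: "sg n j * sg n (j - 1) * of_bool (mir n (j - 1) = j \<and> mir n j = j - 1) = (- of_bool (mir n (j - 1) = j) :: 'a)"
      unfolding 1 using 2 by (cases "mir n (j - 1) = j") simp_all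
    have t4: "sg n i * sg n (j - 1) * of_bool (mir n i = j - 1 \<and> mir n (j - 1) = i) = (- of_bool (mir n i = j - 1) :: 'a)"
      unfolding 3 using 4 by (cases "mir n i = j - 1") simp_all
    have ne: "i \<noteq> j" "i \<noteq> j - 1" "j - 1 \<noteq> j" using assms by auto
    show ?thesis
      unfolding bracket_entry[OF rootmat_carrier rootmat_carrier l]
        rootmat_mult[OF l(1) assms(3) assms(3) l(2) l] rootmat_mult[OF assms(3) l(2) l(1) assms(3) l]
        simp_thms t2 t4
      by (simp only: ne t4 simp_thms of_bool_eq mult_zero_right sg_square mult_1_left diff_0_right add_0_right diff_0
          diff_minus_eq_add add_0_left)
  qed
  moreover have "\<dots> \<noteq> (0 :: 'a)"
    by (auto simp: of_bool_def)
  ultimately show ?thesis using rootmat_mem l assms by (metis less_diff_conv less_irrefl)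
qed

lemma shrink_left:
  assumes "rootmat n i j \<in> p" "i + 1 < j" "j < 2 * n"
  shows "rootmat n (i + 1) j \<in> p"
proof -
  have i: "i < 2 * n" using assms by simp
  have "rootmat n (mir n j) (mir n i) \<in> p" using rootmat_mir_mem[OF i assms(3)] assms(1) by simp
  then have "rootmat n (mir n j) (mir n i - 1) \<in> p"
    by (rule shrink_right) (use assms i in \<open>auto simp: mir_def\<close>)
  moreover have "mir n i - 1 = mir n (i + 1)" using assms by (auto simp: mir_def)
  ultimately show ?thesis using rootmat_mir_mem[of "i + 1" j] assms by simp
qed

lemma extend_right:
  assumes "rootmat n i (j - 1) \<in> p" "rootmat n (j - 1) j \<in> p" "i + 1 < j" "j < 2 * n"
  shows "rootmat n i j \<in> p"
proof -
  have l: "i < 2 * n" "j - 1 < 2 * n" using assms by auto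
  let ?X = "rootmat n i (j - 1) :: 'a mat" and ?Y = "rootmat n (j - 1) j :: 'a mat"
  have "bracket ?X ?Y \<in> p" using assms by (intro bracket) auto
  moreover have "bracket ?X ?Y $$ (i, j) = 1 + of_bool (mir n j = j - 1) + of_bool (mir n i = j - 1) + of_bool (mir n i = j)"
  proof -
    have 1: "mir n j = j - 1 \<and> mir n (j - 1) = j \<longleftrightarrow> mir n j = j - 1" using assms by (auto simp: mir_def)
    have 2: "mir n j = j - 1 \<Longrightarrow> sg n (j - 1) * sg n j = (- 1 :: 'a)"
      using assms by (auto simp: sg_def mir_def)
    have 3: "mir n i = j \<and> mir n j = i \<longleftrightarrow> mir n i = j" using assms by (auto simp: mir_def)
    have 4: "mir n i = j \<Longrightarrow> sg n i * sg n j = (- 1 :: 'a)"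
      using assms by (auto simp: sg_def mir_def)
    have t2: "sg n (j - 1) * sg n j * of_bool (mir n j = j - 1 \<and> mir n (j - 1) = j) = (- of_bool (mir n j = j - 1) :: 'a)"
      unfolding 1 using 2 by (cases "mir n j = j - 1") simp_all
    have t4: "sg n i * sg n j * of_bool (mir n i = j \<and> mir n j = i) = (- of_bool (mir n i = j) :: 'a)"
      unfolding 3 using 4 by (cases "mir n i = j") simp_all
    have ne: "i \<noteq> j" "i \<noteq> j - 1" "j \<noteq> j - 1" using assms by auto
    show ?thesis
      unfolding bracket_entry[OF rootmat_carrier rootmat_carrier l(1) assms(4)]
        rootmat_mult[OF l l(2) assms(4) l(1) assms(4)] rootmat_mult[OF l(2) assms(4) l l(1) assms(4)]
        simp_thms t2 t4
      by (simp only: ne t4 simp_thms of_bool_eq mult_zero_right sg_square mult_1_left diff_0_right add_0_right diff_0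
          diff_minus_eq_add add_0_left)
  qed
  moreover have "\<dots> \<noteq> (0 :: 'a)"
    by (auto simp: of_bool_def)
  ultimately show ?thesis using rootmat_mem l assms by (metis less_irrefl less_trans less_add_one)
qed

text \<open>The reason why simple roots determine a parabolic subalgebra: a positive root vector can
  be shortened to each superdiagonal step it passes over, and is rebuilt from these steps by
  brackets.\<close>

lemma rootmat_mem_iff:
  assumes "i < j" "j < 2 * n"
  shows "rootmat n i j \<in> p \<longleftrightarrow> (\<forall>c. i < c \<and> c \<le> j \<longrightarrow> rootmat n (c - 1) c \<in> p)"
proof
  assume "rootmat n i j \<in> p"
  then show "\<forall>c. i < c \<and> c \<le> j \<longrightarrow> rootmat n (c - 1) c \<in> p"
    using assms
  proof (induction "j - i" arbitrary: i j rule: less_induct)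
    case less
    show ?case
    proof (intro allI impI)
      fix c assume c: "i < c \<and> c \<le> j"
      show "rootmat n (c - 1) c \<in> p"
      proof (cases "i + 1 < j")
        case False
        then have "c = j" "i = c - 1" using c less.prems by auto
        then show ?thesis using less.prems by simp
      next
        case True
        show ?thesis
        proof (cases "c = j")
          case True
          then show ?thesis
            using less.hyps[of j "i + 1"] shrink_left[OF less.prems(1) \<open>i + 1 < j\<close> less.prems(3)] \<open>i + 1 < j\<close> less.prems
            by auto
        next
          case False
          then show ?thesis
            using less.hyps[of "j - 1" i] shrink_right[OF less.prems(1) True less.prems(3)] True less.prems c
            by auto
        qed
      qed
    qed
  qed
next
  assume "\<forall>c. i < c \<and> c \<le> j \<longrightarrow> rootmat n (c - 1) c \<in> p"
  then show "rootmat n i j \<in> p" using assms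
  proof (induction j)
    case (Suc j)
    show ?case
    proof (cases "i = j")
      case True
      then show ?thesis using Suc.prems by auto
    next
      case False
      then show ?thesis using Suc extend_right[of i "Suc j"] by auto
    qed
  qed simp
qed

lemma mem_if_components:
  assumes "x \<in> sp n" "\<And>i j. i < 2 * n \<Longrightarrow> j < 2 * n \<Longrightarrow> x $$ (i, j) \<noteq> 0 \<Longrightarrow> rootmat n i j \<in> p"
  shows "x \<in> p"
proof -
  let ?I = "{..<2 * n} \<times> {..<2 * n}"
  define S where "S Q = mat (2 * n) (2 * n) (\<lambda>(k, l). \<Sum>(i, j)\<in>Q. x $$ (i, j) * rootmat n i j $$ (k, l))" for Q
  have s: "S Q \<in> p" if "finite Q" "Q \<subseteq> ?I" for Q
    using that
  proof (induction Q rule: finite_induct)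
    case empty
    have "S {} = 0\<^sub>m (2 * n) (2 * n)" by (intro eq_matI) (auto simp: S_def)
    then show ?case using zero by simp
  next
    case (insert q Q)
    obtain i j where q: "q = (i, j)" "i < 2 * n" "j < 2 * n" using insert.prems by auto
    have "x $$ (i, j) \<cdot>\<^sub>m rootmat n i j \<in> p"
    proof (cases "x $$ (i, j) = 0")
      case True
      then have "x $$ (i, j) \<cdot>\<^sub>m rootmat n i j = 0\<^sub>m (2 * n) (2 * n)" by (intro eq_matI) auto
      then show ?thesis using zero by simp
    qed (use assms(2) q smult in blast)
    moreover have "S Q \<in> p" using insert by auto
    moreover have "S (insert q Q) = x $$ (i, j) \<cdot>\<^sub>m rootmat n i j + S Q"
      using insert(1,2) by (intro eq_matI) (auto simp: q S_def)
    ultimately show ?case using add by simp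
  qed
  \<comment> \<open>Summing over all positions counts every entry twice, once for its position and
    once for the mirrored one.\<close>
  have "(1 / 2) \<cdot>\<^sub>m S ?I = x"
  proof (rule eq_matI, goal_cases)
    case (1 k l)
    then have kl: "k < 2 * n" "l < 2 * n" using sp_carrier[OF assms(1)] by auto
    have two: "a * (of_bool A + of_bool B) = (if A then a else 0) + (if B then a else 0)" for a :: 'a and A B
      by (cases A; cases B) (simp_all add: mult_2_right)
    have "(\<Sum>(i, j)\<in>?I. x $$ (i, j) * rootmat n i j $$ (k, l))
        = (\<Sum>q\<in>?I. (if q = (k, l) then x $$ (k, l) else 0) + (if q = (mir n l, mir n k) then x $$ (k, l) else 0))"
    proof (rule sum.cong[OF refl])
      fix q assume "q \<in> ?I"
      then obtain i j where q: "q = (i, j)" "i < 2 * n" "j < 2 * n" by auto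
      have b: "k = i \<and> l = j \<longleftrightarrow> q = (k, l)" "mir n l = i \<and> mir n k = j \<longleftrightarrow> q = (mir n l, mir n k)"
        unfolding q(1) by blast+
      have "x $$ (i, j) * rootmat n i j $$ (k, l)
          = (if q = (k, l) then x $$ (k, l) else 0) + (if q = (mir n l, mir n k) then x $$ (k, l) else 0)"
        unfolding sp_entry_rootmat[OF assms(1) kl q(2,3)] b by (rule two)
      then show "(case q of (i, j) \<Rightarrow> x $$ (i, j) * rootmat n i j $$ (k, l))
          = (if q = (k, l) then x $$ (k, l) else 0) + (if q = (mir n l, mir n k) then x $$ (k, l) else 0)"
        unfolding q(1) split .
    qed
    also have "\<dots> = 2 * x $$ (k, l)" using kl by (simp add: sum.distrib)
    finally show ?case using kl by (simp add: S_def)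
  qed (use sp_carrier[OF assms(1)] in \<open>auto simp: S_def\<close>)
  then show ?thesis using smult[OF s[of ?I], of "1 / 2"] by simp
qed

end

section \<open>Standard parabolic subalgebras\<close>

lemma cartan_mir:
  assumes "h \<in> cartan n" "k < 2 * n"
  shows "h $$ (mir n k, mir n k) = - h $$ (k, k)"
  using sp_entry[of h n k k] assms by (auto simp: cartan_def)

text \<open>The long root fits the formula of the short ones: the index \<open>n\<close> is the
  mirror of \<open>n - 1\<close>, so the adjacent diagonal entries are opposite and their difference
  is twice the first.\<close>

lemma simple_root_cartan:
  assumes "h \<in> cartan n" "1 \<le> c" "c \<le> n"
  shows "simple_root n c h = h $$ (c - 1, c - 1) - h $$ (c, c)"
proof (cases "c = n")
  case True
  have "mir n (n - 1) = n" using assms True by (auto simp: mir_def)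
  then have "h $$ (n, n) = - h $$ (n - 1, n - 1)" using cartan_mir[OF assms(1), of "n - 1"] assms by auto
  then show ?thesis using True by (simp add: simple_root_def eps_def)
qed (use assms in \<open>simp add: simple_root_def eps_def\<close>)

lemma root_space_iff:
  "x \<in> root_space n \<alpha> \<longleftrightarrow> x \<in> sp n \<and> (\<forall>h \<in> cartan n. \<forall>k < 2 * n. \<forall>l < 2 * n.
     (h $$ (k, k) - h $$ (l, l)) * x $$ (k, l) = \<alpha> h * x $$ (k, l))"
proof -
  have "bracket h x = \<alpha> h \<cdot>\<^sub>m x \<longleftrightarrow> (\<forall>k < 2 * n. \<forall>l < 2 * n. (h $$ (k, k) - h $$ (l, l)) * x $$ (k, l) = \<alpha> h * x $$ (k, l))"
    if "x \<in> sp n" "h \<in> cartan n" for h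
  proof -
    have c: "h \<in> carrier_mat (2 * n) (2 * n)" "diagonal_mat h" "x \<in> carrier_mat (2 * n) (2 * n)"
      using that sp_carrier by (auto simp: cartan_def)
    note e = bracket_diagonal_entry[OF c] and b = bracket_carrier[OF c(1,3)]
    show ?thesis
    proof
      assume a: "bracket h x = \<alpha> h \<cdot>\<^sub>m x"
      show "\<forall>k < 2 * n. \<forall>l < 2 * n. (h $$ (k, k) - h $$ (l, l)) * x $$ (k, l) = \<alpha> h * x $$ (k, l)"
      proof (intro allI impI)
        fix k l assume kl: "k < 2 * n" "l < 2 * n"
        then have "bracket h x $$ (k, l) = \<alpha> h * x $$ (k, l)" unfolding a using c(3) by simp
        then show "(h $$ (k, k) - h $$ (l, l)) * x $$ (k, l) = \<alpha> h * x $$ (k, l)" unfolding e[OF kl] .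
      qed
    next
      assume "\<forall>k < 2 * n. \<forall>l < 2 * n. (h $$ (k, k) - h $$ (l, l)) * x $$ (k, l) = \<alpha> h * x $$ (k, l)"
      then show "bracket h x = \<alpha> h \<cdot>\<^sub>m x" using e b c(3) by (intro eq_matI) auto
    qed
  qed
  then show ?thesis by (auto simp: root_space_def)
qed

lemma rootmat_root_space:
  assumes "1 \<le> c" "c \<le> n"
  shows "rootmat n (c - 1) c \<in> root_space n (simple_root n c)"
proof -
  have "(h $$ (k, k) - h $$ (l, l)) * rootmat n (c - 1) c $$ (k, l) = simple_root n c h * rootmat n (c - 1) c $$ (k, l)"
    if h: "h \<in> cartan n" and kl: "k < 2 * n" "l < 2 * n" for h :: "'a mat" and k l
  proof -
    have "rootmat n (c - 1) c $$ (k, l) = (0 :: 'a)"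
      if "\<not> (k = c - 1 \<and> l = c)" "\<not> (mir n l = c - 1 \<and> mir n k = c)"
      unfolding rootmat_entry[OF kl] using that by (simp only: of_bool_eq simp_thms mult_zero_right diff_self)
    then consider "k = c - 1 \<and> l = c" | "mir n l = c - 1 \<and> mir n k = c" | "rootmat n (c - 1) c $$ (k, l) = (0 :: 'a)"
      by blast
    then show ?thesis
    proof cases
      case 2
      then have "h $$ (c - 1, c - 1) = - h $$ (l, l)" "h $$ (c, c) = - h $$ (k, k)"
        using cartan_mir[OF h kl(1)] cartan_mir[OF h kl(2)] by (simp_all only:)
      then show ?thesis using simple_root_cartan[OF h assms] by simp
    qed (use simple_root_cartan[OF h assms] in auto)
  qed
  then show ?thesis unfolding root_space_iff using rootmat_sp by blast
qed

text \<open>Evaluating the weight condition at \<open>hgen n\<close> alone suffices, since that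
  element separates the roots.\<close>

lemma root_space_support:
  fixes x :: "'a::field_char_0 mat"
  assumes "x \<in> root_space n (simple_root n c)" "1 \<le> c" "c \<le> n" "k < 2 * n" "l < 2 * n" "x $$ (k, l) \<noteq> 0"
  shows "k = c - 1 \<and> l = c \<or> mir n l = c - 1 \<and> mir n k = c"
proof -
  have h: "hgen n \<in> cartan n" by (rule hgen_cartan)
  have "(hgen n $$ (k, k) - hgen n $$ (l, l)) * x $$ (k, l) = simple_root n c (hgen n) * x $$ (k, l)"
    using assms h unfolding root_space_iff by blast
  then have "((hgen n :: 'a mat) $$ (k, k) - hgen n $$ (l, l)) = hgen n $$ (c - 1, c - 1) - hgen n $$ (c, c)"
    unfolding simple_root_cartan[OF h assms(2,3)] using assms(6) by (simp only: mult_cancel_right simp_thms)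
  then have "(of_int (hz n k - hz n l) :: 'a) = of_int (hz n (c - 1) - hz n c)"
    using assms by (simp add: hgen_def)
  then have "hz n k - hz n l = hz n (c - 1) - hz n c" by (simp only: of_int_eq_iff)
  then show ?thesis using hz_separates[of "c - 1" n c k l] assms by auto
qed

lemma simple_root_inj: "inj_on (simple_root n :: nat \<Rightarrow> 'a::field_char_0 mat \<Rightarrow> 'a) {1..n}"
proof (rule inj_onI)
  fix c d assume cd: "c \<in> {1..n}" "d \<in> {1..n}" "(simple_root n c :: 'a mat \<Rightarrow> 'a) = simple_root n d"
  have "(rootmat n (c - 1) c :: 'a mat) \<in> root_space n (simple_root n c)"
    by (rule rootmat_root_space) (use cd in auto)
  then have "(rootmat n (c - 1) c :: 'a mat) \<in> root_space n (simple_root n d)" unfolding cd(3) .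
  moreover have lt: "c - 1 < 2 * n" "c < 2 * n" using cd by auto
  then have "(rootmat n (c - 1) c :: 'a mat) $$ (c - 1, c) \<noteq> 0"
    using rootmat_nonzero[OF lt, where 'a = 'a] by (cases "mir n c = c - 1") auto
  ultimately have "c - 1 = d - 1 \<and> c = d \<or> mir n c = d - 1 \<and> mir n (c - 1) = d"
    using root_space_support[of "rootmat n (c - 1) c :: 'a mat" n d "c - 1" c] cd by auto
  then show "c = d" using cd by (auto simp: mir_def)
qed

text \<open>The stabiliser of a partial flag, written as vanishing across cuts; each cut
  \<open>c\<close> comes with its mirror \<open>2 * n - c\<close>, as the flag is self-dual.\<close>

definition pminus :: "nat \<Rightarrow> nat set \<Rightarrow> 'a::field mat set" where
  "pminus n J = {x \<in> sp n. \<forall>i < 2 * n. \<forall>j < 2 * n. \<forall>c. i < c \<and> c \<le> j \<and> (c \<in> J \<or> 2 * n - c \<in> J) \<longrightarrow> x $$ (i, j) = 0}"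

definition pplus :: "nat \<Rightarrow> nat set \<Rightarrow> 'a::field mat set" where
  "pplus n J = {x \<in> sp n. \<forall>i < 2 * n. \<forall>j < 2 * n. \<forall>c. j < c \<and> c \<le> i \<and> (c \<in> J \<or> 2 * n - c \<in> J) \<longrightarrow> x $$ (i, j) = 0}"

text \<open>The predicate under the definite description in \<open>parabolic_minus\<close>, made
  available for a proof of existence and uniqueness.\<close>

definition minus_type :: "nat \<Rightarrow> ('a::field mat \<Rightarrow> 'a) set \<Rightarrow> 'a mat set \<Rightarrow> bool" where
  "minus_type n \<Psi> p \<longleftrightarrow> lie_subalgebra_sp n p \<and> cartan n \<union> u_minus n \<subseteq> p \<and>
     \<Psi> = {\<alpha> \<in> simple_roots n. \<not> root_space n \<alpha> \<subseteq> p}"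

definition plus_type :: "nat \<Rightarrow> ('a::field mat \<Rightarrow> 'a) set \<Rightarrow> 'a mat set \<Rightarrow> bool" where
  "plus_type n \<Psi> p \<longleftrightarrow> lie_subalgebra_sp n p \<and> cartan n \<union> u_plus n \<subseteq> p \<and>
     \<Psi> = {\<alpha> \<in> simple_roots n. \<not> root_space n (- \<alpha>) \<subseteq> p}"

lemma sp_zero: "0\<^sub>m (2 * n) (2 * n) \<in> sp n"
  by (auto simp: sp_iff)

lemma spI:
  "x \<in> carrier_mat (2 * n) (2 * n) \<Longrightarrow>
    (\<And>i j. i < 2 * n \<Longrightarrow> j < 2 * n \<Longrightarrow> x $$ (mir n j, mir n i) = - (sg n i * sg n j * x $$ (i, j))) \<Longrightarrow> x \<in> sp n"
  by (simp add: sp_iff)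

lemma sp_add:
  assumes "x \<in> sp n" "y \<in> sp n"
  shows "x + y \<in> sp n"
proof (rule spI)
  note c = sp_carrier[OF assms(1)] sp_carrier[OF assms(2)]
  show "x + y \<in> carrier_mat (2 * n) (2 * n)" using c by simp
  fix i j assume "i < 2 * n" "j < 2 * n"
  then show "(x + y) $$ (mir n j, mir n i) = - (sg n i * sg n j * (x + y) $$ (i, j))"
    using c sp_entry[OF assms(1)] sp_entry[OF assms(2)] by (simp add: distrib_left)
qed

lemma sp_smult:
  assumes "x \<in> sp n"
  shows "c \<cdot>\<^sub>m x \<in> sp n"
proof (rule spI)
  note car = sp_carrier[OF assms]
  show "c \<cdot>\<^sub>m x \<in> carrier_mat (2 * n) (2 * n)" using car by simp
  have ring: "c * - (a * b * d) = - (a * b * (c * d))" for a b d :: 'a by (simp add: ac_simps)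
  fix i j assume "i < 2 * n" "j < 2 * n"
  then show "(c \<cdot>\<^sub>m x) $$ (mir n j, mir n i) = - (sg n i * sg n j * (c \<cdot>\<^sub>m x) $$ (i, j))"
    using car sp_entry[OF assms, of i j] ring by simp
qed

lemma pminus_subalgebra: "lie_subalgebra_sp n (pminus n J :: 'a::field mat set)"
  unfolding lie_subalgebra_sp_iff
proof (intro conjI ballI allI)
  show "(pminus n J :: 'a mat set) \<subseteq> sp n" by (auto simp: pminus_def)
  show "0\<^sub>m (2 * n) (2 * n) \<in> (pminus n J :: 'a mat set)" using sp_zero by (auto simp: pminus_def)
next
  fix x y :: "'a mat" assume x: "x \<in> pminus n J" and y: "y \<in> pminus n J"
  then have c: "x \<in> carrier_mat (2 * n) (2 * n)" "y \<in> carrier_mat (2 * n) (2 * n)" and s: "x \<in> sp n" "y \<in> sp n"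
    using sp_carrier by (auto simp: pminus_def)
  show "x + y \<in> pminus n J" using x y c sp_add[OF s] by (auto simp: pminus_def)
  \<comment> \<open>Each intermediate index \<open>k\<close> lies on one side of the cut, and then
    one of the two factors vanishes.\<close>
  have z: "(\<Sum>k<2 * n. u $$ (i, k) * v $$ (k, j)) = 0"
    if "u \<in> pminus n J" "v \<in> pminus n J" "i < 2 * n" "j < 2 * n" "i < c" "c \<le> j" "c \<in> J \<or> 2 * n - c \<in> J"
    for u v :: "'a mat" and i j c
  proof (rule sum.neutral, rule ballI)
    fix k assume "k \<in> {..<2 * n}"
    then have k: "k < 2 * n" by simp
    show "u $$ (i, k) * v $$ (k, j) = 0"
    proof (cases "k < c")
      case True
      then have "v $$ (k, j) = 0" using that k unfolding pminus_def by blast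
      then show ?thesis by simp
    next
      case False
      then have "c \<le> k" by simp
      then have "u $$ (i, k) = 0" using that k unfolding pminus_def by blast
      then show ?thesis by simp
    qed
  qed
  have "bracket x y $$ (i, j) = 0"
    if "i < 2 * n" "j < 2 * n" "i < c" "c \<le> j" "c \<in> J \<or> 2 * n - c \<in> J" for i j c
    unfolding bracket_entry[OF c that(1,2)] z[OF x y that] z[OF y x that] by simp
  then show "bracket x y \<in> pminus n J" using sp_bracket[OF s] unfolding pminus_def by blast
next
  fix c and x :: "'a mat" assume x: "x \<in> pminus n J"
  then have "x \<in> carrier_mat (2 * n) (2 * n)" "x \<in> sp n" using sp_carrier by (auto simp: pminus_def)
  then show "c \<cdot>\<^sub>m x \<in> pminus n J" using x sp_smult by (auto simp: pminus_def)
qed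

lemma pminus_borel: "cartan n \<union> u_minus n \<subseteq> pminus n J"
proof
  fix x :: "'a mat" assume "x \<in> cartan n \<union> u_minus n"
  then have "x \<in> sp n" "\<And>i j. i < 2 * n \<Longrightarrow> j < 2 * n \<Longrightarrow> i < j \<Longrightarrow> x $$ (i, j) = 0"
    using sp_carrier[of x n] by (auto simp: cartan_def u_minus_def diagonal_mat_def)
  then show "x \<in> pminus n J" by (auto simp: pminus_def)
qed

text \<open>Uniqueness: the simple roots fix which superdiagonal root vectors belong to
  \<open>p\<close>, hence by \<open>rootmat_mem_iff\<close> which positive ones do, and membership
  of a matrix is decided by its components. Existence is a check of
  \<open>pminus n J\<close>.\<close>

lemma minus_type_iff:
  fixes p :: "'a::field_char_0 mat set"
  assumes J: "J \<subseteq> {1..n}"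
  shows "minus_type n (simple_root n ` J) p \<longleftrightarrow> p = pminus n J"
proof -
  have rs: "root_space n (simple_root n c) \<subseteq> p \<longleftrightarrow> rootmat n (c - 1) c \<in> p"
    if "borel_minus_subalgebra n p" "c \<in> {1..n}" for c and p :: "'a mat set"
  proof
    interpret borel_minus_subalgebra n p by (rule that)
    assume r: "rootmat n (c - 1) c \<in> p"
    then have r': "rootmat n (mir n c) (mir n (c - 1)) \<in> p"
      using rootmat_mir_mem[of "c - 1" c] that by auto
    show "root_space n (simple_root n c) \<subseteq> p"
    proof
      fix x :: "'a mat" assume x: "x \<in> root_space n (simple_root n c)"
      show "x \<in> p"
      proof (rule mem_if_components)
        show "x \<in> sp n" using x by (simp add: root_space_iff)
        fix i j assume ij: "i < 2 * n" "j < 2 * n" "x $$ (i, j) \<noteq> 0"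
        have "i = c - 1 \<and> j = c \<or> mir n j = c - 1 \<and> mir n i = c"
          by (rule root_space_support[OF x _ _ ij]) (use that in auto)
        then show "rootmat n i j \<in> p" using r r' mir_mir ij by metis
      qed
    qed
  next
    assume "root_space n (simple_root n c) \<subseteq> p"
    then show "rootmat n (c - 1) c \<in> p" using rootmat_root_space[of c n] that by auto
  qed
  have psi: "simple_root n ` J = {\<alpha> \<in> simple_roots n. \<not> root_space n \<alpha> \<subseteq> p}
      \<longleftrightarrow> (\<forall>c \<in> {1..n}. c \<in> J \<longleftrightarrow> rootmat n (c - 1) c \<notin> p)"
    if "borel_minus_subalgebra n p" for p :: "'a mat set"
  proof -
    have "{\<alpha> \<in> simple_roots n. \<not> root_space n \<alpha> \<subseteq> p} = (simple_root n :: nat \<Rightarrow> 'a mat \<Rightarrow> 'a) ` {c \<in> {1..n}. rootmat n (c - 1) c \<notin> p}"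
      using rs[OF that] unfolding simple_roots_def by blast
    moreover have "(simple_root n :: nat \<Rightarrow> 'a mat \<Rightarrow> 'a) ` J = simple_root n ` {c \<in> {1..n}. rootmat n (c - 1) c \<notin> p}
        \<longleftrightarrow> J = {c \<in> {1..n}. rootmat n (c - 1) c \<notin> p}"
      by (rule inj_on_image_eq_iff[OF simple_root_inj J]) auto
    moreover have "J = {c \<in> {1..n}. rootmat n (c - 1) c \<notin> p} \<longleftrightarrow> (\<forall>c \<in> {1..n}. c \<in> J \<longleftrightarrow> rootmat n (c - 1) c \<notin> p)"
      using J by blast
    ultimately show ?thesis by simp
  qed
  have bm: "borel_minus_subalgebra n p \<longleftrightarrow> lie_subalgebra_sp n p \<and> cartan n \<union> u_minus n \<subseteq> p" for p :: "'a mat set"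
    by (simp add: borel_minus_subalgebra_def)
  show ?thesis
  proof
    assume t: "minus_type n (simple_root n ` J) p"
    then have b: "borel_minus_subalgebra n p" by (simp add: bm minus_type_def)
    then interpret borel_minus_subalgebra n p .
    have D: "c \<in> J \<longleftrightarrow> rootmat n (c - 1) c \<notin> p" if "c \<in> {1..n}" for c
      using psi[OF b] t that unfolding minus_type_def by blast
    \<comment> \<open>Simple roots index only \<open>c \<le> n\<close>; for larger \<open>c\<close>
      the mirrored superdiagonal position carries the same root vector up to a scalar.\<close>
    have D': "rootmat n (c - 1) c \<notin> p \<longleftrightarrow> c \<in> J \<or> 2 * n - c \<in> J" if "1 \<le> c" "c < 2 * n" for c
    proof (cases "c \<le> n")
      case True
      have "c \<in> J" if "2 * n - c \<in> J"
      proof -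
        have "2 * n - c \<le> n" using J that by auto
        then have "2 * n - c = c" using True by auto
        then show ?thesis using that by simp
      qed
      then show ?thesis using D[of c] True that by auto
    next
      case False
      have e: "mir n c = 2 * n - c - 1" "mir n (c - 1) = 2 * n - c" using that by (auto simp: mir_def)
      have "rootmat n (c - 1) c \<in> p \<longleftrightarrow> rootmat n (2 * n - c - 1) (2 * n - c) \<in> p"
        using rootmat_mir_mem[of "c - 1" c] that unfolding e by simp
      moreover have "c \<notin> J" using J False by auto
      moreover have "2 * n - c \<in> {1..n}" using False that by auto
      ultimately show ?thesis using D[of "2 * n - c"] by blast
    qed
    have M: "rootmat n i j \<in> p \<longleftrightarrow> (\<forall>c. i < c \<and> c \<le> j \<longrightarrow> \<not> (c \<in> J \<or> 2 * n - c \<in> J))"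
      if "i < j" "j < 2 * n" for i j
    proof -
      have "(i < c \<and> c \<le> j \<longrightarrow> rootmat n (c - 1) c \<in> p) \<longleftrightarrow> (i < c \<and> c \<le> j \<longrightarrow> \<not> (c \<in> J \<or> 2 * n - c \<in> J))" for c
        using D'[of c] that by auto
      then show ?thesis unfolding rootmat_mem_iff[OF that] by (simp only:)
    qed
    show "p = pminus n J"
    proof
      show "p \<subseteq> pminus n J"
      proof
        fix x assume x: "x \<in> p"
        have "x $$ (i, j) = 0" if "i < 2 * n" "j < 2 * n" "i < c" "c \<le> j" "c \<in> J \<or> 2 * n - c \<in> J" for i j c
          using rootmat_mem[OF x that(1,2)] M[of i j] that by fastforce
        then show "x \<in> pminus n J" using sub_sp[OF x] unfolding pminus_def by blast
      qed
      show "pminus n J \<subseteq> p"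
      proof
        fix x :: "'a mat" assume x: "x \<in> pminus n J"
        show "x \<in> p"
        proof (rule mem_if_components)
          show "x \<in> sp n" using x by (simp add: pminus_def)
          fix i j assume ij: "i < 2 * n" "j < 2 * n" "x $$ (i, j) \<noteq> 0"
          show "rootmat n i j \<in> p"
          proof (cases "i < j")
            case True
            then show ?thesis using M[of i j] ij x unfolding pminus_def by blast
          qed (use rootmat_lower ij in auto)
        qed
      qed
    qed
  next
    assume p: "p = pminus n J"
    have b: "borel_minus_subalgebra n p"
      unfolding bm p by (intro conjI pminus_subalgebra pminus_borel)
    have "rootmat n (c - 1) c \<notin> p \<longleftrightarrow> c \<in> J" if c: "c \<in> {1..n}" for c
    proof
      assume "c \<in> J"
      moreover have lt: "c - 1 < 2 * n" "c < 2 * n" using c by auto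
      then have "(rootmat n (c - 1) c :: 'a mat) $$ (c - 1, c) \<noteq> 0"
        using rootmat_nonzero[OF lt, where 'a = 'a] by (cases "mir n c = c - 1") auto
      moreover have "(rootmat n (c - 1) c :: 'a mat) $$ (c - 1, c) = 0" if "rootmat n (c - 1) c \<in> p" "c \<in> J"
      proof -
        have "\<forall>i < 2 * n. \<forall>j < 2 * n. \<forall>d. i < d \<and> d \<le> j \<and> (d \<in> J \<or> 2 * n - d \<in> J) \<longrightarrow>
            (rootmat n (c - 1) c :: 'a mat) $$ (i, j) = 0"
          using that(1) unfolding p pminus_def by blast
        from this[rule_format, OF lt, of c] show ?thesis using c that(2) by simp
      qed
      ultimately show "rootmat n (c - 1) c \<notin> p" by blast
    next
      assume "rootmat n (c - 1) c \<notin> p"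
      then obtain i j d where ij: "i < 2 * n" "j < 2 * n" "i < d" "d \<le> j" "d \<in> J \<or> 2 * n - d \<in> J"
        "(rootmat n (c - 1) c :: 'a mat) $$ (i, j) \<noteq> 0"
        unfolding p pminus_def using rootmat_sp by blast
      then have "i = c - 1 \<and> j = c \<or> mir n j = c - 1 \<and> mir n i = c"
        by (auto simp: rootmat_entry split: if_splits)
      then have "d = c \<or> d = 2 * n - c" using ij c by (auto simp: mir_def)
      then have "c \<in> J \<or> 2 * n - c \<in> J" using ij c by auto
      moreover have "c \<in> J" if "2 * n - c \<in> J"
      proof -
        have "2 * n - c \<le> n" using J that by auto
        then have "2 * n - c = c" using c by auto
        then show ?thesis using that by simp
      qed
      ultimately show "c \<in> J" by blast
    qed
    then have "simple_root n ` J = {\<alpha> \<in> simple_roots n. \<not> root_space n \<alpha> \<subseteq> p}"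
      unfolding psi[OF b] by blast
    then show "minus_type n (simple_root n ` J) p"
      using b unfolding minus_type_def bm by (simp only: simp_thms)
  qed
qed

lemma parabolic_minus_eq:
  assumes "J \<subseteq> {1..n}"
  shows "parabolic_minus n (simple_root n ` J) = (pminus n J :: 'a::field_char_0 mat set)"
  unfolding parabolic_minus_def minus_type_iff[OF assms, unfolded minus_type_def] the_eq_trivial ..

section \<open>Transposition carries lower to upper parabolic subalgebras\<close>

lemma transpose_sp:
  assumes "x \<in> sp n"
  shows "transpose_mat x \<in> sp n"
proof (rule spI)
  note car = sp_carrier[OF assms]
  show "transpose_mat x \<in> carrier_mat (2 * n) (2 * n)" using car by simp
  have ring: "- (a * b * d) = - (b * a * d)" for a b d :: 'a by (simp add: ac_simps)
  fix i j assume "i < 2 * n" "j < 2 * n"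
  then show "transpose_mat x $$ (mir n j, mir n i) = - (sg n i * sg n j * transpose_mat x $$ (i, j))"
    using car sp_entry[OF assms, of j i] ring[of "sg n i" "sg n j"] by simp
qed

lemma transpose_image_mem: "transpose_mat x \<in> transpose_mat ` p \<longleftrightarrow> x \<in> p"
  by (metis (no_types, lifting) image_iff transpose_transpose)

lemma transpose_mem: "x \<in> transpose_mat ` p \<longleftrightarrow> transpose_mat x \<in> p"
  using transpose_image_mem[of "transpose_mat x" p] by simp

lemma transpose_bracket:
  assumes "x \<in> carrier_mat m m" "y \<in> carrier_mat m m"
  shows "transpose_mat (bracket x y) = bracket (transpose_mat y) (transpose_mat (x :: 'a::field mat))"
  unfolding bracket_def
  using assms by (subst transpose_minus[of _ m m]) (auto simp: transpose_mult)

lemma lie_subalgebra_sp_transpose: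
  fixes p :: "'a::field mat set"
  assumes "lie_subalgebra_sp n p"
  shows "lie_subalgebra_sp n (transpose_mat ` p)"
proof -
  note a = assms[unfolded lie_subalgebra_sp_iff]
  have c: "x \<in> carrier_mat (2 * n) (2 * n)" if "x \<in> p" for x using a that sp_carrier by blast
  show ?thesis
    unfolding lie_subalgebra_sp_iff
  proof (intro conjI ballI allI)
    show "transpose_mat ` p \<subseteq> sp n" using a transpose_sp by blast
    have "transpose_mat (0\<^sub>m (2 * n) (2 * n)) = (0\<^sub>m (2 * n) (2 * n) :: 'a mat)" by auto
    then show "0\<^sub>m (2 * n) (2 * n) \<in> transpose_mat ` p" using a by (metis imageI)
  next
    fix x y assume "x \<in> transpose_mat ` p" "y \<in> transpose_mat ` p"
    then obtain x' y' where xy: "x = transpose_mat x'" "y = transpose_mat y'" "x' \<in> p" "y' \<in> p" by blast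
    have "x + y = transpose_mat (x' + y')" using transpose_add[OF c[OF xy(3)] c[OF xy(4)]] xy by simp
    then show "x + y \<in> transpose_mat ` p" using a xy by blast
    have "bracket x y = transpose_mat (bracket y' x')" using transpose_bracket[OF c[OF xy(4)] c[OF xy(3)]] xy by simp
    then show "bracket x y \<in> transpose_mat ` p" using a xy by blast
  next
    fix k and x :: "'a mat" assume "x \<in> transpose_mat ` p"
    then obtain x' where x: "x = transpose_mat x'" "x' \<in> p" by blast
    have "k \<cdot>\<^sub>m x = transpose_mat (k \<cdot>\<^sub>m x')" unfolding x by (intro eq_matI) auto
    then show "k \<cdot>\<^sub>m x \<in> transpose_mat ` p" using a x by blast
  qed
qed

lemma transpose_cartan: "x \<in> cartan n \<Longrightarrow> transpose_mat x \<in> cartan n"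
  using transpose_sp[of x n] sp_carrier[of x n] by (auto simp: cartan_def diagonal_mat_def)

lemma transpose_u_minus: "x \<in> u_minus n \<Longrightarrow> transpose_mat x \<in> u_plus n"
  using transpose_sp[of x n] sp_carrier[of x n] by (auto simp: u_minus_def u_plus_def)

lemma transpose_u_plus: "x \<in> u_plus n \<Longrightarrow> transpose_mat x \<in> u_minus n"
  using transpose_sp[of x n] sp_carrier[of x n] by (auto simp: u_minus_def u_plus_def)

lemma transpose_root_space:
  assumes "x \<in> root_space n \<alpha>"
  shows "transpose_mat x \<in> root_space n (- \<alpha>)"
proof -
  have x: "x \<in> sp n" using assms by (simp add: root_space_iff)
  have "(h $$ (k, k) - h $$ (l, l)) * transpose_mat x $$ (k, l) = (- \<alpha>) h * transpose_mat x $$ (k, l)"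
    if "h \<in> cartan n" "k < 2 * n" "l < 2 * n" for h k l
  proof -
    have "(h $$ (l, l) - h $$ (k, k)) * x $$ (l, k) = \<alpha> h * x $$ (l, k)"
      using assms that by (simp add: root_space_iff)
    then show ?thesis using that sp_carrier[OF x] by (simp add: algebra_simps)
  qed
  then show ?thesis unfolding root_space_iff using transpose_sp[OF x] by blast
qed

lemma root_space_transpose_subset:
  "root_space n (- \<alpha>) \<subseteq> transpose_mat ` p \<longleftrightarrow> root_space n \<alpha> \<subseteq> p"
proof
  assume a: "root_space n (- \<alpha>) \<subseteq> transpose_mat ` p"
  show "root_space n \<alpha> \<subseteq> p"
    using a transpose_root_space transpose_image_mem by blast
next
  assume a: "root_space n \<alpha> \<subseteq> p"
  show "root_space n (- \<alpha>) \<subseteq> transpose_mat ` p"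
  proof
    fix x assume "x \<in> root_space n (- \<alpha>)"
    then have "transpose_mat x \<in> root_space n (- (- \<alpha>))" by (rule transpose_root_space)
    moreover have "- (- \<alpha>) = \<alpha>" by (simp add: fun_eq_iff)
    ultimately show "x \<in> transpose_mat ` p" using a transpose_mem by auto
  qed
qed

lemma plus_type_transpose:
  fixes p :: "'a::field mat set"
  shows "plus_type n \<Psi> (transpose_mat ` p) \<longleftrightarrow> minus_type n \<Psi> p"
proof -
  have 1: "lie_subalgebra_sp n (transpose_mat ` p) \<longleftrightarrow> lie_subalgebra_sp n p"
    using lie_subalgebra_sp_transpose[of n p] lie_subalgebra_sp_transpose[of n "transpose_mat ` p"]
    by (auto simp: image_image)
  have 2: "cartan n \<union> u_plus n \<subseteq> transpose_mat ` p \<longleftrightarrow> cartan n \<union> u_minus n \<subseteq> p"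
  proof
    assume a: "cartan n \<union> u_plus n \<subseteq> transpose_mat ` p"
    show "cartan n \<union> u_minus n \<subseteq> p"
    proof
      fix x :: "'a mat" assume "x \<in> cartan n \<union> u_minus n"
      then have "transpose_mat x \<in> cartan n \<union> u_plus n" using transpose_cartan transpose_u_minus by blast
      then have "transpose_mat x \<in> transpose_mat ` p" using a by blast
      then show "x \<in> p" unfolding transpose_image_mem .
    qed
  next
    assume a: "cartan n \<union> u_minus n \<subseteq> p"
    show "cartan n \<union> u_plus n \<subseteq> transpose_mat ` p"
    proof
      fix x :: "'a mat" assume "x \<in> cartan n \<union> u_plus n"
      then have "transpose_mat x \<in> cartan n \<union> u_minus n" using transpose_cartan transpose_u_plus by blast
      then show "x \<in> transpose_mat ` p" unfolding transpose_mem using a by blast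
    qed
  qed
  show ?thesis unfolding plus_type_def minus_type_def 1 2 root_space_transpose_subset ..
qed

lemma transpose_pminus: "transpose_mat ` (pminus n J :: 'a::field mat set) = pplus n J"
proof (rule Set.set_eqI)
  fix x :: "'a mat"
  have sp: "transpose_mat x \<in> sp n \<longleftrightarrow> x \<in> sp n" using transpose_sp[of x n] transpose_sp[of "transpose_mat x" n] by auto
  show "x \<in> transpose_mat ` pminus n J \<longleftrightarrow> x \<in> pplus n J"
  proof
    assume a: "x \<in> transpose_mat ` pminus n J"
    then have "x \<in> sp n" unfolding transpose_mem pminus_def using sp by simp
    moreover have "x $$ (i, j) = 0" if "i < 2 * n" "j < 2 * n" "j < c \<and> c \<le> i \<and> (c \<in> J \<or> 2 * n - c \<in> J)" for i j c
    proof -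
      have "transpose_mat x $$ (j, i) = 0" using a that unfolding transpose_mem pminus_def by blast
      then show ?thesis using that sp_carrier[OF calculation] by simp
    qed
    ultimately show "x \<in> pplus n J" unfolding pplus_def by blast
  next
    assume a: "x \<in> pplus n J"
    then have x: "x \<in> sp n" by (simp add: pplus_def)
    have "transpose_mat x $$ (i, j) = 0" if "i < 2 * n" "j < 2 * n" "i < c \<and> c \<le> j \<and> (c \<in> J \<or> 2 * n - c \<in> J)" for i j c
    proof -
      have "x $$ (j, i) = 0" using a that unfolding pplus_def by blast
      then show ?thesis using that sp_carrier[OF x] by simp
    qed
    then show "x \<in> transpose_mat ` pminus n J" unfolding transpose_mem pminus_def using x sp by blast
  qed
qed

lemma parabolic_plus_eq:
  assumes "J \<subseteq> {1..n}"
  shows "parabolic_plus n (simple_root n ` J) = (pplus n J :: 'a::field_char_0 mat set)"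
proof -
  have TT: "transpose_mat ` transpose_mat ` q = q" for q :: "'a mat set" by (simp add: image_image)
  have "plus_type n (simple_root n ` J) p \<longleftrightarrow> p = pplus n J" for p :: "'a mat set"
  proof -
    have "plus_type n (simple_root n ` J) p \<longleftrightarrow> minus_type n (simple_root n ` J) (transpose_mat ` p)"
      unfolding plus_type_transpose[symmetric] TT ..
    also have "\<dots> \<longleftrightarrow> transpose_mat ` p = pminus n J" by (rule minus_type_iff[OF assms])
    also have "\<dots> \<longleftrightarrow> p = pplus n J"
    proof
      assume "transpose_mat ` p = pminus n J"
      then have "transpose_mat ` transpose_mat ` p = pplus n J" by (simp only: transpose_pminus)
      then show "p = pplus n J" unfolding TT .
    next
      assume p: "p = pplus n J"
      show "transpose_mat ` p = pminus n J" unfolding p transpose_pminus[symmetric] TT ..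
    qed
    finally show ?thesis .
  qed
  then show ?thesis
    unfolding parabolic_plus_def plus_type_def by (simp only: the_eq_trivial)
qed

lemma seaweed_C_two:
  assumes "0 < a" "0 < b" "a + b \<le> n"
  shows "(seaweed_C n [n] [a, b] :: 'a::field_char_0 mat set) = pplus n {n} \<inter> pminus n {a, a + b}"
proof -
  have "phi_C n [n] = (simple_root n ` {n} :: ('a mat \<Rightarrow> 'a) set)"
  proof -
    have "1 \<le> k \<and> k \<le> length [n] \<longleftrightarrow> k = 1" for k by auto
    then show ?thesis unfolding phi_C_def by simp
  qed
  moreover have "phi_C n [a, b] = (simple_root n ` {a, a + b} :: ('a mat \<Rightarrow> 'a) set)"
  proof -
    have "phi_C n [a, b] = (\<lambda>k. simple_root n (sum_list (take k [a, b])) :: 'a mat \<Rightarrow> 'a) ` {1..2}"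
      by (auto simp: phi_C_def)
    also have "{1..2} = {1, 2 :: nat}" by auto
    finally show ?thesis by (simp add: numeral_2_eq_2)
  qed
  moreover have "{n} \<subseteq> {1..n}" "{a, a + b} \<subseteq> {1..n}" using assms by auto
  ultimately show ?thesis
    unfolding seaweed_C_def seaweed_def by (simp only: parabolic_plus_eq parabolic_minus_eq)
qed

section \<open>The index as nondegeneracy of a form\<close>

text \<open>Needed because \<open>dim\<close> is a least cardinality of finite generating sets,
  which says nothing when none exists. The induction is on the positions where entries may be
  nonzero; one element with a nonzero entry at the new position clears that entry in all
  others.\<close>

lemma matrix_submodule_finitely_generated:
  fixes W :: "'a::field mat set"
  assumes "finite Q" "submodule class_ring W (module_mat TYPE('a) m m)"
    and "\<And>x i j. x \<in> W \<Longrightarrow> i < m \<Longrightarrow> j < m \<Longrightarrow> (i, j) \<notin> Q \<Longrightarrow> x $$ (i, j) = 0"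
  shows "\<exists>A. finite A \<and> A \<subseteq> W \<and> LinearCombinations.module.span class_ring (module_mat TYPE('a) m m) A = W"
  using assms
proof (induction Q arbitrary: W rule: finite_induct)
  let ?V = "module_mat TYPE('a) m m"
  interpret V: vectorspace "class_ring :: 'a ring" ?V by (rule matrix_vs)
  case empty
  note s = empty.prems(1)
  have "W \<subseteq> {0\<^sub>m m m}"
  proof
    fix x assume x: "x \<in> W"
    then have "x \<in> carrier_mat m m" using submodule.subset[OF s] by (auto simp: module_mat_simps)
    then show "x \<in> {0\<^sub>m m m}" using empty.prems(2)[OF x] by (intro singletonI[THEN back_subst[of "\<lambda>z. z \<in> {0\<^sub>m m m}"]] eq_matI) auto
  qed
  moreover have "0\<^sub>m m m \<in> V.span {}"
    using submodule.zero_closed[OF V.span_is_submodule[of "{}"]] by (simp add: module_mat_simps)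
  moreover have "V.span {} \<subseteq> W" by (rule V.span_is_subset[OF _ s]) simp
  ultimately have "V.span {} = W" by blast
  then show ?case by (intro exI[of _ "{}"]) simp
next
  let ?V = "module_mat TYPE('a) m m"
  interpret V: vectorspace "class_ring :: 'a ring" ?V by (rule matrix_vs)
  case (insert q Q)
  note s = insert.prems(1)
  have car: "x \<in> carrier_mat m m" if "x \<in> W" for x
    using that submodule.subset[OF s] by (auto simp: module_mat_simps)
  then have dims: "dim_row x = m" "dim_col x = m" if "x \<in> W" for x using that by blast+
  obtain i j where q: "q = (i, j)" by (cases q)
  show ?case
  proof (cases "\<exists>w \<in> W. i < m \<and> j < m \<and> w $$ (i, j) \<noteq> 0")
    case False
    then show ?thesis using insert.IH[OF s] insert.prems(2) q by (metis insert_iff prod.inject)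
  next
    case True
    then obtain w where w: "w \<in> W" "w $$ (i, j) \<noteq> 0" and ij: "i < m" "j < m" by blast
    define W' where "W' = {x \<in> W. x $$ (i, j) = 0}"
    have cl: "x + y \<in> W" "c \<cdot>\<^sub>m x \<in> W" "0\<^sub>m m m \<in> W" if "x \<in> W" "y \<in> W" for x y c
      using submodule.m_closed[OF s] submodule.smult_closed[OF s] submodule.zero_closed[OF s] that
      by (simp_all add: module_mat_simps)
    have s': "submodule class_ring W' ?V"
      by (rule submodule.intro[OF V.module_axioms])
        (use cl w dims submodule.subset[OF s] ij in \<open>auto simp: W'_def module_mat_simps\<close>)
    have "x $$ (k, l) = 0" if "x \<in> W'" "k < m" "l < m" "(k, l) \<notin> Q" for x k l
      using insert.prems(2)[of x k l] that q by (cases "(k, l) = (i, j)") (auto simp: W'_def)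
    then obtain A where A: "finite A" "A \<subseteq> W'" "V.span A = W'" using insert.IH[OF s'] by blast
    have A': "insert w A \<subseteq> W" using A w by (auto simp: W'_def)
    have AV: "insert w A \<subseteq> carrier ?V" using A' submodule.subset[OF s] by blast
    note sp = V.span_is_submodule[OF AV]
    have "W \<subseteq> V.span (insert w A)"
    proof
      fix x assume x: "x \<in> W"
      define c where "c = x $$ (i, j) / w $$ (i, j)"
      have "x + (- c) \<cdot>\<^sub>m w \<in> W'"
        using cl[OF x cl(2)[OF w(1) w(1)]] car[OF x] car[OF w(1)] w(2) ij by (simp add: W'_def c_def)
      then have "x + (- c) \<cdot>\<^sub>m w \<in> V.span (insert w A)"
        using A(3) V.span_is_monotone[of A "insert w A"] by blast
      moreover have "c \<cdot>\<^sub>m w \<in> V.span (insert w A)"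
        using submodule.smult_closed[OF sp, of c w] V.in_own_span[OF AV] by (simp add: module_mat_simps)
      ultimately have "x + (- c) \<cdot>\<^sub>m w + c \<cdot>\<^sub>m w \<in> V.span (insert w A)"
        using submodule.m_closed[OF sp] by (simp add: module_mat_simps)
      moreover have "x + (- c) \<cdot>\<^sub>m w + c \<cdot>\<^sub>m w = x"
        using car[OF x] car[OF w(1)] by (intro eq_matI) auto
      ultimately show "x \<in> V.span (insert w A)" by simp
    qed
    moreover have "V.span (insert w A) \<subseteq> W" by (rule V.span_is_subset[OF A' s])
    ultimately show ?thesis using A(1) A' by (intro exI[of _ "insert w A"]) auto
  qed
qed

lemma matrix_submodule_dim_zero:
  fixes W :: "'a::field mat set"
  assumes s: "submodule class_ring W (module_mat TYPE('a) m m)"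
  shows "vectorspace.dim class_ring ((module_mat TYPE('a) m m)\<lparr>carrier := W\<rparr>) = 0 \<longleftrightarrow> W = {0\<^sub>m m m}"
proof -
  let ?V = "module_mat TYPE('a) m m"
  interpret V: vectorspace "class_ring :: 'a ring" ?V by (rule matrix_vs)
  have "VectorSpace.subspace class_ring W ?V" using s V.vectorspace_axioms by (simp add: VectorSpace.subspace_def)
  then interpret W: vectorspace "class_ring :: 'a ring" "V.vs W" by (rule V.subspace_is_vs)
  have sp: "W.span A = V.span A" if "A \<subseteq> W" for A
    by (rule V.span_li_not_depend(1)[OF that s])
  have e: "V.span {} = {0\<^sub>m m m}"
  proof
    have z: "submodule class_ring {0\<^sub>m m m} ?V"
      by (rule submodule.intro[OF V.module_axioms]) (auto simp: module_mat_simps)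
    show "V.span {} \<subseteq> {0\<^sub>m m m}" by (rule V.span_is_subset[OF _ z]) simp
    show "{0\<^sub>m m m} \<subseteq> V.span {}"
      using submodule.zero_closed[OF V.span_is_submodule[of "{}"]] by (simp add: module_mat_simps)
  qed
  let ?P = "\<lambda>k. \<exists>A. finite A \<and> card A = k \<and> A \<subseteq> carrier (V.vs W) \<and> W.span A = carrier (V.vs W)"
  have dim: "W.dim = (LEAST k. ?P k)" by (rule W.dim_def)
  show ?thesis
  proof
    assume "W.dim = 0"
    \<comment> \<open>A finite generating set makes the least element in \<open>dim\<close> an
      attained one, so that dimension zero yields an empty generating set.\<close>
    obtain A where "finite A" "A \<subseteq> W" "V.span A = W"
      using matrix_submodule_finitely_generated[OF _ s, of "{..<m} \<times> {..<m}"] by auto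
    then have "?P (card A)" using sp by auto
    then have "?P (LEAST k. ?P k)" by (rule LeastI)
    then have "?P 0" using \<open>W.dim = 0\<close> dim by simp
    then obtain B where "finite B" "card B = 0" "W.span B = W" by auto
    then have "W.span {} = W" by simp
    then show "W = {0\<^sub>m m m}" using sp[of "{}"] e by simp
  next
    assume "W = {0\<^sub>m m m}"
    then have "?P 0" using sp[of "{}"] e by (intro exI[of _ "{}"]) simp
    then show "W.dim = 0" unfolding dim by (rule Least_eq_0)
  qed
qed

lemma lie_dual_iff:
  fixes g :: "'a::field mat set"
  shows "f \<in> lie_dual class_ring ((module_mat TYPE('a) m m)\<lparr>carrier := g\<rparr>) \<longleftrightarrow>
    (\<forall>x\<in>g. \<forall>y\<in>g. f (x + y) = f x + f y) \<and> (\<forall>c. \<forall>x\<in>g. f (c \<cdot>\<^sub>m x) = c * f x)"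
  by (auto simp: lie_dual_def LinearCombinations.module_hom_def self_module_def module_mat_simps)

lemma bracket_add_left:
  assumes "x \<in> carrier_mat m m" "x' \<in> carrier_mat m m" "y \<in> carrier_mat m m"
  shows "bracket (x + x') y = bracket x y + bracket x' (y :: 'a::field mat)"
proof (rule eq_matI, goal_cases)
  case (1 i j)
  then have ij: "i < m" "j < m" using assms by (auto simp: bracket_def)
  have c: "x + x' \<in> carrier_mat m m" using assms by simp
  show ?case
    using assms ij bracket_carrier[OF assms(1,3)] bracket_carrier[OF assms(2,3)]
    by (simp add: bracket_entry[OF c assms(3) ij] bracket_entry[OF assms(1,3) ij] bracket_entry[OF assms(2,3) ij]
        distrib_left distrib_right sum.distrib)
qed (use assms in \<open>auto simp: bracket_def\<close>)

lemma bracket_smult_left: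
  assumes "x \<in> carrier_mat m m" "y \<in> carrier_mat m m"
  shows "bracket (c \<cdot>\<^sub>m x) y = c \<cdot>\<^sub>m bracket x (y :: 'a::field mat)"
proof (rule eq_matI, goal_cases)
  case (1 i j)
  then have ij: "i < m" "j < m" using assms by (auto simp: bracket_def)
  have cc: "c \<cdot>\<^sub>m x \<in> carrier_mat m m" using assms by simp
  show ?case
    using assms ij bracket_carrier[OF assms]
    by (simp add: bracket_entry[OF cc assms(2) ij] bracket_entry[OF assms ij] sum_distrib_left right_diff_distrib
        mult.left_commute mult.assoc)
qed (use assms in \<open>auto simp: bracket_def\<close>)

text \<open>An infimum of a nonempty set of natural numbers is attained, and a kernel of dimension
  zero is the zero space; so index zero means that some functional has a nondegenerate form.\<close>

lemma index_sp_zero_iff: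
  fixes g :: "'a::field mat set"
  assumes g: "lie_subalgebra_sp n g"
  shows "index_sp n g = 0 \<longleftrightarrow> (\<exists>f. (\<forall>x\<in>g. \<forall>y\<in>g. f (x + y) = f x + f y) \<and> (\<forall>c. \<forall>x\<in>g. f (c \<cdot>\<^sub>m x) = c * f x) \<and>
    (\<forall>x\<in>g. (\<forall>y\<in>g. f (bracket x y) = 0) \<longrightarrow> x = 0\<^sub>m (2 * n) (2 * n)))"
proof -
  note a = g[unfolded lie_subalgebra_sp_iff]
  let ?V = "module_mat TYPE('a) (2 * n) (2 * n)"
  let ?L = "?V\<lparr>carrier := g\<rparr>"
  interpret V: vectorspace "class_ring :: 'a ring" ?V by (rule matrix_vs)
  have car: "x \<in> carrier_mat (2 * n) (2 * n)" if "x \<in> g" for x using that a sp_carrier by blast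
  let ?k = "\<lambda>f. form_kernel class_ring ?L bracket f"
  have k: "?k f = {x \<in> g. \<forall>y\<in>g. f (bracket x y) = 0}" for f by (simp add: form_kernel_def)
  have sub: "submodule class_ring (?k f) ?V" if f: "f \<in> lie_dual class_ring ?L" for f
  proof (rule submodule.intro[OF V.module_axioms])
    note f' = f[unfolded lie_dual_iff]
    have br: "bracket (v + w) y = bracket v y + bracket w y" "bracket (c \<cdot>\<^sub>m v) y = c \<cdot>\<^sub>m bracket v y"
      if "v \<in> g" "w \<in> g" "y \<in> g" for v w y c
      by (rule bracket_add_left[OF car[OF that(1)] car[OF that(2)] car[OF that(3)]])
        (rule bracket_smult_left[OF car[OF that(1)] car[OF that(3)]])
    show "?k f \<subseteq> carrier ?V" using car by (auto simp: k module_mat_simps)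
    show "v \<oplus>\<^bsub>?V\<^esub> w \<in> ?k f" if "v \<in> ?k f" "w \<in> ?k f" for v w
      using that a f' by (auto simp: k module_mat_simps br(1))
    show sm: "c \<odot>\<^bsub>?V\<^esub> v \<in> ?k f" if "c \<in> carrier class_ring" "v \<in> ?k f" for c v
      using that a f' by (auto simp: k module_mat_simps br(2)[of v v])
    have z: "0\<^sub>m (2 * n) (2 * n) = 0 \<cdot>\<^sub>m (0\<^sub>m (2 * n) (2 * n) :: 'a mat)" by auto
    have "f (bracket (0\<^sub>m (2 * n) (2 * n)) y) = 0" if "y \<in> g" for y
      using a f' that car by (subst z, subst bracket_smult_left[of _ "2 * n"]) auto
    then show "\<zero>\<^bsub>?V\<^esub> \<in> ?k f" using a by (simp add: k module_mat_simps)
  qed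
  have dim: "vectorspace.dim class_ring (?L\<lparr>carrier := ?k f\<rparr>) = 0 \<longleftrightarrow> ?k f = {0\<^sub>m (2 * n) (2 * n)}"
    if "f \<in> lie_dual class_ring ?L" for f
    using matrix_submodule_dim_zero[OF sub[OF that]] by simp
  let ?D = "(\<lambda>f. vectorspace.dim class_ring (?L\<lparr>carrier := ?k f\<rparr>)) ` lie_dual class_ring ?L"
  have "(\<lambda>_. 0) \<in> lie_dual class_ring ?L" by (simp add: lie_dual_iff)
  then have ne: "?D \<noteq> {}" by blast
  have "index_sp n g = 0 \<longleftrightarrow> 0 \<in> ?D"
    unfolding index_sp_def lie_index_def
  proof
    assume "Inf ?D = 0"
    then show "0 \<in> ?D" using Inf_nat_def1[OF ne] by (simp only:)
  next
    assume "0 \<in> ?D"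
    then show "Inf ?D = 0" using cInf_lower[of 0 ?D] by simp
  qed
  also have "\<dots> \<longleftrightarrow> (\<exists>f \<in> lie_dual class_ring ?L. ?k f = {0\<^sub>m (2 * n) (2 * n)})"
    using dim by (force simp: image_iff)
  also have "\<dots> \<longleftrightarrow> (\<exists>f \<in> lie_dual class_ring ?L. \<forall>x\<in>g. (\<forall>y\<in>g. f (bracket x y) = 0) \<longrightarrow> x = 0\<^sub>m (2 * n) (2 * n))"
  proof (rule bex_cong[OF refl])
    fix f assume "f \<in> lie_dual class_ring ?L"
    then have "0\<^sub>m (2 * n) (2 * n) \<in> ?k f" using submodule.zero_closed[OF sub] by (simp add: module_mat_simps)
    then show "?k f = {0\<^sub>m (2 * n) (2 * n)} \<longleftrightarrow> (\<forall>x\<in>g. (\<forall>y\<in>g. f (bracket x y) = 0) \<longrightarrow> x = 0\<^sub>m (2 * n) (2 * n))"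
      unfolding k by blast
  qed
  finally show ?thesis unfolding Bex_def lie_dual_iff by (simp only: conj_assoc)
qed

section \<open>Coordinates on the seaweed\<close>

definition blk :: "nat \<Rightarrow> (nat \<Rightarrow> nat \<Rightarrow> 'a::field) \<Rightarrow> 'a fmat" where
  "blk n h = Fmat (\<lambda>i j. if i < n \<and> j < n then h i j else 0)"

lemma ent_blk: "ent (blk n h) i j = (if i < n \<and> j < n then h i j else 0)"
proof -
  have "\<exists>N. \<forall>i j. (if i < n \<and> j < n then h i j else 0) \<noteq> 0 \<longrightarrow> i < N \<and> j < N"
    by (rule exI[of _ n]) auto
  then have "ent (Fmat (\<lambda>i j. if i < n \<and> j < n then h i j else 0)) = (\<lambda>i j. if i < n \<and> j < n then h i j else 0)"
    by (intro Fmat_inverse) blast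
  then show ?thesis by (simp add: blk_def)
qed

text \<open>The representing matrix collects the values on matrix units, transposed to match the
  trace pairing. Linearity is assumed only on matrices supported in \<open>P\<close>, because the
  functionals at hand are constrained only on the seaweed.\<close>

lemma linear_functional_trace:
  fixes \<phi> :: "'a::field fmat \<Rightarrow> 'a"
  assumes "finite P"
    and add: "\<And>A B. (\<And>i j. ent A i j \<noteq> 0 \<Longrightarrow> (i, j) \<in> P) \<Longrightarrow> (\<And>i j. ent B i j \<noteq> 0 \<Longrightarrow> (i, j) \<in> P) \<Longrightarrow>
      \<phi> (A + B) = \<phi> A + \<phi> B"
    and smul: "\<And>c A. (\<And>i j. ent A i j \<noteq> 0 \<Longrightarrow> (i, j) \<in> P) \<Longrightarrow> \<phi> (c *f A) = c * \<phi> A"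
  shows "\<exists>F. \<forall>A. (\<forall>i j. ent A i j \<noteq> 0 \<longrightarrow> (i, j) \<in> P) \<longrightarrow> \<phi> A = tr (F * A)"
proof -
  define F where "F = (\<Sum>(i, j)\<in>P. \<phi> (munit i j) *f munit j i)"
  have "\<phi> A = tr (F * A)" if A: "\<forall>i j. ent A i j \<noteq> 0 \<longrightarrow> (i, j) \<in> P" for A
  proof -
    have e: "ent (\<Sum>(i, j)\<in>Q. ent A i j *f munit i j) k l = (if (k, l) \<in> Q then ent A k l else 0)"
      if "finite Q" for Q k l
    proof -
      have "ent (\<Sum>(i, j)\<in>Q. ent A i j *f munit i j) k l = (\<Sum>q\<in>Q. if q = (k, l) then ent A k l else 0)"
        unfolding ent_sum by (rule sum.cong) (auto simp: ent_munit split: if_splits)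
      then show ?thesis using that by simp
    qed
    have "\<phi> (\<Sum>(i, j)\<in>Q. ent A i j *f munit i j) = (\<Sum>(i, j)\<in>Q. ent A i j * \<phi> (munit i j))" if "finite Q" "Q \<subseteq> P" for Q
      using that
    proof (induction Q rule: finite_induct)
      case empty
      show ?case using smul[of 0 0] by simp
    next
      case (insert q Q)
      obtain i j where q: "q = (i, j)" "(i, j) \<in> P" using insert.prems by (cases q) auto
      have m: "(k, l) \<in> P" if "ent (munit i j :: 'a fmat) k l \<noteq> 0" for k l
        using that q by (auto simp: ent_munit split: if_splits)
      have "\<phi> (ent A i j *f munit i j + (\<Sum>(i, j)\<in>Q. ent A i j *f munit i j))
          = \<phi> (ent A i j *f munit i j) + \<phi> (\<Sum>(i, j)\<in>Q. ent A i j *f munit i j)"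
        by (rule add) (use m e[OF insert(1)] insert.prems in \<open>auto split: if_splits\<close>)
      then show ?case using insert smul[OF m] by (simp add: q)
    qed
    from this[OF assms(1) subset_refl]
    have "\<phi> (\<Sum>(i, j)\<in>P. ent A i j *f munit i j) = (\<Sum>(i, j)\<in>P. ent A i j * \<phi> (munit i j))" .
    moreover have "(\<Sum>(i, j)\<in>P. ent A i j *f munit i j) = A"
      using A e[OF assms(1)] by (intro fmat_eqI) auto
    moreover have "tr (F * A) = (\<Sum>(i, j)\<in>P. ent A i j * \<phi> (munit i j))"
    proof -
      have "F * A = (\<Sum>q\<in>P. (case q of (i, j) \<Rightarrow> \<phi> (munit i j) *f munit j i) * A)"
        unfolding F_def by (rule sum_distrib_right)
      then have "tr (F * A) = (\<Sum>q\<in>P. tr ((case q of (i, j) \<Rightarrow> \<phi> (munit i j) *f munit j i) * A))"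
        by (simp only: tr_sum)
      also have "\<dots> = (\<Sum>(i, j)\<in>P. ent A i j * \<phi> (munit i j))"
        by (rule sum.cong) (auto simp: tr_comm[of "munit _ _" A] tr_times_munit)
      finally show ?thesis .
    qed
    ultimately show ?thesis by simp
  qed
  then show ?thesis by blast
qed

lemma sum_two_halves:
  fixes h :: "nat \<Rightarrow> 'a::comm_monoid_add"
  shows "(\<Sum>k<2 * n. h k) = (\<Sum>k<n. h k) + (\<Sum>k<n. h (mir n k))"
proof -
  have "{..<2 * n} = {..<n} \<union> {n..<2 * n}" by auto
  then have "(\<Sum>k<2 * n. h k) = (\<Sum>k<n. h k) + (\<Sum>k=n..<2 * n. h k)"
    by (simp add: sum.union_disjoint ivl_disj_int)
  also have "(\<Sum>k=n..<2 * n. h k) = (\<Sum>k<n. h (mir n k))"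
    by (rule sum.reindex_bij_witness[of _ "mir n" "mir n"]) (auto simp: mir_def)
  finally show ?thesis .
qed


lemma fmat_eq_iff: "A = B \<longleftrightarrow> (\<forall>i j. ent A i j = ent B i j)"
  by (auto intro: fmat_eqI)

lemma mir_lt_half: "i < 2 * n \<Longrightarrow> mir n i < n \<longleftrightarrow> \<not> i < n"
  by (auto simp: mir_def)

section \<open>The seaweed as pairs of a block triangular and a symmetric matrix\<close>

abbreviation lv :: "nat \<Rightarrow> nat \<Rightarrow> nat \<Rightarrow> 'a::field fmat set" where
  "lv n a b \<equiv> levi (dg a) (dg (a + b) - dg a) (dg n - dg (a + b))"

lemma levi_iff:
  assumes "a + b \<le> n"
  shows "A \<in> lv n a b \<longleftrightarrow>
    (\<forall>i j. ent A i j \<noteq> 0 \<longrightarrow> i < n \<and> j < n \<and> \<not> (i < a \<and> a \<le> j) \<and> \<not> (i < a + b \<and> a + b \<le> j))"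
proof -
  have e: "dg a + (dg (a + b) - dg a) + (dg n - dg (a + b)) = (dg n :: 'a fmat)"
    "dg a + (dg (a + b) - dg a) = (dg (a + b) :: 'a fmat)" by simp_all
  have "A \<in> lv n a b \<longleftrightarrow> (\<forall>i j. (((if i < n then ent A i j else 0) = ent A i j) \<and>
      ((if j < n then ent A i j else 0) = ent A i j)) \<and>
      (if j < a + b then if i < a then ent A i j else 0 else 0) - (if j < a then if i < a then ent A i j else 0 else 0) = 0 \<and>
      (if j < n then if i < a + b then ent A i j else 0 else 0) -
        (if j < a + b then if i < a + b then ent A i j else 0 else 0) = 0)"
    unfolding levi_def e(1) unfolding e(2) hom_def mem_Collect_eq right_diff_distrib fmat_eq_iff ent_minus ent_dg_left ent_dg_right
      ent_zero all_conj_distrib ..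
  also have "\<dots> \<longleftrightarrow> (\<forall>i j. ent A i j \<noteq> 0 \<longrightarrow> i < n \<and> j < n \<and> \<not> (i < a \<and> a \<le> j) \<and> \<not> (i < a + b \<and> a + b \<le> j))"
    by (intro all_cong1) (use assms in auto)
  finally show ?thesis .
qed

lemma symm_iff:
  assumes "c \<le> n"
  shows "B \<in> symm (dg n - dg c) \<longleftrightarrow>
    (\<forall>i j. ent B i j \<noteq> 0 \<longrightarrow> c \<le> i \<and> i < n \<and> c \<le> j \<and> j < n) \<and> tp B = B"
proof -
  have "B \<in> symm (dg n - dg c) \<longleftrightarrow> (\<forall>i j.
      (if i < n then ent B i j else 0) - (if i < c then ent B i j else 0) = ent B i j \<and>
      (if j < n then ent B i j else 0) - (if j < c then ent B i j else 0) = ent B i j) \<and> tp B = B"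
    unfolding symm_def hom_def mem_Collect_eq right_diff_distrib left_diff_distrib fmat_eq_iff[of _ B]
      ent_minus ent_dg_left ent_dg_right all_conj_distrib ..
  also have "(\<forall>i j. (if i < n then ent B i j else 0) - (if i < c then ent B i j else 0) = ent B i j \<and>
      (if j < n then ent B i j else 0) - (if j < c then ent B i j else 0) = ent B i j) \<longleftrightarrow>
      (\<forall>i j. ent B i j \<noteq> 0 \<longrightarrow> c \<le> i \<and> i < n \<and> c \<le> j \<and> j < n)"
    by (intro all_cong1) (use assms in auto)
  finally show ?thesis .
qed

definition ul :: "nat \<Rightarrow> 'a::field mat \<Rightarrow> 'a fmat" where
  "ul n x = blk n (\<lambda>i j. x $$ (i, j))"

text \<open>Reversing the columns turns symmetry about the antidiagonal into ordinary symmetry, so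
  that \<open>tp\<close> applies.\<close>

definition ur :: "nat \<Rightarrow> 'a::field mat \<Rightarrow> 'a fmat" where
  "ur n x = blk n (\<lambda>i j. x $$ (i, mir n j))"

definition glue :: "nat \<Rightarrow> 'a::field fmat \<Rightarrow> 'a fmat \<Rightarrow> 'a mat" where
  "glue n A B = mat (2 * n) (2 * n) (\<lambda>(i, j). if i < n then if j < n then ent A i j else ent B i (mir n j)
     else if j < n then 0 else - ent A (mir n j) (mir n i))"

definition two_block :: "nat \<Rightarrow> nat \<Rightarrow> nat \<Rightarrow> 'a::field mat set" where
  "two_block n a b = pplus n {n} \<inter> pminus n {a, a + b}"

lemma ent_ul: "ent (ul n x) i j = (if i < n \<and> j < n then x $$ (i, j) else 0)"
  and ent_ur: "ent (ur n x) i j = (if i < n \<and> j < n then x $$ (i, mir n j) else 0)"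
  by (simp_all add: ul_def ur_def ent_blk)

lemma glue_carrier [simp]: "glue n A B \<in> carrier_mat (2 * n) (2 * n)"
  by (simp add: glue_def)

lemma glue_entry: "i < 2 * n \<Longrightarrow> j < 2 * n \<Longrightarrow> glue n A B $$ (i, j) =
    (if i < n then if j < n then ent A i j else ent B i (mir n j)
     else if j < n then 0 else - ent A (mir n j) (mir n i))"
  by (simp add: glue_def)

lemma ul_linear:
  assumes "x \<in> carrier_mat (2 * n) (2 * n)" "y \<in> carrier_mat (2 * n) (2 * n)"
  shows "ul n (x + y) = ul n x + ul n y" "ur n (x + y) = ur n x + ur n y"
    "ul n (c \<cdot>\<^sub>m x) = c *f ul n x" "ur n (c \<cdot>\<^sub>m x) = c *f ur n x"
  using assms by (auto intro!: fmat_eqI simp: ent_ul ent_ur)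

lemma glue_add: "glue n (A + A') (B + B') = glue n A B + glue n A' B'"
  by (rule eq_matI) (auto simp: glue_def)

lemma glue_smul: "glue n (c *f A) (c *f B) = c \<cdot>\<^sub>m glue n A B"
  by (rule eq_matI) (auto simp: glue_def)

lemma glue_zero: "glue n 0 0 = 0\<^sub>m (2 * n) (2 * n)"
  by (rule eq_matI) (auto simp: glue_def)

text \<open>The cut at \<open>n\<close> in \<open>pplus\<close> removes the lower left block, the
  cuts at \<open>a\<close> and \<open>a + b\<close> make the upper left block triangular, and the
  latter cut with its mirror confines the upper right block to its last \<open>n - (a + b)\<close>
  rows and, in reversed order, columns.\<close>

lemma two_block_iff:
  assumes "a + b \<le> n"
  shows "x \<in> two_block n a b \<longleftrightarrow> x \<in> sp n \<and> (\<forall>i j. n \<le> i \<and> i < 2 * n \<and> j < n \<longrightarrow> x $$ (i, j) = 0) \<and>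
    ul n x \<in> lv n a b \<and> ur n x \<in> symm (dg n - dg (a + b))"
proof (cases "x \<in> sp n")
  case False
  then show ?thesis by (simp add: two_block_def pplus_def)
next
  case x: True
  have m: "x $$ (i, j) = - x $$ (mir n j, mir n i)" if "n \<le> i" "n \<le> j" "i < 2 * n" "j < 2 * n" for i j
    using sp_entry[OF x that(3,4)] that by (simp add: sg_def)
  have sym: "x $$ (i, mir n j) = x $$ (j, mir n i)" if "i < n" "j < n" for i j
    using sp_entry[OF x, of i "mir n j"] that mir_lt_half[of j n] by (simp add: sg_def)
  show ?thesis
  proof
    assume g: "x \<in> two_block n a b"
    have P: "x $$ (i, j) = 0" if "n \<le> i" "i < 2 * n" "j < n" for i j
    proof -
      have "i < 2 * n" "j < 2 * n" "j < n \<and> n \<le> i \<and> (n \<in> {n} \<or> 2 * n - n \<in> {n})" using that by auto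
      then show ?thesis using g unfolding two_block_def pplus_def by blast
    qed
    have M: "x $$ (i, j) = 0" if "i < c" "c \<le> j" "j < 2 * n" "c = a \<or> c = a + b" for i j c
    proof -
      have "i < 2 * n" "i < c \<and> c \<le> j \<and> (c \<in> {a, a + b} \<or> 2 * n - c \<in> {a, a + b})" using that by auto
      then show ?thesis using g \<open>j < 2 * n\<close> unfolding two_block_def pminus_def by blast
    qed
    have "ul n x \<in> lv n a b"
      unfolding levi_iff[OF assms] ent_ul using M[of _ a] M[of _ "a + b"]
      by (metis linorder_not_less mult_2 trans_less_add1)
    moreover have "ur n x \<in> symm (dg n - dg (a + b))"
      unfolding symm_iff[OF assms]
    proof (intro conjI allI impI)
      show "tp (ur n x) = ur n x" using sym by (auto intro!: fmat_eqI simp: ent_ur)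
      have z: "x $$ (i, mir n j) = 0" if "i < a + b" "i < n" "j < n" for i j
        by (rule M[of _ "a + b"]) (use that assms in \<open>auto simp: mir_def\<close>)
      fix i j assume e: "ent (ur n x) i j \<noteq> 0"
      then show ij: "i < n" "j < n" by (auto simp: ent_ur split: if_splits)
      show "a + b \<le> i" using e z[of i j] ij by (simp add: ent_ur) (meson not_le)
      show "a + b \<le> j" using e z[of j i] sym[of i j] ij by (simp add: ent_ur) (meson not_le)
    qed
    ultimately show "x \<in> sp n \<and> (\<forall>i j. n \<le> i \<and> i < 2 * n \<and> j < n \<longrightarrow> x $$ (i, j) = 0) \<and>
      ul n x \<in> lv n a b \<and> ur n x \<in> symm (dg n - dg (a + b))" using x P by blast
  next
    assume h: "x \<in> sp n \<and> (\<forall>i j. n \<le> i \<and> i < 2 * n \<and> j < n \<longrightarrow> x $$ (i, j) = 0) \<and>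
      ul n x \<in> lv n a b \<and> ur n x \<in> symm (dg n - dg (a + b))"
    have A0: "x $$ (i, j) = 0" if "i < n" "j < n" "i < a \<and> a \<le> j \<or> i < a + b \<and> a + b \<le> j" for i j
    proof (rule ccontr)
      assume "x $$ (i, j) \<noteq> 0"
      then have "ent (ul n x) i j \<noteq> 0" using that by (simp add: ent_ul)
      then show False using h that(3) unfolding levi_iff[OF assms] by blast
    qed
    have B0: "x $$ (i, j) = 0" if "i < n" "n \<le> j" "j < 2 * n" "i < a + b \<or> mir n j < a + b" for i j
    proof (rule ccontr)
      assume "x $$ (i, j) \<noteq> 0"
      then have "ent (ur n x) i (mir n j) \<noteq> 0" using that mir_lt_half[of j n] by (simp add: ent_ur)
      then have "a + b \<le> i" "a + b \<le> mir n j" using h unfolding symm_iff[OF assms] by blast+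
      then show False using that(4) by linarith
    qed
    have "x \<in> pplus n {n}"
      unfolding pplus_def mem_Collect_eq
    proof (intro conjI allI impI)
      fix i j c assume "i < 2 * n" "j < 2 * n" "j < c \<and> c \<le> i \<and> (c \<in> {n} \<or> 2 * n - c \<in> {n})"
      moreover from this have "c = n" by auto
      ultimately show "x $$ (i, j) = 0" using h by auto
    qed (rule x)
    moreover have "x \<in> pminus n {a, a + b}"
      unfolding pminus_def mem_Collect_eq
    proof (intro conjI allI impI)
      fix i j c assume ij: "i < 2 * n" "j < 2 * n" and c: "i < c \<and> c \<le> j \<and> (c \<in> {a, a + b} \<or> 2 * n - c \<in> {a, a + b})"
      consider "j < n" | "i < n" "n \<le> j" | "n \<le> i" using not_less by blast
      then show "x $$ (i, j) = 0"
      proof cases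
        case 1
        then show ?thesis using c assms by (intro A0) auto
      next
        case 2
        then show ?thesis using c assms ij by (intro B0) (auto simp: mir_def)
      next
        case 3
        have "x $$ (mir n j, mir n i) = 0"
          by (rule A0) (use 3 c assms ij in \<open>auto simp: mir_def\<close>)
        then show ?thesis using m 3 c ij by simp
      qed
    qed (rule x)
    ultimately show "x \<in> two_block n a b" by (simp add: two_block_def)
  qed
qed

lemma ul_glue:
  assumes "\<And>i j. ent A i j \<noteq> 0 \<Longrightarrow> i < n \<and> j < n"
  shows "ul n (glue n A B) = A"
proof (rule fmat_eqI)
  fix i j
  show "ent (ul n (glue n A B)) i j = ent A i j"
    using assms[of i j] by (cases "i < n \<and> j < n") (auto simp: ent_ul glue_entry)
qed

lemma ur_glue:
  assumes "\<And>i j. ent B i j \<noteq> 0 \<Longrightarrow> i < n \<and> j < n"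
  shows "ur n (glue n A B) = B"
proof (rule fmat_eqI)
  fix i j
  show "ent (ur n (glue n A B)) i j = ent B i j"
    using assms[of i j] mir_lt_half[of j n] by (cases "i < n \<and> j < n") (auto simp: ent_ur glue_entry)
qed

lemma glue_sp:
  assumes "tp B = B"
  shows "glue n A B \<in> sp n"
proof (rule spI)
  have s: "ent B i j = ent B j i" for i j using arg_cong[OF assms, of "\<lambda>M. ent M j i"] by simp
  fix i j assume ij: "i < 2 * n" "j < 2 * n"
  show "glue n A B $$ (mir n j, mir n i) = - (sg n i * sg n j * glue n A B $$ (i, j))"
    using ij mir_lt_half[of i n] mir_lt_half[of j n] s[of "mir n j" i]
    by (cases "i < n"; cases "j < n") (simp_all add: glue_entry sg_def)
qed simp

lemma glue_two_block:
  assumes n: "a + b \<le> n" and A: "A \<in> lv n a b" and B: "B \<in> symm (dg n - dg (a + b))"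
  shows "glue n A B \<in> two_block n a b" "ul n (glue n A B) = A" "ur n (glue n A B) = B"
proof -
  show u: "ul n (glue n A B) = A" by (rule ul_glue) (use A levi_iff[OF n] in blast)
  show v: "ur n (glue n A B) = B" by (rule ur_glue) (use B symm_iff[OF n] in blast)
  have "tp B = B" using B by (simp add: symm_def)
  then show "glue n A B \<in> two_block n a b"
    unfolding two_block_iff[OF n] u v using A B glue_sp by (auto simp: glue_entry)
qed

lemma glue_ul_ur:
  assumes n: "a + b \<le> n" and x: "x \<in> two_block n a b"
  shows "glue n (ul n x) (ur n x) = x"
proof (rule eq_matI)
  note h = x[unfolded two_block_iff[OF n]]
  then have s: "x \<in> sp n" by blast
  note c = sp_carrier[OF s]
  fix i j assume "i < dim_row x" "j < dim_col x"
  then have ij: "i < 2 * n" "j < 2 * n" using c by auto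
  have "x $$ (mir n j, mir n i) = - x $$ (i, j)" if "\<not> i < n" "\<not> j < n"
    using sp_entry[OF s ij] that by (simp add: sg_def)
  then show "glue n (ul n x) (ur n x) $$ (i, j) = x $$ (i, j)"
    using ij mir_lt_half[of i n] mir_lt_half[of j n] h
    by (cases "i < n"; cases "j < n") (simp_all add: glue_entry ent_ul ent_ur)
qed (use sp_carrier[of x n] x[unfolded two_block_iff[OF n]] in \<open>auto simp: glue_def\<close>)

text \<open>The isomorphism with the semidirect product. The lower right block of a member is minus
  the mirrored transpose of the upper left one; summing over the second half of the indices
  therefore produces the terms with \<open>tp\<close>.\<close>

lemma bracket_blocks:
  assumes n: "a + b \<le> n" and x: "x \<in> two_block n a b" and y: "y \<in> two_block n a b"
  shows "ul n (bracket x y) = ul n x * ul n y - ul n y * ul n x"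
    "ur n (bracket x y) = ul n x * ur n y - ur n x * tp (ul n y) - ul n y * ur n x + ur n y * tp (ul n x)"
proof -
  have sp: "x \<in> sp n" "y \<in> sp n" using x y by (simp_all add: two_block_iff[OF n])
  note c = sp_carrier[OF sp(1)] sp_carrier[OF sp(2)]
  have supp: "k < n" if "ent (ul n z) i k \<noteq> 0 \<or> ent (ur n z) i k \<noteq> 0" for z :: "'a mat" and i k
    using that by (auto simp: ent_ul ent_ur split: if_splits)
  have t: "ent (ul n z * M) i j = (\<Sum>k<n. ent (ul n z) i k * ent M k j)"
    "ent (ur n z * M) i j = (\<Sum>k<n. ent (ur n z) i k * ent M k j)" for z :: "'a mat" and M i j
    by (rule ent_times_bound; use supp in blast)+
  have d: "z $$ (mir n k, j) = 0" "z $$ (mir n k, mir n j) = - z $$ (j, k)"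
    if z: "z \<in> two_block n a b" and "j < n" "k < n" for z :: "'a mat" and j k
  proof -
    have "n \<le> mir n k" "mir n k < 2 * n" using that by (auto simp: mir_def)
    then show "z $$ (mir n k, j) = 0" using z that by (simp add: two_block_iff[OF n])
    have "z \<in> sp n" using z by (simp add: two_block_iff[OF n])
    then show "z $$ (mir n k, mir n j) = - z $$ (j, k)" using sp_entry[of z n j k] that by (simp add: sg_def)
  qed
  show "ul n (bracket x y) = ul n x * ul n y - ul n y * ul n x"
  proof (rule fmat_eqI)
    fix i j
    have p: "ent (ul n z * ul n w) i j = (if i < n \<and> j < n then \<Sum>k<n. z $$ (i, k) * w $$ (k, j) else 0)" for z w :: "'a mat"
      by (cases "i < n \<and> j < n") (auto simp: t ent_ul intro!: sum.cong sum.neutral)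
    show "ent (ul n (bracket x y)) i j = ent (ul n x * ul n y - ul n y * ul n x) i j"
    proof (cases "i < n \<and> j < n")
      case True
      then have "i < 2 * n" "j < 2 * n" by auto
      note b = bracket_entry[OF c this]
      show ?thesis using True by (simp add: ent_ul p b sum_two_halves d[OF x] d[OF y])
    next
      case False
      then show ?thesis by (auto simp: ent_ul p)
    qed
  qed
  show "ur n (bracket x y) = ul n x * ur n y - ur n x * tp (ul n y) - ul n y * ur n x + ur n y * tp (ul n x)"
  proof (rule fmat_eqI)
    fix i j
    have p: "ent (ul n z * ur n w) i j = (if i < n \<and> j < n then \<Sum>k<n. z $$ (i, k) * w $$ (k, mir n j) else 0)"
      "ent (ur n z * tp (ul n w)) i j = (if i < n \<and> j < n then \<Sum>k<n. z $$ (i, mir n k) * w $$ (j, k) else 0)"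
      for z w :: "'a mat"
      by (cases "i < n \<and> j < n"; auto simp: t ent_ul ent_ur intro!: sum.cong sum.neutral)+
    show "ent (ur n (bracket x y)) i j
      = ent (ul n x * ur n y - ur n x * tp (ul n y) - ul n y * ur n x + ur n y * tp (ul n x)) i j"
    proof (cases "i < n \<and> j < n")
      case True
      then have "i < 2 * n" "mir n j < 2 * n" by (auto simp: mir_def)
      note b = bracket_entry[OF c this]
      show ?thesis using True by (simp add: ent_ur p b sum_two_halves d[OF x] d[OF y] sum_negf)
    next
      case False
      then show ?thesis by (auto simp: ent_ur p)
    qed
  qed
qed

lemma two_block_subalgebra: "lie_subalgebra_sp n (two_block n a b :: 'a::field mat set)"
proof -
  have "lie_subalgebra_sp n (pplus n {n} :: 'a mat set)"
    using lie_subalgebra_sp_transpose[OF pminus_subalgebra] by (simp only: transpose_pminus)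
  then show ?thesis
    using pminus_subalgebra[of n "{a, a + b}", where 'a = 'a]
    unfolding lie_subalgebra_sp_iff two_block_def by blast
qed

lemma two_block_functional:
  fixes f :: "'a::field_char_0 mat \<Rightarrow> 'a"
  assumes n: "a + b \<le> n"
    and add: "\<And>x y. x \<in> two_block n a b \<Longrightarrow> y \<in> two_block n a b \<Longrightarrow> f (x + y) = f x + f y"
    and hom: "\<And>c x. x \<in> two_block n a b \<Longrightarrow> f (c \<cdot>\<^sub>m x) = c * f x"
  shows "\<exists>F S. \<forall>x \<in> two_block n a b. f x = tr (F * ul n x) + tr (S * ur n x)"
proof -
  let ?P = "{(i, j). i < n \<and> j < n \<and> \<not> (i < a \<and> a \<le> j) \<and> \<not> (i < a + b \<and> a + b \<le> j)}"
  let ?Q = "{(i, j). a + b \<le> i \<and> i < n \<and> a + b \<le> j \<and> j < n}"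
  have fin: "finite ?P" "finite ?Q" by (rule finite_subset[of _ "{..<n} \<times> {..<n}"]; auto)+
  have z: "0 \<in> lv n a b" "0 \<in> symm (dg n - dg (a + b))" by (simp_all add: levi_def symm_def)
  note G = glue_two_block[OF n]
  have P: "A \<in> lv n a b" if "\<And>i j. ent A i j \<noteq> 0 \<Longrightarrow> (i, j) \<in> ?P" for A :: "'a fmat"
    using that unfolding levi_iff[OF n] by blast
  have Q: "B + tp B \<in> symm (dg n - dg (a + b))" if "\<And>i j. ent B i j \<noteq> 0 \<Longrightarrow> (i, j) \<in> ?Q" for B :: "'a fmat"
    unfolding symm_iff[OF n]
  proof (intro conjI allI impI)
    fix i j assume "ent (B + tp B) i j \<noteq> 0"
    then have "ent B i j \<noteq> 0 \<or> ent B j i \<noteq> 0" by auto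
    then have "(i, j) \<in> ?Q \<or> (j, i) \<in> ?Q" using that by blast
    then show "a + b \<le> i" "i < n" "a + b \<le> j" "j < n" by auto
  qed (simp add: add.commute)
  have "\<exists>F. \<forall>A. (\<forall>i j. ent A i j \<noteq> 0 \<longrightarrow> (i, j) \<in> ?P) \<longrightarrow> f (glue n A 0) = tr (F * A)"
  proof (rule linear_functional_trace[OF fin(1)])
    fix A B :: "'a fmat" and c
    assume "\<And>i j. ent A i j \<noteq> 0 \<Longrightarrow> (i, j) \<in> ?P"
    note A = P[OF this]
    show "f (glue n (c *f A) 0) = c * f (glue n A 0)"
      using hom[OF G(1)[OF A z(2)]] glue_smul[of n c A 0] by simp
    assume "\<And>i j. ent B i j \<noteq> 0 \<Longrightarrow> (i, j) \<in> ?P"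
    note B = P[OF this]
    show "f (glue n (A + B) 0) = f (glue n A 0) + f (glue n B 0)"
      using add[OF G(1)[OF A z(2)] G(1)[OF B z(2)]] glue_add[of n A B 0 0] by simp
  qed
  then obtain F where F: "\<And>A. A \<in> lv n a b \<Longrightarrow> f (glue n A 0) = tr (F * A)"
    unfolding levi_iff[OF n] by auto
  \<comment> \<open>Evaluating on \<open>B + tp B\<close> makes the functional linear in a
    \<open>B\<close> free of symmetry constraints; the resulting factor 2 on symmetric matrices is
    compensated by halving \<open>S\<close>.\<close>
  have "\<exists>S. \<forall>B. (\<forall>i j. ent B i j \<noteq> 0 \<longrightarrow> (i, j) \<in> ?Q) \<longrightarrow> f (glue n 0 (B + tp B)) = tr (S * B)"
  proof (rule linear_functional_trace[OF fin(2)])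
    fix A B :: "'a fmat" and c
    assume "\<And>i j. ent A i j \<noteq> 0 \<Longrightarrow> (i, j) \<in> ?Q"
    note A = Q[OF this]
    have "c *f A + tp (c *f A) = c *f (A + tp A)" by (simp add: smul_add)
    then show "f (glue n 0 (c *f A + tp (c *f A))) = c * f (glue n 0 (A + tp A))"
      using hom[OF G(1)[OF z(1) A]] glue_smul[of n c 0 "A + tp A"] by (simp only: smul_zero)
    assume "\<And>i j. ent B i j \<noteq> 0 \<Longrightarrow> (i, j) \<in> ?Q"
    note B = Q[OF this]
    have "A + B + tp (A + B) = (A + tp A) + (B + tp B)" by simp
    then show "f (glue n 0 (A + B + tp (A + B))) = f (glue n 0 (A + tp A)) + f (glue n 0 (B + tp B))"
      using add[OF G(1)[OF z(1) A] G(1)[OF z(1) B]] glue_add[of n 0 0 "A + tp A" "B + tp B"]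
      by (simp only: add_0_left)
  qed
  then obtain S where S: "\<And>B. (\<And>i j. ent B i j \<noteq> 0 \<Longrightarrow> (i, j) \<in> ?Q) \<Longrightarrow> f (glue n 0 (B + tp B)) = tr (S * B)"
    by blast
  have "f x = tr (F * ul n x) + tr (((1 / 2) *f S) * ur n x)" if x: "x \<in> two_block n a b" for x
  proof -
    have u: "ul n x \<in> lv n a b" and v: "ur n x \<in> symm (dg n - dg (a + b))"
      using x unfolding two_block_iff[OF n] by blast+
    let ?B = "(1 / 2) *f ur n x"
    have "ent ?B i j \<noteq> 0 \<Longrightarrow> (i, j) \<in> ?Q" for i j using v[unfolded symm_iff[OF n]] by auto
    then have "f (glue n 0 (?B + tp ?B)) = tr (S * ?B)" by (rule S)
    moreover have "?B + tp ?B = ur n x"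
      using v[unfolded symm_iff[OF n]] by (auto intro!: fmat_eqI)
    ultimately have "f (glue n 0 (ur n x)) = tr (((1 / 2) *f S) * ur n x)" by simp
    moreover have "f x = f (glue n (ul n x) 0) + f (glue n 0 (ur n x))"
      using add[OF G(1)[OF u z(2)] G(1)[OF z(1) v]] glue_add[of n "ul n x" 0 0 "ur n x"] glue_ul_ur[OF n x] by simp
    ultimately show ?thesis using F[OF u] by simp
  qed
  then show ?thesis by blast
qed

lemma index_two_block:
  assumes n: "a + b \<le> n"
  shows "index_sp n (two_block n a b :: 'a::field_char_0 mat set) = 0 \<longleftrightarrow>
    frobG (dg a :: 'a fmat) (dg (a + b) - dg a) (dg n - dg (a + b))"
proof -
  let ?G = "two_block n a b :: 'a mat set"
  let ?Z = "symm (dg n - dg (a + b)) :: 'a fmat set"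
  note G = glue_two_block[OF n]
  have mem: "ul n x \<in> lv n a b" "ur n x \<in> ?Z" if "x \<in> ?G" for x using that unfolding two_block_iff[OF n] by blast+
  have car: "x \<in> carrier_mat (2 * n) (2 * n)" if "x \<in> ?G" for x
    using that sp_carrier unfolding two_block_iff[OF n] by blast
  have cl: "bracket x y \<in> ?G" if "x \<in> ?G" "y \<in> ?G" for x y
    using two_block_subalgebra that unfolding lie_subalgebra_sp_iff by blast
  have z: "ul n (0\<^sub>m (2 * n) (2 * n)) = (0 :: 'a fmat)" "ur n (0\<^sub>m (2 * n) (2 * n)) = (0 :: 'a fmat)"
    by (auto intro!: fmat_eqI simp: ent_ul ent_ur)
  show ?thesis
    unfolding index_sp_zero_iff[OF two_block_subalgebra]
  proof
    assume "\<exists>f. (\<forall>x\<in>?G. \<forall>y\<in>?G. f (x + y) = f x + f y) \<and> (\<forall>c. \<forall>x\<in>?G. f (c \<cdot>\<^sub>m x) = c * f x) \<and>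
      (\<forall>x\<in>?G. (\<forall>y\<in>?G. f (bracket x y) = 0) \<longrightarrow> x = 0\<^sub>m (2 * n) (2 * n))"
    then obtain f where f: "\<And>x y. x \<in> ?G \<Longrightarrow> y \<in> ?G \<Longrightarrow> f (x + y) = f x + f y"
      "\<And>c x. x \<in> ?G \<Longrightarrow> f (c \<cdot>\<^sub>m x) = c * f x"
      and k: "\<And>x. x \<in> ?G \<Longrightarrow> (\<And>y. y \<in> ?G \<Longrightarrow> f (bracket x y) = 0) \<Longrightarrow> x = 0\<^sub>m (2 * n) (2 * n)" by blast
    obtain F S where FS: "\<And>x. x \<in> ?G \<Longrightarrow> f x = tr (F * ul n x) + tr (S * ur n x)"
      using two_block_functional[OF n f] by blast
    show "frobG (dg a :: 'a fmat) (dg (a + b) - dg a) (dg n - dg (a + b))"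
      unfolding frobG_def
    proof (intro exI ballI impI)
      fix A B assume A: "A \<in> lv n a b" and B: "B \<in> ?Z"
        and K: "\<forall>A' \<in> lv n a b. \<forall>B' \<in> ?Z.
          tr (F * (A * A' - A' * A)) + tr (S * (A * B' - B * tp A' - A' * B + B' * tp A)) = 0"
      note g = G[OF A B]
      have "f (bracket (glue n A B) y) = 0" if y: "y \<in> ?G" for y
        unfolding FS[OF cl[OF g(1) y]] bracket_blocks[OF n g(1) y] g(2,3) using K mem[OF y] by blast
      then have "glue n A B = 0\<^sub>m (2 * n) (2 * n)" by (rule k[OF g(1)])
      then show "A = 0 \<and> B = 0" using g(2,3) z by metis
    qed
  next
    assume "frobG (dg a :: 'a fmat) (dg (a + b) - dg a) (dg n - dg (a + b))"
    then obtain F S where K: "\<And>A B. A \<in> lv n a b \<Longrightarrow> B \<in> ?Z \<Longrightarrow> (\<And>A' B'. A' \<in> lv n a b \<Longrightarrow> B' \<in> ?Z \<Longrightarrow>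
        tr (F * (A * A' - A' * A)) + tr (S * (A * B' - B * tp A' - A' * B + B' * tp A)) = 0) \<Longrightarrow> A = 0 \<and> B = 0"
      unfolding frobG_def by blast
    let ?f = "\<lambda>x. tr (F * ul n x) + tr (S * ur n x)"
    have "x = 0\<^sub>m (2 * n) (2 * n)" if x: "x \<in> ?G" and k: "\<forall>y\<in>?G. ?f (bracket x y) = 0" for x
    proof -
      have "ul n x = 0 \<and> ur n x = 0"
      proof (rule K[OF mem[OF x]])
        fix A' :: "'a fmat" and B' :: "'a fmat" assume "A' \<in> lv n a b" "B' \<in> ?Z"
        note g = G[OF this]
        show "tr (F * (ul n x * A' - A' * ul n x)) +
            tr (S * (ul n x * B' - ur n x * tp A' - A' * ur n x + B' * tp (ul n x))) = 0"
          using bspec[OF k g(1)] unfolding bracket_blocks[OF n x g(1)] g(2,3) .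
      qed
      then show ?thesis using glue_ul_ur[OF n x] glue_zero by metis
    qed
    moreover have "?f (x + y) = ?f x + ?f y" if "x \<in> ?G" "y \<in> ?G" for x y
      by (simp add: ul_linear(1,2)[OF car[OF that(1)] car[OF that(2)]] distrib_left)
    moreover have "?f (c \<cdot>\<^sub>m x) = c * ?f x" if "x \<in> ?G" for c x
      by (simp add: ul_linear(3,4)[OF car[OF that] car[OF that]] distrib_left)
    ultimately show "\<exists>f. (\<forall>x\<in>?G. \<forall>y\<in>?G. f (x + y) = f x + f y) \<and> (\<forall>c. \<forall>x\<in>?G. f (c \<cdot>\<^sub>m x) = c * f x) \<and>
      (\<forall>x\<in>?G. (\<forall>y\<in>?G. f (bracket x y) = 0) \<longrightarrow> x = 0\<^sub>m (2 * n) (2 * n))"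
      by (intro exI[of _ ?f] conjI) blast+
  qed
qed

theorem theorem5p6:
  fixes n a b :: nat
  assumes "0 < a" and "0 < b" and "0 < n" and "a + b \<le> n"
  shows "index_sp n (seaweed_C n [n] [a, b] :: 'a::{alg_closed_field, field_char_0} mat set) = 0
    \<longleftrightarrow> (a + b = n - 1 \<and> gcd (a + b) (b + 1) = 1)
      \<or> (a + b = n - 2 \<and> gcd (a + b) (b + 2) = 1)
      \<or> (a + b = n - 3 \<and> odd n \<and> odd a \<and> odd b \<and> gcd (a + b) (b + 3) = 2)"
proof -
  let ?q = "dg a :: 'a fmat" and ?p = "dg (a + b) - dg a :: 'a fmat" and ?s = "dg n - dg (a + b) :: 'a fmat"
  have m: "min a (a + b) = a" "min (a + b) a = a" "min (a + b) n = a + b" "min n (a + b) = a + b"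
    "min a n = a" "min n a = a" using assms(4) by auto
  have "index_sp n (seaweed_C n [n] [a, b] :: 'a mat set) = 0 \<longleftrightarrow> frobG ?q ?p ?s"
    unfolding seaweed_C_two[OF assms(1,2,4)] two_block_def[symmetric] by (rule index_two_block[OF assms(4)])
  also have "\<dots> \<longleftrightarrow> condH a b (n - (a + b))"
    by (rule frobG_criterion)
      (use assms(1,4) in \<open>simp_all add: left_diff_distrib right_diff_distrib dg_times_dg m of_nat_diff\<close>)
  also have "\<dots> \<longleftrightarrow> (a + b = n - 1 \<and> gcd (a + b) (b + 1) = 1)
      \<or> (a + b = n - 2 \<and> gcd (a + b) (b + 2) = 1)
      \<or> (a + b = n - 3 \<and> odd n \<and> odd a \<and> odd b \<and> gcd (a + b) (b + 3) = 2)"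
  proof -
    \<comment> \<open>Truncated subtraction is harmless: positivity of \<open>a\<close> and
      \<open>b\<close> rules out \<open>a + b = 0\<close>, and \<open>a + b \<le> n\<close>.\<close>
    have "n - (a + b) = 1 \<longleftrightarrow> a + b = n - 1" "n - (a + b) = 2 \<longleftrightarrow> a + b = n - 2"
      "n - (a + b) = 3 \<longleftrightarrow> a + b = n - 3" using assms by arith+
    moreover have "odd n" if "a + b = n - 3" "odd a" "odd b"
    proof -
      have e: "n = a + b + 3" using that(1) assms by arith
      show ?thesis unfolding e using that(2,3) by simp
    qed
    ultimately show ?thesis unfolding condH_def by blast
  qed
  finally show ?thesis .
qed

end
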